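(* Let $U^0,X$ be $L^2[0,1]$-valued random variables with $\mathbb{E}(U^0\mid X)=0$ a.s., let $\delta(X)$ be an $L^2[0,1]$-valued function of $X$, let $r_n$, $n\ge1$, be a sequence of real numbers that either decreases to zero or satisfies $r_n\equiv1$, and consider the sequence of alternatives $$H_{1n}:\ U=U^0+r_n\delta(X),\qquad n\ge1 .$$ Suppose that: (a) The following hold. (a1) $(U^0_1,X_1),\dots,(U^0_n,X_n)$ are independent draws from $(U^0,X)$, $\mathbb{E}\|U^0\|^8<\infty$, and there exists $\varrho>0$ such that $\mathbb{E}[\exp(\varrho\|X\|)]<\infty$. (a2) For any $p\ge1$ and any $\gamma\in\mathcal{S}^p$, the distribution function $F_\gamma$ is continuous. (a3) There exist $\underline{\sigma}^2,C_1,C_2>0$ and $\nu>2$ such that $0<\underline{\sigma}^2\le\mathbb{E}(\langle U^0_1,U^0_2\rangle^2\,\mathbb{I}_{\{|\langle U^0_1,U^0_2\rangle|\le C_1\}}\mid X_1,X_2)$ a.s. and $\mathbb{E}[\|U^0\|^\nu\mid X]\le C_2$. (a4) For any $p\ge1$, $\gamma_0^{(p)}\in B_p\subset\mathcal{S}^p$, the $B_p$ are open subsets of $\mathcal{S}^p$, and $B_p\times0_{p'-p}\subset B_{p'}$ for all $1\le p<p'$, where $0_k$ is the null vector of $\mathbb{R}^k$. (b) $K$ is a continuous density on the real line with $K(x)=K(-x)$, non-increasing on $[0,\infty)$, with integrable Fourier transform; $h\to0$ and $nh^2\to\infty$; $p=p_n\ge1$ increases to infinity with $n$ and there is $\lambda>0$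 such that $p\ln^{-\lambda}n$ is bounded; in addition $nh^4\to\infty$ and there exists a constant $C$ such that $|K(u)-K(v)|\le C|u-v|$ for all $u,v\in\mathbb{R}$. (c) $\alpha_n/\{p\ln n\}\to\infty$ and $r_n^2nh^{1/2}/\alpha_n\to\infty$. (d) $\mathbb{E}[\delta(X)]=0$ and $0<\mathbb{E}[\|\delta(X)\|^8]<\infty$. (e) There exist an integer $\widetilde p$ and $\widetilde\gamma\in B_{\widetilde p}\subset\mathcal{S}^{\widetilde p}$ (independent of $n$) such that $\mathbb{E}[\delta(X)\mid\langle X,\widetilde\gamma\rangle]\ne0$ (i.e. it is not a.s. zero) and, for all $t\in[0,1]$, the Fourier transform of $\overline\delta(t,\cdot)=\mathbb{E}[\delta(X)(t)\mid F_{\widetilde\gamma}(\langle X,\widetilde\gamma\rangle)=\cdot]$ is integrable. Then the test based on $T_n$ is consistent against the sequence of alternatives $H_{1n}$: for every $a\in(0,1)$, $\mathbb{P}(T_n\ge z_{1-a})\to1$ under $H_{1n}$, where $z_{1-a}$ is the $(1-a)$-quantile of the standard normal distribution.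
   Context: $\langle\cdot,\cdot\rangle$, $\|\cdot\|$: inner product and norm of $L^2[0,1]$. $\{\psi_1,\psi_2,\dots\}$ is a fixed orthonormal basis of $L^2[0,1]$. It is supposed (normalization) that $\mathbb{E}[X(t)]=0$ for all $t$. $\mathcal{S}^p=\{\gamma\in\mathbb{R}^p:\|\gamma\|=1\}$. For $\gamma\in\mathbb{R}^p$, $\langle X,\gamma\rangle=\sum_{j=1}^p\langle X,\psi_j\rangle\gamma_j$, $F_\gamma$ is the distribution function of $\langle X,\gamma\rangle$, and $F_{\gamma,n}$ is the empirical distribution function of $\langle X_1,\gamma\rangle,\dots,\langle X_n,\gamma\rangle$; ties are broken by comparing indices (if $\langle X_i,\gamma\rangle=\langle X_j,\gamma\rangle$ and $i<j$, then $F_{\gamma,n}(\langle X_i,\gamma\rangle)<F_{\gamma,n}(\langle X_j,\gamma\rangle)$), so the values $F_{\gamma,n}(\langle X_i,\gamma\rangle)$, $1\le i\le n$, are a permutation of $1/n,\dots,n/n$. Under $H_{1n}$ the observed sample of size $n$ is $(U_i,X_i)$, $1\le i\le n$, with $U_i=U_i^0+r_n\delta(X_i)$. The bandwidth $h=h_n>0$ and dimension $p=p_n$ depend on $n$; $\alpha_n>0$; $K_h(\cdot)=K(\cdot/h)$. For $\gamma\in\mathcal{S}^p$, $$Q_n(\gamma)=\frac{1}{n(n-1)}\sum_{1\le i\ne j\le n}\langle U_i,U_j\rangle\frac1hK_h\big(F_{\gamma,n}(\langle X_i,\gamma\rangle)-F_{\gamma,n}(\langle X_j,\gamma\rangle)\big),$$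 $$\widehat v_n^2(\gamma)=\frac{2}{n(n-1)h}\sum_{j\ne i}\langle U_i,U_j\rangle^2K_h^2\big(F_{\gamma,n}(\langle X_i,\gamma\rangle)-F_{\gamma,n}(\langle X_j,\gamma\rangle)\big).$$ A sequence $(b_{01},b_{02},\dots)$ of reals with $\sum_jb_{0j}^2<\infty$ is fixed, and for $p$ with $\sum_{j=1}^pb_{0j}^2>0$ (which holds for the $p$ considered), $\gamma_0^{(p)}=(b_{01},\dots,b_{0p})/\|(b_{01},\dots,b_{0p})\|\in\mathcal{S}^p$. The selected direction and test statistic are $$\widehat\gamma_n=\arg\max_{\gamma\in B_p}\Big[nh^{1/2}Q_n(\gamma)/\widehat v_n(\gamma)-\alpha_n\mathbb{I}_{\{\gamma\ne\gamma_0^{(p)}\}}\Big],\qquad T_n=nh^{1/2}\frac{Q_n(\widehat\gamma_n)}{\widehat v_n(\widehat\gamma_n)}.$$ The Fourier transform of an integrable $\phi$ on $\mathbb{R}$ is $\mathcal{F}[\phi](t)=\int_{\mathbb{R}}\phi(x)\exp\{-2\pi itx\}\,dx$; the function $\overline\delta(t,\cdot)$, defined on $[0,1]$, is extended by zero to $\mathbb{R}$. *)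

theory Defs
  imports "HOL-Probability.Probability"
begin

section \<open>The Hilbert space of square-integrable functions on the unit interval\<close>

abbreviation unit_leb :: "real measure" where
  "unit_leb \<equiv> lebesgue_on {0..1}"

definition sq_int :: "(real \<Rightarrow> real) \<Rightarrow> bool" where
  "sq_int f \<longleftrightarrow> f \<in> borel_measurable unit_leb \<and> integrable unit_leb (\<lambda>t. (f t)\<^sup>2)"

lemma prob_space_unit_leb: "prob_space unit_leb"
  by (rule prob_spaceI) (simp add: emeasure_restrict_space)

lemma sq_int_measurable [measurable_dest]: "sq_int f \<Longrightarrow> f \<in> borel_measurable unit_leb"
  by (simp add: sq_int_def)

lemma sq_int_integrable_mult:
  assumes "sq_int f" "sq_int g"
  shows "integrable unit_leb (\<lambda>t. f t * g t)"
proof (rule Bochner_Integration.integrable_bound)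
  show "integrable unit_leb (\<lambda>t. (f t)\<^sup>2 + (g t)\<^sup>2)"
    using assms by (simp add: sq_int_def)
  show "(\<lambda>t. f t * g t) \<in> borel_measurable unit_leb"
    using assms by (auto simp: sq_int_def intro: borel_measurable_times)
  have "\<bar>x * y\<bar> \<le> x\<^sup>2 + y\<^sup>2" for x y :: real
  proof -
    have "0 \<le> (\<bar>x\<bar> - \<bar>y\<bar>)\<^sup>2 + x\<^sup>2 + y\<^sup>2" by simp
    then show ?thesis by (simp add: power2_eq_square algebra_simps abs_mult)
  qed
  then show "AE t in unit_leb. norm (f t * g t) \<le> norm ((f t)\<^sup>2 + (g t)\<^sup>2)"
    by simp
qed

lemma sq_int_zero: "sq_int (\<lambda>_. 0)"
  by (simp add: sq_int_def)

lemma sq_int_add: "sq_int f \<Longrightarrow> sq_int g \<Longrightarrow> sq_int (\<lambda>t. f t + g t)"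
  using sq_int_integrable_mult[of f g]
  by (auto simp: sq_int_def power2_sum mult.assoc)

lemma sq_int_scale: "sq_int f \<Longrightarrow> sq_int (\<lambda>t. c * f t)"
  by (auto simp: sq_int_def power_mult_distrib)

lemma sq_int_diff: "sq_int f \<Longrightarrow> sq_int g \<Longrightarrow> sq_int (\<lambda>t. f t - g t)"
  using sq_int_add[of f "\<lambda>t. (-1) * g t"] sq_int_scale[of g "-1"] by simp

quotient_type l2 = "real \<Rightarrow> real" / partial:
  "\<lambda>f g. sq_int f \<and> sq_int g \<and> (AE t in unit_leb. f t = g t)"
proof (rule part_equivpI)
  show "\<exists>f. sq_int f \<and> sq_int f \<and> (AE t in unit_leb. f t = f t)"
    using sq_int_zero by auto
  show "symp (\<lambda>f g. sq_int f \<and> sq_int g \<and> (AE t in unit_leb. f t = g t))"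
    by (auto simp: symp_def)
  show "transp (\<lambda>f g. sq_int f \<and> sq_int g \<and> (AE t in unit_leb. f t = g t))"
    unfolding transp_def by auto
qed

lift_definition represents :: "(real \<Rightarrow> real) \<Rightarrow> l2 \<Rightarrow> bool" is
  "\<lambda>f g. sq_int f \<and> (AE t in unit_leb. f t = g t)"
  by auto

instantiation l2 :: real_vector
begin

lift_definition zero_l2 :: l2 is "\<lambda>_. 0" by (simp add: sq_int_zero)

lift_definition plus_l2 :: "l2 \<Rightarrow> l2 \<Rightarrow> l2" is "\<lambda>f g t. f t + g t"
  by (auto simp: sq_int_add)

lift_definition minus_l2 :: "l2 \<Rightarrow> l2 \<Rightarrow> l2" is "\<lambda>f g t. f t - g t"
  by (auto simp: sq_int_diff)

lift_definition scaleR_l2 :: "real \<Rightarrow> l2 \<Rightarrow> l2" is "\<lambda>c f t. c * f t"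
  by (auto simp: sq_int_scale)

lift_definition uminus_l2 :: "l2 \<Rightarrow> l2" is "\<lambda>f t. - f t"
  using sq_int_scale[of _ "-1"] by auto

instance
  by standard
    (transfer; auto simp: algebra_simps sq_int_zero intro!: sq_int_add sq_int_diff sq_int_scale
      dest: sq_int_scale[of _ "-1"])+

end

instantiation l2 :: real_inner
begin

lift_definition inner_l2 :: "l2 \<Rightarrow> l2 \<Rightarrow> real" is "\<lambda>f g. integral\<^sup>L unit_leb (\<lambda>t. f t * g t)"
  by (rule integral_cong_AE) (auto simp: sq_int_def)

definition norm_l2 :: "l2 \<Rightarrow> real" where "norm_l2 x = sqrt (inner x x)"
definition sgn_l2 :: "l2 \<Rightarrow> l2" where "sgn_l2 x = x /\<^sub>R norm x"
definition dist_l2 :: "l2 \<Rightarrow> l2 \<Rightarrow> real" where "dist_l2 x y = norm (x - y)"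
definition uniformity_l2 :: "(l2 \<times> l2) filter" where
  "uniformity_l2 = (INF e\<in>{0<..}. principal {(x, y). dist x y < e})"
definition open_l2 :: "l2 set \<Rightarrow> bool" where
  "open_l2 U \<longleftrightarrow> (\<forall>x\<in>U. \<forall>\<^sub>F (x', y) in uniformity. x' = x \<longrightarrow> y \<in> U)"

instance
proof
  fix x y z :: l2 and r :: real
  show "inner x y = inner y x"
    by transfer (simp add: mult.commute)
  show "inner (x + y) z = inner x z + inner y z"
    by transfer (simp add: algebra_simps sq_int_integrable_mult)
  show "inner (r *\<^sub>R x) y = r * inner x y"
    by transfer (simp add: mult.assoc)
  show "0 \<le> inner x x"
    by transfer simp
  show "inner x x = 0 \<longleftrightarrow> x = 0"
  proof transfer
    fix f assume "sq_int f \<and> sq_int f \<and> (AE t in unit_leb. f t = f t)"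
    then have f: "sq_int f" by simp
    have "(integral\<^sup>L unit_leb (\<lambda>t. f t * f t) = 0) = (AE t in unit_leb. f t * f t = 0)"
      by (rule integral_nonneg_eq_0_iff_AE) (use f sq_int_integrable_mult in auto)
    then show "(integral\<^sup>L unit_leb (\<lambda>t. f t * f t) = 0) =
        (sq_int f \<and> sq_int (\<lambda>_. 0) \<and> (AE t in unit_leb. f t = 0))"
      using f sq_int_zero by simp
  qed
qed (simp_all add: norm_l2_def sgn_l2_def dist_l2_def uniformity_l2_def open_l2_def)

end

lemma representsE:
  fixes x :: l2 obtains f where "represents f x" "sq_int f"
proof -
  have "\<exists>f. represents f x"
    by transfer auto
  then obtain f where f: "represents f x" ..
  moreover have "represents f x \<Longrightarrow> sq_int f" by transfer simp
  ultimately show ?thesis using that by blast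
qed

lemma sq_int_represents: "sq_int f \<Longrightarrow> \<exists>x. represents f x"
  by transfer auto

lemma represents_sq_int: "represents f x \<Longrightarrow> sq_int f"
  by transfer simp

lemma represents_diff: "represents f x \<Longrightarrow> represents g y \<Longrightarrow> represents (\<lambda>t. f t - g t) (x - y)"
  by transfer (auto intro: sq_int_diff)

lemma norm_represents:
  assumes "represents f x" shows "(norm x)\<^sup>2 = integral\<^sup>L unit_leb (\<lambda>t. (f t)\<^sup>2)"
  using assms unfolding power2_norm_eq_inner
  by transfer (auto intro!: integral_cong_AE simp: sq_int_def power2_eq_square)


instance l2 :: complete_space
proof
  fix X :: "nat \<Rightarrow> l2" assume X: "Cauchy X"
  have "\<exists>f. \<forall>n. represents (f n) (X n)"
    by (rule choice) (metis representsE)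
  then obtain f where f: "\<And>n. represents (f n) (X n)" by blast
  have sf: "sq_int (f n)" for n using represents_sq_int[OF f] .
  have [measurable]: "f n \<in> borel_measurable unit_leb" for n
    using sf by (simp add: sq_int_def)
  have nn: "(\<integral>\<^sup>+ t. ennreal ((f m t - f n t)\<^sup>2) \<partial>unit_leb) = ennreal ((norm (X m - X n))\<^sup>2)" for m n
    using norm_represents[OF represents_diff[OF f f]] sq_int_diff[OF sf sf, of m n]
    by (subst nn_integral_eq_integral) (auto simp: sq_int_def)
  have "\<exists>N. \<forall>m\<ge>N. \<forall>n\<ge>N. dist (X m) (X n) < (1/2)^k" for k
    using X[unfolded Cauchy_def, rule_format, of "(1/2)^k"] by simp
  then obtain N where N: "\<And>k m n. m \<ge> N k \<Longrightarrow> n \<ge> N k \<Longrightarrow> dist (X m) (X n) < (1/2)^k"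
    by metis
  define s where "s = rec_nat (N 0) (\<lambda>k r. max (Suc r) (N (Suc k)))"
  have s0: "s 0 = N 0" and sS: "s (Suc k) = max (Suc (s k)) (N (Suc k))" for k
    by (simp_all add: s_def)
  have sm: "strict_mono s"
    by (rule strict_monoI_Suc) (simp add: sS)
  have sN: "s k \<ge> N k" for k by (cases k) (simp_all add: s0 sS)
  define D where "D k t = \<bar>f (s (Suc k)) t - f (s k) t\<bar>" for k t
  have [measurable]: "D k \<in> borel_measurable unit_leb" for k
    unfolding D_def by measurable
  have D1: "(\<integral>\<^sup>+ t. ennreal (D k t) \<partial>unit_leb) \<le> ennreal (2 * (1/2)^k)" for k
  proof -
    define e :: real where "e = (1/2)^k"
    have e: "e > 0" by (simp add: e_def)
    have pt: "D k t \<le> e + inverse e * (f (s (Suc k)) t - f (s k) t)\<^sup>2" for t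
    proof -
      have "0 \<le> (D k t - e)\<^sup>2 + e * D k t" using e by (simp add: D_def)
      then have "e * D k t \<le> e * e + (D k t)\<^sup>2"
        by (simp add: power2_eq_square algebra_simps)
      then have "D k t \<le> (e * e + (D k t)\<^sup>2) / e"
        using e by (simp add: field_simps)
      then show ?thesis using e by (simp add: D_def field_simps)
    qed
    have "(\<integral>\<^sup>+ t. ennreal (D k t) \<partial>unit_leb) \<le>
      (\<integral>\<^sup>+ t. ennreal e + ennreal (inverse e) * ennreal ((f (s (Suc k)) t - f (s k) t)\<^sup>2) \<partial>unit_leb)"
      using e pt by (intro nn_integral_mono)
        (simp add: ennreal_mult[symmetric] ennreal_plus[symmetric] del: ennreal_plus)
    also have "\<dots> = ennreal e + ennreal (inverse e) * ennreal ((norm (X (s (Suc k)) - X (s k)))\<^sup>2)"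
      by (subst nn_integral_add) (auto simp: nn_integral_cmult nn emeasure_restrict_space)
    also have "\<dots> \<le> ennreal e + ennreal (inverse e) * ennreal (e\<^sup>2)"
    proof -
      have "norm (X (s (Suc k)) - X (s k)) \<le> e"
        using N[of k "s (Suc k)" "s k"] sN[of k] strict_mono_leD[OF sm, of k "Suc k"]
        by (simp add: dist_norm e_def)
      then show ?thesis
        by (intro add_left_mono mult_left_mono ennreal_leI power_mono) auto
    qed
    also have "\<dots> = ennreal (2 * e)"
      using e by (simp add: ennreal_mult[symmetric] ennreal_plus[symmetric] power2_eq_square field_simps
          del: ennreal_plus)
    finally show ?thesis by (simp add: e_def)
  qed
  have "(\<integral>\<^sup>+ t. (\<Sum>k. ennreal (D k t)) \<partial>unit_leb) = (\<Sum>k. \<integral>\<^sup>+ t. ennreal (D k t) \<partial>unit_leb)"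
    by (rule nn_integral_suminf) measurable
  also have "\<dots> \<le> (\<Sum>k. ennreal (2 * (1/2)^k))"
    by (intro suminf_le D1) auto
  also have "\<dots> = ennreal (\<Sum>k. 2 * (1/2)^k)"
    by (rule suminf_ennreal2) (auto intro!: summable_mult summable_geometric)
  finally have "(\<integral>\<^sup>+ t. (\<Sum>k. ennreal (D k t)) \<partial>unit_leb) \<noteq> \<infinity>"
    by (auto simp: top_unique)
  then have "AE t in unit_leb. (\<Sum>k. ennreal (D k t)) \<noteq> \<infinity>"
    by (intro nn_integral_PInf_AE) auto
  then have "AE t in unit_leb. (\<lambda>k. f (s k) t) \<longlonglongrightarrow> lim (\<lambda>k. f (s k) t)"
  proof eventually_elim
    case (elim t)
    have "summable (\<lambda>k. D k t)"
      by (rule summable_suminf_not_top) (use elim in \<open>simp_all add: D_def\<close>)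
    then have "summable (\<lambda>k. norm (f (s (Suc k)) t - f (s k) t))"
      by (simp add: D_def)
    then have "summable (\<lambda>k. f (s (Suc k)) t - f (s k) t)"
      by (rule summable_norm_cancel)
    then have "convergent (\<lambda>n. \<Sum>k<n. f (s (Suc k)) t - f (s k) t)"
      by (simp add: summable_iff_convergent)
    then have "convergent (\<lambda>n. f (s n) t - f (s 0) t)"
      by (simp add: sum_lessThan_telescope[of "\<lambda>k. f (s k) t"])
    then have "convergent (\<lambda>n. (f (s n) t - f (s 0) t) + f (s 0) t)"
      by (rule convergent_add[OF _ convergent_const])
    then have "convergent (\<lambda>n. f (s n) t)" by simp
    then show ?case by (simp only: convergent_LIMSEQ_iff)
  qed
  moreover define g where "g t = lim (\<lambda>k. f (s k) t)" for t
  ultimately have lim: "AE t in unit_leb. (\<lambda>k. f (s k) t) \<longlonglongrightarrow> g t" by simp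
  have [measurable]: "g \<in> borel_measurable unit_leb"
    unfolding g_def by measurable
  have fatou: "(\<integral>\<^sup>+ t. ennreal ((g t - f (s m) t)\<^sup>2) \<partial>unit_leb) \<le> ennreal (((1/2)^m)\<^sup>2)" for m
  proof -
    have "(\<integral>\<^sup>+ t. ennreal ((g t - f (s m) t)\<^sup>2) \<partial>unit_leb) =
        (\<integral>\<^sup>+ t. liminf (\<lambda>k. ennreal ((f (s k) t - f (s m) t)\<^sup>2)) \<partial>unit_leb)"
    proof (rule nn_integral_cong_AE, use lim in eventually_elim)
      case (elim t)
      then have "(\<lambda>k. ennreal ((f (s k) t - f (s m) t)\<^sup>2)) \<longlonglongrightarrow> ennreal ((g t - f (s m) t)\<^sup>2)"
        by (intro tendsto_ennrealI tendsto_intros)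
      then show ?case
        by (rule lim_imp_Liminf[OF sequentially_bot, symmetric])
    qed
    also have "\<dots> \<le> liminf (\<lambda>k. \<integral>\<^sup>+ t. ennreal ((f (s k) t - f (s m) t)\<^sup>2) \<partial>unit_leb)"
      by (rule nn_integral_liminf) measurable
    also have "\<dots> \<le> ennreal (((1/2)^m)\<^sup>2)"
    proof (rule Liminf_le)
      show "\<forall>\<^sub>F k in sequentially. (\<integral>\<^sup>+ t. ennreal ((f (s k) t - f (s m) t)\<^sup>2) \<partial>unit_leb)
          \<le> ennreal (((1/2)^m)\<^sup>2)"
        using eventually_ge_at_top[of m]
      proof eventually_elim
        case (elim k)
        then have "s m \<le> s k" using sm by (simp add: strict_mono_less_eq)
        then have "norm (X (s k) - X (s m)) \<le> (1/2)^m"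
          using N[of m "s k" "s m"] sN[of m] by (simp add: dist_norm)
        then show ?case unfolding nn by (intro ennreal_leI power_mono) auto
      qed
    qed simp
    finally show ?thesis .
  qed
  have sgf: "sq_int (\<lambda>t. g t - f (s m) t)" for m
    unfolding sq_int_def
  proof
    show "integrable unit_leb (\<lambda>t. (g t - f (s m) t)\<^sup>2)"
      by (rule integrableI_nonneg)
        (use fatou[of m] in \<open>auto simp: top_unique intro: le_less_trans\<close>)
  qed measurable
  have "sq_int g"
    using sq_int_add[OF sgf[of 0] sf[of "s 0"]] by simp
  then obtain x where x: "represents g x"
    using sq_int_represents by blast
  have bnd: "norm (X (s m) - x) \<le> (1/2)^m" for m
  proof -
    have "ennreal ((norm (x - X (s m)))\<^sup>2) \<le> ennreal (((1/2)^m)\<^sup>2)"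
      using fatou[of m] norm_represents[OF represents_diff[OF x f[of "s m"]]] sgf[of m]
      by (subst (asm) nn_integral_eq_integral) (auto simp: sq_int_def)
    then have "norm (x - X (s m)) \<le> (1/2)^m"
      by (subst (asm) ennreal_le_iff) (auto intro: power2_le_imp_le)
    then show ?thesis by (simp add: norm_minus_commute)
  qed
  have "(\<lambda>m. X (s m) - x) \<longlonglongrightarrow> 0"
    by (rule Lim_null_comparison[where g = "\<lambda>m. (1/2)^m"])
      (use bnd in \<open>auto intro: LIMSEQ_realpow_zero\<close>)
  then have sub: "(X \<circ> s) \<longlonglongrightarrow> x"
    by (simp add: LIM_zero_iff o_def)
  have "X \<longlonglongrightarrow> x"
  proof (rule metric_LIMSEQ_I)
    fix e :: real assume e: "e > 0"
    obtain M where M: "\<And>m n. m \<ge> M \<Longrightarrow> n \<ge> M \<Longrightarrow> dist (X m) (X n) < e/2"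
      using X e unfolding Cauchy_def by (meson half_gt_zero)
    obtain k where k: "\<And>n. n \<ge> k \<Longrightarrow> dist ((X \<circ> s) n) x < e/2"
      using metric_LIMSEQ_D[OF sub, of "e/2"] e by auto
    have "dist (X n) x < e" if "n \<ge> M" for n
    proof -
      define j where "j = max k M"
      have "s j \<ge> M" using seq_suble[OF sm, of j] by (simp add: j_def)
      then have "dist (X n) (X (s j)) < e/2" "dist (X (s j)) x < e/2"
        using M that k[of j] by (auto simp: j_def)
      then show ?thesis using dist_triangle[of "X n" x "X (s j)"] by linarith
    qed
    then show "\<exists>M. \<forall>n\<ge>M. dist (X n) x < e" by blast
  qed
  then show "convergent X" by (auto simp: convergent_def)
qed

instance l2 :: banach ..


lemma sq_int_bounded:
  assumes "f \<in> borel_measurable unit_leb" "\<And>t. t \<in> {0..1} \<Longrightarrow> \<bar>f t\<bar> \<le> B"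
  shows "sq_int f"
proof -
  interpret unit_leb: prob_space unit_leb by (rule prob_space_unit_leb)
  have "(f t)\<^sup>2 \<le> B\<^sup>2" if "t \<in> {0..1}" for t
    using assms(2)[OF that] by (metis abs_ge_zero power2_abs power_mono)
  then have "AE t in unit_leb. norm ((f t)\<^sup>2) \<le> B\<^sup>2"
    by (intro AE_I2) auto
  then have "integrable unit_leb (\<lambda>t. (f t)\<^sup>2)"
    using assms(1) by (intro unit_leb.integrable_const_bound) auto
  then show ?thesis using assms(1) by (simp add: sq_int_def)
qed

lemma sq_int_continuous:
  assumes "continuous_on {0..1} f" shows "sq_int f"
proof -
  have "compact (f ` {0..1})"
    using assms by (intro compact_continuous_image) auto
  then have "\<exists>B. \<forall>t\<in>{0..1}. \<bar>f t\<bar> \<le> B"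
    using compact_imp_bounded[of "f ` {0..1}"] by (simp add: bounded_iff)
  then obtain B where "\<And>t. t \<in> {0..1} \<Longrightarrow> \<bar>f t\<bar> \<le> B" by blast
  moreover have "f \<in> borel_measurable unit_leb"
    using assms by (intro continuous_imp_measurable_on_sets_lebesgue) auto
  ultimately show ?thesis by (rule sq_int_bounded[rotated])
qed

lemma sq_int_continuous_dense:
  assumes f: "sq_int f" and e: "e > 0"
  shows "\<exists>g. continuous_on {0..1} g \<and> integral\<^sup>L unit_leb (\<lambda>t. (f t - g t)\<^sup>2) < e"
proof -
  interpret unit_leb: prob_space unit_leb by (rule prob_space_unit_leb)
  define c :: "nat \<Rightarrow> real \<Rightarrow> real" where "c N y = max (- real N) (min (real N) y)" for N y
  have cN: "\<bar>c N y\<bar> \<le> real N" for N y by (auto simp: c_def)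
  have cy: "\<bar>y - c N y\<bar> \<le> \<bar>y\<bar>" for N y by (auto simp: c_def)
  have cc: "continuous_on UNIV (c N)" for N unfolding c_def by (intro continuous_intros)
  have [measurable]: "f \<in> borel_measurable unit_leb" using f by (simp add: sq_int_def)
  have cm[measurable]: "c N \<in> borel_measurable borel" for N
    by (intro borel_measurable_continuous_onI cc)
  have "(\<lambda>N. integral\<^sup>L unit_leb (\<lambda>t. (f t - c N (f t))\<^sup>2)) \<longlonglongrightarrow> integral\<^sup>L unit_leb (\<lambda>_. 0)"
  proof (rule integral_dominated_convergence[where w = "\<lambda>t. (f t)\<^sup>2"])
    show "AE t in unit_leb. (\<lambda>N. (f t - c N (f t))\<^sup>2) \<longlonglongrightarrow> 0"
    proof (intro AE_I2 tendsto_eventually)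
      fix t
      obtain N where "\<bar>f t\<bar> \<le> real N" using real_arch_simple by blast
      then have "\<forall>n\<ge>N. c n (f t) = f t"
        by (auto simp: c_def max_def min_def)
      then show "\<forall>\<^sub>F N in sequentially. (f t - c N (f t))\<^sup>2 = 0"
        unfolding eventually_sequentially by (intro exI[of _ N]) auto
    qed
    show "AE t in unit_leb. norm ((f t - c N (f t))\<^sup>2) \<le> (f t)\<^sup>2" for N
      using cy by (intro AE_I2) (simp add: abs_le_square_iff)
    show "integrable unit_leb (\<lambda>t. (f t)\<^sup>2)" using f by (simp add: sq_int_def)
  qed measurable
  then obtain N where N: "integral\<^sup>L unit_leb (\<lambda>t. (f t - c N (f t))\<^sup>2) < e/4"
    using e order_tendstoD(2)[of _ 0 sequentially "e/4"] eventually_happens'[OF sequentially_bot]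
    by (force simp: eventually_sequentially)
  have "f measurable_on {0..1}"
    by (simp add: measurable_on_iff_borel_measurable)
  then obtain Z g where Z: "negligible Z" and g: "\<And>n. continuous_on UNIV (g n)"
    and lim: "\<And>x. x \<notin> Z \<Longrightarrow> (\<lambda>n. g n x) \<longlonglongrightarrow> (if x \<in> {0..1} then f x else 0)"
    unfolding measurable_on_def by blast
  have gm[measurable]: "g n \<in> borel_measurable unit_leb" for n
    using g by (intro continuous_imp_measurable_on_sets_lebesgue) (auto intro: continuous_on_subset)
  have "(\<lambda>n. integral\<^sup>L unit_leb (\<lambda>t. (c N (f t) - c N (g n t))\<^sup>2)) \<longlonglongrightarrow> integral\<^sup>L unit_leb (\<lambda>_. 0)"
  proof (rule integral_dominated_convergence[where w = "\<lambda>t. (2 * real N)\<^sup>2"])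
    have "AE t in lebesgue. t \<notin> Z"
      using Z by (simp add: negligible_iff_null_sets AE_not_in)
    then have "AE t in unit_leb. t \<notin> Z"
      by (subst AE_restrict_space_iff) auto
    moreover have "AE t in unit_leb. t \<in> {0..1}" by (intro AE_I2) simp
    ultimately show "AE t in unit_leb. (\<lambda>n. (c N (f t) - c N (g n t))\<^sup>2) \<longlonglongrightarrow> 0"
    proof eventually_elim
      case (elim t)
      have "(\<lambda>n. c N (g n t)) \<longlonglongrightarrow> c N (f t)"
        using lim[of t] elim by (intro continuous_on_tendsto_compose[OF cc]) auto
      then have "(\<lambda>n. (c N (f t) - c N (g n t))\<^sup>2) \<longlonglongrightarrow> (c N (f t) - c N (f t))\<^sup>2"
        by (intro tendsto_intros)
      then show ?case by simp
    qed
    show "AE t in unit_leb. norm ((c N (f t) - c N (g n t))\<^sup>2) \<le> (2 * real N)\<^sup>2" for n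
    proof (rule AE_I2)
      fix t
      have "\<bar>c N (f t) - c N (g n t)\<bar> \<le> \<bar>2 * real N\<bar>"
        using cN[of N "f t"] cN[of N "g n t"] by linarith
      then show "norm ((c N (f t) - c N (g n t))\<^sup>2) \<le> (2 * real N)\<^sup>2"
        by (subst (asm) abs_le_square_iff) simp
    qed
  qed auto
  then obtain n where n: "integral\<^sup>L unit_leb (\<lambda>t. (c N (f t) - c N (g n t))\<^sup>2) < e/4"
    using e order_tendstoD(2)[of _ 0 sequentially "e/4"] eventually_happens'[OF sequentially_bot]
    by (force simp: eventually_sequentially)
  have s1: "sq_int (\<lambda>t. c N (f t))" by (rule sq_int_bounded[where B = "real N"]) (auto simp: cN)
  have s2: "sq_int (\<lambda>t. c N (g n t))" by (rule sq_int_bounded[where B = "real N"]) (auto simp: cN)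
  note i = sq_int_diff[OF f s1, unfolded sq_int_def] sq_int_diff[OF s1 s2, unfolded sq_int_def]
    sq_int_diff[OF f s2, unfolded sq_int_def]
  have "integral\<^sup>L unit_leb (\<lambda>t. (f t - c N (g n t))\<^sup>2) \<le>
      integral\<^sup>L unit_leb (\<lambda>t. 2 * (f t - c N (f t))\<^sup>2 + 2 * (c N (f t) - c N (g n t))\<^sup>2)"
  proof (rule integral_mono)
    fix t
    have "(a + b)\<^sup>2 \<le> 2 * a\<^sup>2 + 2 * b\<^sup>2" for a b :: real
      using zero_le_power2[of "a - b"] by (simp add: power2_eq_square algebra_simps)
    from this[of "f t - c N (f t)" "c N (f t) - c N (g n t)"]
    show "(f t - c N (g n t))\<^sup>2 \<le> 2 * (f t - c N (f t))\<^sup>2 + 2 * (c N (f t) - c N (g n t))\<^sup>2"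
      by simp
  qed (use i in auto)
  also have "\<dots> < e" using i N n by simp
  finally have "integral\<^sup>L unit_leb (\<lambda>t. (f t - c N (g n t))\<^sup>2) < e" .
  moreover have "continuous_on {0..1} (\<lambda>t. c N (g n t))"
    by (rule continuous_on_compose2[OF cc continuous_on_subset[OF g]]) auto
  ultimately show ?thesis by blast
qed

definition bernstein_l2 :: "nat \<times> rat list \<Rightarrow> real \<Rightarrow> real" where
  "bernstein_l2 = (\<lambda>(n, qs) t. \<Sum>k\<le>n. of_rat (qs ! k) * Bernstein n k t)"

lemma continuous_bernstein_l2: "continuous_on A (bernstein_l2 nq)"
  unfolding bernstein_l2_def Bernstein_def case_prod_beta by (intro continuous_intros)

lemma bernstein_l2_uniform:
  assumes g: "continuous_on {0..1} g" and e: "e > 0"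
  shows "\<exists>nq. \<forall>t\<in>{0..1}. \<bar>g t - bernstein_l2 nq t\<bar> < e"
proof -
  obtain N where N: "\<And>n x. N \<le> n \<Longrightarrow> x \<in> {0..1} \<Longrightarrow>
      \<bar>g x - (\<Sum>k\<le>n. g (k/n) * Bernstein n k x)\<bar> < e/2"
    using Bernstein_Weierstrass[OF g, of "e/2"] e by auto
  have "\<exists>q. \<bar>y - of_rat q\<bar> < e/2" for y
  proof -
    obtain r where "r \<in> \<rat>" "y - e/2 < r" "r < y + e/2"
      using Rats_dense_in_real[of "y - e/2" "y + e/2"] e by auto
    then have "\<bar>y - r\<bar> < e/2" by linarith
    with \<open>r \<in> \<rat>\<close> show ?thesis by (auto elim: Rats_cases)
  qed
  then obtain q where q: "\<And>y. \<bar>y - of_rat (q y)\<bar> < e/2" by metis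
  define qs where "qs = map (\<lambda>k. q (g (real k / real N))) [0..<Suc N]"
  have "\<bar>g t - bernstein_l2 (N, qs) t\<bar> < e" if t: "t \<in> {0..1}" for t
  proof -
    have qk: "qs ! k = q (g (real k / real N))" if "k \<le> N" for k
      using that by (simp add: qs_def del: upt_Suc)
    have "\<bar>(\<Sum>k\<le>N. g (k/N) * Bernstein N k t) - bernstein_l2 (N, qs) t\<bar> =
       \<bar>\<Sum>k\<le>N. (g (k/N) - of_rat (qs ! k)) * Bernstein N k t\<bar>"
      by (simp add: bernstein_l2_def sum_subtractf[symmetric] algebra_simps)
    also have "\<dots> \<le> (\<Sum>k\<le>N. (e/2) * Bernstein N k t)"
    proof (intro order.trans[OF sum_abs] sum_mono)
      fix k assume k: "k \<in> {..N}"
      then have "\<bar>g (k/N) - of_rat (qs ! k)\<bar> \<le> e/2"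
        using q[of "g (k/N)"] by (simp add: qk)
      moreover have "0 \<le> Bernstein N k t" using t by (simp add: Bernstein_nonneg)
      ultimately show "\<bar>(g (k/N) - of_rat (qs ! k)) * Bernstein N k t\<bar> \<le> (e/2) * Bernstein N k t"
        by (simp only: abs_mult abs_of_nonneg mult_right_mono)
    qed
    also have "\<dots> = e/2" by (simp only: sum_distrib_left[symmetric] sum_Bernstein mult_1_right)
    finally show ?thesis using N[OF order_refl t] unfolding abs_less_iff abs_le_iff by linarith
  qed
  then show ?thesis by blast
qed

lemma l2_separable: "\<exists>D :: l2 set. countable D \<and> (\<forall>x e. e > 0 \<longrightarrow> (\<exists>d\<in>D. dist x d < e))"
proof -
  interpret unit_leb: prob_space unit_leb by (rule prob_space_unit_leb)
  have sb: "sq_int (bernstein_l2 nq)" for nq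
    by (rule sq_int_continuous[OF continuous_bernstein_l2])
  then have "\<exists>d. \<forall>nq. represents (bernstein_l2 nq) (d nq)"
    by (intro choice) (auto intro: sq_int_represents)
  then obtain d where d: "\<And>nq. represents (bernstein_l2 nq) (d nq)" by blast
  have "\<exists>y\<in>range d. dist x y < e" if e: "e > 0" for x e
  proof -
    obtain f where f: "represents f x" "sq_int f" by (rule representsE)
    obtain g where g: "continuous_on {0..1} g"
      and fg: "integral\<^sup>L unit_leb (\<lambda>t. (f t - g t)\<^sup>2) < (e/2)\<^sup>2"
      using sq_int_continuous_dense[OF f(2), of "(e/2)\<^sup>2"] e by auto
    obtain nq where nq: "\<And>t. t \<in> {0..1} \<Longrightarrow> \<bar>g t - bernstein_l2 nq t\<bar> < e/2"
      using bernstein_l2_uniform[OF g, of "e/2"] e by (meson half_gt_zero)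
    have sg: "sq_int g" by (rule sq_int_continuous[OF g])
    then obtain y where y: "represents g y" using sq_int_represents by blast
    have "(norm (x - y))\<^sup>2 < (e/2)\<^sup>2"
      using norm_represents[OF represents_diff[OF f(1) y]] fg by simp
    then have 1: "norm (x - y) < e/2"
      by (rule power2_less_imp_less) (use e in simp)
    have "(norm (y - d nq))\<^sup>2 = integral\<^sup>L unit_leb (\<lambda>t. (g t - bernstein_l2 nq t)\<^sup>2)"
      by (rule norm_represents[OF represents_diff[OF y d]])
    also have "\<dots> \<le> integral\<^sup>L unit_leb (\<lambda>t. (e/2)\<^sup>2)"
    proof (rule integral_mono)
      fix t assume "t \<in> space unit_leb"
      then have "\<bar>g t - bernstein_l2 nq t\<bar> \<le> \<bar>e/2\<bar>" using nq[of t] e by auto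
      then show "(g t - bernstein_l2 nq t)\<^sup>2 \<le> (e/2)\<^sup>2" by (simp only: abs_le_square_iff)
    qed (use sq_int_diff[OF sg sb] in \<open>auto simp: sq_int_def\<close>)
    also have "\<dots> = (e/2)\<^sup>2" using unit_leb.prob_space by simp
    finally have 2: "norm (y - d nq) \<le> e/2"
      using e by (auto intro: power2_le_imp_le)
    have "dist x (d nq) < e"
      using 1 2 norm_triangle_ineq[of "x - y" "y - d nq"] by (simp add: dist_norm)
    then show ?thesis by blast
  qed
  moreover have "countable (range d)" by simp
  ultimately show ?thesis by blast
qed

instance l2 :: second_countable_topology
proof
  obtain D :: "l2 set" where D: "countable D" "\<And>x e. e > 0 \<Longrightarrow> \<exists>d\<in>D. dist x d < e"
    using l2_separable by blast
  define B where "B = (\<lambda>(d, q). ball d (of_rat q)) ` (D \<times> (UNIV :: rat set))"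
  have "topological_basis B"
  proof (rule topological_basisI)
    show "open b" if "b \<in> B" for b using that by (auto simp: B_def)
    fix O' :: "l2 set" and x assume O: "open O'" "x \<in> O'"
    then obtain e where e: "e > 0" "ball x e \<subseteq> O'" by (meson open_contains_ball)
    obtain d where d: "d \<in> D" "dist x d < e/4" using D(2)[of "e/4" x] e by auto
    obtain q :: rat where q: "e/4 < of_rat q" "of_rat q < e/2"
      using Rats_dense_in_real[of "e/4" "e/2"] e by (force simp: Rats_def)
    have "x \<in> ball d (of_rat q)" using d q by (simp add: dist_commute)
    moreover have "ball d (of_rat q) \<subseteq> O'"
    proof
      fix y assume "y \<in> ball d (of_rat q)"
      then have "dist x y < e"
        using d q dist_triangle[of x y d] by simp
      then show "y \<in> O'" using e by auto
    qed
    ultimately show "\<exists>B'\<in>B. x \<in> B' \<and> B' \<subseteq> O'"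
      using d unfolding B_def by blast
  qed
  moreover have "countable B" unfolding B_def using D(1) by auto
  ultimately show "\<exists>B::l2 set set. countable B \<and> open = generate_topology B"
    using topological_basis_imp_subbasis by blast
qed


section \<open>Probabilistic and analytic notions\<close>

abbreviation sigma_of :: "'w measure \<Rightarrow> ('w \<Rightarrow> 'b::topological_space) \<Rightarrow> 'w measure" where
  "sigma_of M V \<equiv> vimage_algebra (space M) V borel"

text \<open>\<open>Y\<close> is a version of the conditional expectation of \<open>Z\<close> given \<open>F\<close>. The library's
  \<^const>\<open>real_cond_exp\<close> covers real variables only.\<close>

definition has_cond_exp ::
    "'w measure \<Rightarrow> 'w measure \<Rightarrow> ('w \<Rightarrow> 'b::{banach, second_countable_topology}) \<Rightarrow> ('w \<Rightarrow> 'b) \<Rightarrow> bool" where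
  "has_cond_exp M F Z Y \<longleftrightarrow>
     integrable M Z \<and> integrable M Y \<and> Y \<in> borel_measurable F \<and>
     (\<forall>A\<in>sets F. set_lebesgue_integral M A Y = set_lebesgue_integral M A Z)"

definition fourier :: "(real \<Rightarrow> real) \<Rightarrow> real \<Rightarrow> complex" where
  "fourier \<phi> t =
     (LINT x|lborel. complex_of_real (\<phi> x) * exp (- (2 * complex_of_real pi * \<i> * complex_of_real (t * x))))"

definition std_normal_quantile :: "real \<Rightarrow> real" where
  "std_normal_quantile q = Inf {x. q \<le> cdf std_normal_distribution x}"

text \<open>A choice of a representative of each class \<open>\<delta> x\<close>, measurable in \<open>x\<close> and the argument jointly;
  it gives a meaning to the value of \<open>\<delta> x\<close> at a point.\<close>

definition measurable_version :: "(l2 \<Rightarrow> l2) \<Rightarrow> (l2 \<Rightarrow> real \<Rightarrow> real) \<Rightarrow> bool" where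
  "measurable_version \<delta> d \<longleftrightarrow>
     (\<lambda>(x, t). d x t) \<in> borel_measurable (borel \<Otimes>\<^sub>M restrict_space borel {0..1}) \<and>
     (\<forall>x. represents (d x) (\<delta> x))"

definition orthonormal_basis :: "(nat \<Rightarrow> l2) \<Rightarrow> bool" where
  "orthonormal_basis \<psi> \<longleftrightarrow>
     (\<forall>i j. inner (\<psi> i) (\<psi> j) = (if i = j then 1 else 0)) \<and> closure (span (range \<psi>)) = UNIV"

section \<open>Directions\<close>

text \<open>A vector of \<open>\<real>\<^sup>p\<close> is a sequence that vanishes from index \<open>p\<close> on (coordinates, basis elements and
  observations are numbered from 0), so that padding by zeros is the identity. On \<open>unit_sphere p\<close> the
  product topology of \<^typ>\<open>nat \<Rightarrow> real\<close> induces the Euclidean one.\<close>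

definition unit_sphere :: "nat \<Rightarrow> (nat \<Rightarrow> real) set" where
  "unit_sphere p = {\<gamma>. (\<forall>j\<ge>p. \<gamma> j = 0) \<and> L2_set \<gamma> {..<p} = 1}"

definition normalized_dir :: "(nat \<Rightarrow> real) \<Rightarrow> nat \<Rightarrow> nat \<Rightarrow> real" where
  "normalized_dir b p j = (if j < p then b j / L2_set b {..<p} else 0)"

definition proj :: "(nat \<Rightarrow> l2) \<Rightarrow> nat \<Rightarrow> (nat \<Rightarrow> real) \<Rightarrow> l2 \<Rightarrow> real" where
  "proj \<psi> p \<gamma> x = (\<Sum>j<p. inner x (\<psi> j) * \<gamma> j)"

section \<open>The test statistic\<close>

text \<open>Value at \<open>y i\<close> of the empirical distribution function of \<open>y 0, \<dots>, y (n - 1)\<close>, with ties broken by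
  comparing indices.\<close>

definition ecdf_at :: "nat \<Rightarrow> (nat \<Rightarrow> real) \<Rightarrow> nat \<Rightarrow> real" where
  "ecdf_at n y i = real (card {k. k < n \<and> (y k < y i \<or> y k = y i \<and> k \<le> i)}) / real n"

definition Q_stat ::
    "(real \<Rightarrow> real) \<Rightarrow> real \<Rightarrow> nat \<Rightarrow> (nat \<Rightarrow> l2) \<Rightarrow> (nat \<Rightarrow> real) \<Rightarrow> real" where
  "Q_stat K h n u y =
     1 / (real n * (real n - 1)) *
     (\<Sum>i<n. \<Sum>j\<in>{..<n} - {i}. inner (u i) (u j) * (1 / h) * K ((ecdf_at n y i - ecdf_at n y j) / h))"

definition v_stat ::
    "(real \<Rightarrow> real) \<Rightarrow> real \<Rightarrow> nat \<Rightarrow> (nat \<Rightarrow> l2) \<Rightarrow> (nat \<Rightarrow> real) \<Rightarrow> real" where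
  "v_stat K h n u y = sqrt (
     2 / (real n * (real n - 1) * h) *
     (\<Sum>i<n. \<Sum>j\<in>{..<n} - {i}. (inner (u i) (u j))\<^sup>2 * (K ((ecdf_at n y i - ecdf_at n y j) / h))\<^sup>2))"

text \<open>When \<open>v_stat\<close> vanishes, so does \<open>Q_stat\<close>, and the ratio \<open>0 / 0\<close> is 0.\<close>

definition studentized ::
    "(real \<Rightarrow> real) \<Rightarrow> real \<Rightarrow> nat \<Rightarrow> (nat \<Rightarrow> l2) \<Rightarrow> (nat \<Rightarrow> real) \<Rightarrow> real" where
  "studentized K h n u y = real n * sqrt h * Q_stat K h n u y / v_stat K h n u y"

end

theory Submission
  imports Defs
begin

text \<open>Since \<open>\<gamma>hat\<close> maximizes the penalized criterion, the test statistic is at least the statistic in the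
  fixed direction \<open>\<gamma>t\<close> minus \<open>\<alpha> n\<close>, and it suffices that the former exceeds \<open>2 * \<alpha> n\<close> with
  probability tending to 1; no uniformity over directions is involved. The statistic is driven by the
  quadratic form with weights \<open>K ((R i - R j) / (n * h))\<close>, where the ranks \<open>R\<close> are a permutation of
  \<open>1, \<dots>, n\<close>; so its row sums are of order \<open>n * h\<close> for every sample. Hence the variance estimator is
  bounded by a mean of fourth powers of norms. In the numerator, the terms containing a variable that is
  centered given the covariates are degenerate: their second moments are computed by orthogonality.

  For the remaining term, \<open>\<delta>\<close> is written as \<open>G + \<epsilon> + \<rho>\<close> with \<open>G\<close> a step function of the projection,
  \<open>\<epsilon>\<close> centered given the projection and \<open>\<rho>\<close> small in mean square. An indicator of a half-line, read
  in the order of the ranks, jumps only once, so the form of \<open>G\<close> is, up to a vanishing deterministic error,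
  bounded below by a multiple of the mean of \<open>(norm G)\<^sup>2\<close>.\<close>

section \<open>The kernel\<close>

text \<open>A form weighted by ranks is not a U-statistic: moving one observation reshuffles the
  ranks and thereby all weights. What survives is that observation \<open>m\<close> enters the
  weights only through \<open>w (Z m \<omega>)\<close>. A variable centered given \<open>w\<close>
  can therefore be integrated out against everything else, which is why \<open>cond_centered\<close>
  admits arbitrary measurable functions of \<open>w\<close>. There are two choices of
  \<open>w\<close>: the whole covariate for \<open>U0\<close>, and the real projection for
  \<epsilon>.

  With normalization \<open>n * (n * h)\<close>, the noise that is centered in both arguments has
  mean absolute value of order \<open>1 / (n * sqrt h)\<close>, and the noise centered in one
  argument has order \<open>1 / sqrt n\<close>. Relative to a signal of size \<open>r^2\<close>, the
  noise and cross terms become of order \<open>1 / L\<close> and \<open>1 / sqrt (r^2 * n)\<close>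
  with \<open>L = r^2 * n * sqrt h\<close>, and the rate condition makes both vanish.

  The lower bound for the signal must be fixed before the approximation error is. It is a multiple
  of the squared norm of a set integral of \<delta>, to which \<epsilon> cannot contribute; only
  afterwards are the step function and \<rho> chosen.\<close>

locale kernel =
  fixes K :: "real \<Rightarrow> real"
  assumes cont: "continuous_on UNIV K"
    and nonneg: "\<And>x. K x \<ge> 0"
    and integrable: "integrable lborel K"
    and integral: "integral\<^sup>L lborel K = 1"
    and even: "\<And>x. K x = K (- x)"
    and antimono: "antimono_on {0..} K"
begin

lemma antimonoD: "0 \<le> x \<Longrightarrow> x \<le> y \<Longrightarrow> K y \<le> K x"
  using antimono by (auto simp: monotone_on_def)

lemma K_abs: "K \<bar>x\<bar> = K x"
  using even[of x] by (simp add: abs_if)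

lemma le_K0: "K x \<le> K 0"
  using antimonoD[of 0 "\<bar>x\<bar>"] by (simp add: K_abs)

lemma K0_pos: "K 0 > 0"
proof (rule ccontr)
  assume "\<not> K 0 > 0"
  then have "K = (\<lambda>_. 0)" using le_K0 nonneg by (metis order.trans order_antisym not_less)
  then show False using integral by simp
qed

lemma measurable_K[measurable]: "K \<in> borel_measurable borel"
  using cont by (rule borel_measurable_continuous_onI)

lemma integrable_indicator: "A \<in> sets borel \<Longrightarrow> integrable lborel (\<lambda>x. indicator A x * K x)"
  using integrable_mult_indicator[OF _ integrable, of A] by simp

text \<open>By monotonicity \<open>K (real d / b)\<close> is at most \<open>K\<close> on the cell
  \<open>I d\<close> of length \<open>1 / b\<close> to its left, so the sum divided by
  \<open>b\<close> is at most the integral of \<open>K\<close>. The bound is uniform in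
  \<open>n\<close>.\<close>

lemma Riemann_sum_le:
  assumes b: "b > 0"
  shows "(\<Sum>d=1..n. K (real d / b)) \<le> b"
proof -
  define I where "I d = {(real d - 1) / b <.. real d / b}" for d :: nat
  have ind: "(\<Sum>d=1..n. indicator (I d) x) = (indicator {0 <.. real n / b} x :: real)" for x n
  proof (induction n)
    case (Suc n)
    have le: "real n / b \<le> (1 + real n) / b" "0 \<le> real n / b" using b by (auto simp: divide_simps)
    show ?case using Suc le by (auto simp: I_def indicator_def)
  qed (use b in \<open>simp add: I_def\<close>)
  have mI: "measure lborel (I d) = 1 / b" for d
    using b by (simp add: I_def divide_simps)
  have inI: "integrable lborel (indicator (I d) :: real \<Rightarrow> real)" for d
    by (rule integrable_real_indicator) (use b in \<open>auto simp: I_def divide_right_mono\<close>)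
  have "(\<Sum>d=1..n. K (real d / b)) / b = (\<Sum>d=1..n. K (real d / b) * measure lborel (I d))"
    by (simp add: mI sum_divide_distrib)
  also have "\<dots> = (\<integral>x. (\<Sum>d=1..n. K (real d / b) * indicator (I d) x) \<partial>lborel)"
    using inI by (subst Bochner_Integration.integral_sum) auto
  also have "\<dots> \<le> (\<integral>x. K x \<partial>lborel)"
  proof (rule integral_mono[OF _ integrable])
    show "integrable lborel (\<lambda>x. \<Sum>d=1..n. K (real d / b) * indicator (I d) x)"
      by (intro Bochner_Integration.integrable_sum integrable_mult_right inI)
    fix x
    have "(\<Sum>d=1..n. K (real d / b) * indicator (I d) x) \<le> (\<Sum>d=1..n. K x * indicator (I d) x)"
    proof (rule sum_mono)
      fix d assume d: "d \<in> {1..n}"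
      show "K (real d / b) * indicator (I d) x \<le> K x * indicator (I d) x"
      proof (cases "x \<in> I d")
        case True
        have "0 \<le> (real d - 1) / b" using d b by auto
        then have "0 \<le> x" "x \<le> real d / b" using True by (auto simp: I_def)
        then show ?thesis using antimonoD by (simp add: mult_right_mono)
      qed simp
    qed
    also have "\<dots> = K x * indicator {0 <.. real n / b} x"
      by (simp only: sum_distrib_left[symmetric] ind)
    also have "\<dots> \<le> K x" using nonneg[of x] by (auto simp: indicator_def)
    finally show "(\<Sum>d=1..n. K (real d / b) * indicator (I d) x) \<le> K x" .
  qed
  finally show ?thesis using integral b by (simp add: divide_simps)
qed

text \<open>Monotonicity and integrability force this: \<open>x / 2 * K x\<close> is at most the
  integral of \<open>K\<close> from \<open>x / 2\<close> to \<open>x\<close>, hence at most the tail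
  beyond \<open>x / 2\<close>.\<close>

lemma times_self_tendsto_0: "((\<lambda>x. x * K x) \<longlongrightarrow> 0) at_top"
proof (rule tendsto_sandwich[where f = "\<lambda>_. 0" and h = "\<lambda>x. 2 * (1 - (\<integral>y. indicator {..x/2} y *\<^sub>R K y \<partial>lborel))"])
  show "\<forall>\<^sub>F x in at_top. 0 \<le> x * K x"
    using eventually_ge_at_top[of 0] by eventually_elim (simp add: nonneg)
  show "\<forall>\<^sub>F x in at_top. x * K x \<le> 2 * (1 - (\<integral>y. indicator {..x/2} y *\<^sub>R K y \<partial>lborel))"
    using eventually_gt_at_top[of 0]
  proof eventually_elim
    case (elim x)
    have "x / 2 * K x = (\<integral>y. indicator {x/2<..x} y * K x \<partial>lborel)"
      using elim by simp
    also have "\<dots> \<le> (\<integral>y. K y - indicator {..x/2} y * K y \<partial>lborel)"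
    proof (rule integral_mono)
      show "indicator {x/2<..x} y * K x \<le> K y - indicator {..x/2} y * K y" for y
        using elim antimonoD[of y x] nonneg[of y] by (auto simp: indicator_def)
      have "integrable lborel (indicator {x/2<..x} :: real \<Rightarrow> real)"
        using elim by (intro integrable_real_indicator) auto
      then show "integrable lborel (\<lambda>y. indicator {x/2<..x} y * K x)" by simp
    qed (use integrable integrable_indicator in auto)
    also have "\<dots> = 1 - (\<integral>y. indicator {..x/2} y *\<^sub>R K y \<partial>lborel)"
      using integral integrable integrable_indicator by (subst Bochner_Integration.integral_diff) auto
    finally show ?case by simp
  qed
  have "filterlim (\<lambda>x::real. x / 2) at_top at_top"
    by (rule filterlim_at_top_mult_tendsto_pos[where f = "\<lambda>_. 1/2" and g = "\<lambda>x. x", simplified])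
      (auto intro: filterlim_ident)
  then have "((\<lambda>x. \<integral>y. indicator {..x/2} y *\<^sub>R K y \<partial>lborel) \<longlongrightarrow> integral\<^sup>L lborel K) at_top"
    using filterlim_compose[OF tendsto_integral_at_top[OF _ integrable]] by simp
  then have "((\<lambda>x. 2 * (1 - (\<integral>y. indicator {..x/2} y *\<^sub>R K y \<partial>lborel))) \<longlongrightarrow> 2 * (1 - 1)) at_top"
    by (intro tendsto_intros) (simp add: integral)
  then show "((\<lambda>x. 2 * (1 - (\<integral>y. indicator {..x/2} y *\<^sub>R K y \<partial>lborel))) \<longlongrightarrow> 0) at_top" by simp
qed simp

text \<open>The sum is the cost of one jump of a step function
  (\<open>sum_weight_halfline_le\<close>). With a finite first moment of \<open>K\<close> the
  quotient would be of order \<open>h\<close>. In general it is the average over \<open>d\<close> of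
  \<open>x * K x\<close> at \<open>x = d / (n * h)\<close>: points beyond a fixed \<open>x2\<close>
  contribute little because \<open>x * K x\<close> vanishes at infinity, and at most
  \<open>n * h * x2\<close> of the \<open>n\<close> points lie below, a proportion of order
  \<open>h\<close>.\<close>

lemma first_moment_average_tendsto_0:
  assumes h0: "\<forall>\<^sub>F n in sequentially. h n > 0" and h: "h \<longlonglongrightarrow> 0"
  shows "(\<lambda>n. (\<Sum>d=1..n. real d * K (real d / (real n * h n))) / (real n * (real n * h n))) \<longlonglongrightarrow> 0"
proof (rule LIMSEQ_I)
  fix r :: real assume r: "r > 0"
  have "\<forall>\<^sub>F x in at_top. x * K x < r/2"
    by (rule order_tendstoD(2)[OF times_self_tendsto_0]) (use r in simp)
  then obtain x1 where x1: "\<And>x. x \<ge> x1 \<Longrightarrow> x * K x < r/2" by (auto simp: eventually_at_top_linorder)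
  define x2 where "x2 = max x1 1"
  have x2: "x2 > 0" "\<And>x. x \<ge> x2 \<Longrightarrow> x * K x < r/2" using x1 by (auto simp: x2_def)
  have "(\<lambda>n. K 0 * x2 * x2 * h n) \<longlonglongrightarrow> K 0 * x2 * x2 * 0" by (intro tendsto_intros h)
  then have "\<forall>\<^sub>F n in sequentially. K 0 * x2 * x2 * h n < r/2"
    by (rule order_tendstoD(2)) (use r in simp)
  then have "\<forall>\<^sub>F n in sequentially. norm ((\<Sum>d=1..n. real d * K (real d / (real n * h n))) / (real n * (real n * h n)) - 0) < r"
    using h0 eventually_gt_at_top[of 0]
  proof eventually_elim
    case (elim n)
    define b where "b = real n * h n"
    have b: "b > 0" using elim by (simp add: b_def)
    define D where "D = {d \<in> {1..n}. real d / b < x2}"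
    have D: "real (card D) \<le> b * x2"
    proof -
      have "D \<subseteq> {1..nat \<lfloor>b * x2\<rfloor>}"
      proof
        fix d assume "d \<in> D"
        then have "1 \<le> d" "real d < b * x2" using b by (auto simp: D_def field_simps)
        then show "d \<in> {1..nat \<lfloor>b * x2\<rfloor>}" by (auto simp: le_nat_floor)
      qed
      then have "card D \<le> nat \<lfloor>b * x2\<rfloor>" using card_mono[of "{1..nat \<lfloor>b * x2\<rfloor>}" D] by simp
      then show ?thesis using b x2 by (simp add: le_nat_iff le_floor_iff)
    qed
    have "(\<Sum>d=1..n. real d / b * K (real d / b)) \<le> (\<Sum>d=1..n. r/2 + (if d \<in> D then x2 * K 0 else 0))"
    proof (rule sum_mono)
      fix d assume d: "d \<in> {1..n}"
      show "real d / b * K (real d / b) \<le> r/2 + (if d \<in> D then x2 * K 0 else 0)"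
      proof (cases "d \<in> D")
        case True
        then have "real d / b * K (real d / b) \<le> x2 * K 0"
          using le_K0 nonneg b x2 by (intro mult_mono) (auto simp: D_def)
        then show ?thesis using True r by simp
      next
        case False
        then show ?thesis using x2(2)[of "real d / b"] d by (simp add: D_def)
      qed
    qed
    also have "\<dots> = real n * (r/2) + x2 * K 0 * real (card D)"
    proof -
      have "{1..n} \<inter> D = D" by (auto simp: D_def)
      then show ?thesis by (simp add: sum.distrib sum.If_cases)
    qed
    also have "\<dots> \<le> real n * (r/2) + x2 * K 0 * (b * x2)"
      using D x2 K0_pos by (intro add_left_mono mult_left_mono) auto
    also have "\<dots> = real n * (r/2 + K 0 * x2 * x2 * h n)"
      by (simp add: b_def algebra_simps)
    also have "\<dots> < real n * r" using elim by (intro mult_strict_left_mono) auto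
    finally have "(\<Sum>d=1..n. real d / b * K (real d / b)) / real n < r" using elim by (simp add: field_simps)
    also have "(\<Sum>d=1..n. real d / b * K (real d / b)) / real n = (\<Sum>d=1..n. real d * K (real d / b)) / (real n * b)"
      by (simp add: sum_divide_distrib mult.commute)
    finally have "(\<Sum>d=1..n. real d * K (real d / b)) / (real n * b) < r" .
    moreover have "0 \<le> (\<Sum>d=1..n. real d * K (real d / b)) / (real n * b)"
      using b nonneg by (auto intro!: divide_nonneg_nonneg sum_nonneg)
    ultimately show ?case by (simp add: b_def)
  qed
  then show "\<exists>no. \<forall>n\<ge>no. norm ((\<Sum>d=1..n. real d * K (real d / (real n * h n))) / (real n * (real n * h n)) - 0) < r"
    by (simp add: eventually_sequentially)
qed

text \<open>By continuity the kernel exceeds half of its positive value \<open>K 0\<close> near 0,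
  and about \<open>b * x0\<close> of the points fall there. The condition
  \<open>b * x0 \<ge> 2\<close> ensures that rounding \<open>b * x0\<close> down loses at most half
  of it; the other condition makes the sum long enough to contain all these points.\<close>

lemma Riemann_sum_ge:
  obtains c x0 where "c > 0" "x0 > 0"
    "\<And>b m. b * x0 \<ge> 2 \<Longrightarrow> real m \<ge> b * x0 \<Longrightarrow> c * b \<le> (\<Sum>d=1..m. K (real d / b))"
proof -
  have "\<forall>\<^sub>F x in at 0. K x > K 0 / 2"
    using cont K0_pos by (intro order_tendstoD(1)[of _ "K 0"]) (auto simp: continuous_on_def)
  then obtain x0 where x0: "x0 > 0" "\<And>x. x \<noteq> 0 \<Longrightarrow> dist x 0 < x0 \<Longrightarrow> K x > K 0 / 2"
    unfolding eventually_at by auto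
  define x1 where "x1 = x0 / 2"
  have x1: "x1 > 0" "\<And>x. 0 \<le> x \<Longrightarrow> x \<le> x1 \<Longrightarrow> K x \<ge> K 0 / 2"
  proof -
    show "x1 > 0" using x0 by (simp add: x1_def)
    fix x assume "0 \<le> x" "x \<le> x1"
    then show "K x \<ge> K 0 / 2"
      using x0 K0_pos by (cases "x = 0") (auto simp: x1_def less_imp_le)
  qed
  show ?thesis
  proof (rule that[of "K 0 / 2 * (x1 / 2)" x1])
    fix b m assume b: "b * x1 \<ge> 2" and m: "real m \<ge> b * x1"
    have b0: "b > 0" using b x1 by (smt (verit) mult_nonpos_nonneg)
    define k where "k = nat \<lfloor>b * x1\<rfloor>"
    have k: "real k \<le> b * x1" "real k \<ge> b * x1 / 2"
      unfolding k_def using b by linarith+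
    then have "k \<le> m" using m by linarith
    have "K 0 / 2 * (x1 / 2) * b \<le> real k * (K 0 / 2)"
    proof -
      have "(b * x1 / 2) * (K 0 / 2) \<le> real k * (K 0 / 2)"
        using k K0_pos by (intro mult_right_mono) auto
      then show ?thesis by (simp add: algebra_simps)
    qed
    also have "\<dots> = (\<Sum>d=1..k. K 0 / 2)" by simp
    also have "\<dots> \<le> (\<Sum>d=1..k. K (real d / b))"
    proof (rule sum_mono)
      fix d assume "d \<in> {1..k}"
      then have "real d \<le> b * x1" using k by auto
      then show "K 0 / 2 \<le> K (real d / b)" using b0 by (intro x1) (auto simp: field_simps)
    qed
    also have "\<dots> \<le> (\<Sum>d=1..m. K (real d / b))"
      using \<open>k \<le> m\<close> nonneg by (intro sum_mono2) auto
    finally show "K 0 / 2 * (x1 / 2) * b \<le> (\<Sum>d=1..m. K (real d / b))" .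
  qed (use x1 K0_pos in auto)
qed

end

section \<open>Ranks and weighted quadratic forms\<close>

text \<open>The numerator of \<open>ecdf_at\<close>, kept as a natural number so that sums over the
  sample can be reindexed by ranks.\<close>

definition sample_rank :: "nat \<Rightarrow> (nat \<Rightarrow> real) \<Rightarrow> nat \<Rightarrow> nat" where
  "sample_rank n y i = card {k. k < n \<and> (y k < y i \<or> y k = y i \<and> k \<le> i)}"

lemma ecdf_at_rank: "ecdf_at n y i = real (sample_rank n y i) / real n"
  by (simp add: ecdf_at_def sample_rank_def)

text \<open>Pairs of value and index are compared lexicographically, a strict linear order. The set
  counted for \<open>i\<close> is contained in the one counted for \<open>j\<close>, which has
  \<open>j\<close> as an additional element.\<close>

lemma rank_less:
  assumes "j < n" "y i < y j \<or> y i = y j \<and> i < j"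
  shows "sample_rank n y i < sample_rank n y j"
  unfolding sample_rank_def
  by (rule psubset_card_mono) (use assms in force)+

lemma rank_pos: "i < n \<Longrightarrow> 1 \<le> sample_rank n y i"
  unfolding sample_rank_def by (auto simp: Suc_le_eq card_gt_0_iff)

lemma rank_le: "sample_rank n y i \<le> n"
  unfolding sample_rank_def using card_mono[of "{..<n}" "{k. k < n \<and> (y k < y i \<or> y k = y i \<and> k \<le> i)}"] by auto

lemma bij_betw_rank: "bij_betw (sample_rank n y) {..<n} {1..n}"
proof -
  have inj: "inj_on (sample_rank n y) {..<n}"
  proof (rule inj_onI, rule ccontr)
    fix i j assume ij: "i \<in> {..<n}" "j \<in> {..<n}" "sample_rank n y i = sample_rank n y j" "i \<noteq> j"
    then consider "y i < y j \<or> y i = y j \<and> i < j" | "y j < y i \<or> y j = y i \<and> j < i" by linarith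
    then show False using ij rank_less[of j n y i] rank_less[of i n y j] by cases auto
  qed
  moreover have "sample_rank n y ` {..<n} = {1..n}"
  proof (rule card_subset_eq)
    show "sample_rank n y ` {..<n} \<subseteq> {1..n}" using rank_pos rank_le by fastforce
    show "card (sample_rank n y ` {..<n}) = card {1..n}" using inj by (simp add: card_image)
  qed simp
  ultimately show ?thesis by (simp add: bij_betw_def)
qed

lemma sum_rank: "(\<Sum>j<n. f (sample_rank n y j)) = (\<Sum>s=1..n. f s)"
  by (rule sum.reindex_bij_betw[OF bij_betw_rank])

text \<open>Observations up to a threshold \<open>a\<close> occupy an initial segment of the ranks.
  In the rank scale an indicator of a half-line thus becomes an indicator of an initial segment, and
  the sample matters only through the length of that segment.\<close>

lemma rank_le_count_iff:
  assumes "i < n"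
  shows "sample_rank n y i \<le> card {k. k < n \<and> y k \<le> a} \<longleftrightarrow> y i \<le> a"
proof
  assume "y i \<le> a"
  then show "sample_rank n y i \<le> card {k. k < n \<and> y k \<le> a}"
    unfolding sample_rank_def by (intro card_mono) auto
next
  assume *: "sample_rank n y i \<le> card {k. k < n \<and> y k \<le> a}"
  show "y i \<le> a"
  proof (rule ccontr)
    assume "\<not> y i \<le> a"
    then have "{k. k < n \<and> y k \<le> a} \<subset> {k. k < n \<and> (y k < y i \<or> y k = y i \<and> k \<le> i)}"
      using assms by force
    then have "card {k. k < n \<and> y k \<le> a} < sample_rank n y i"
      unfolding sample_rank_def by (intro psubset_card_mono) auto
    with * show False by simp
  qed
qed

lemma ecdf_at_cong: "(\<And>k. k < n \<Longrightarrow> y k = y' k) \<Longrightarrow> i < n \<Longrightarrow> ecdf_at n y i = ecdf_at n y' i"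
  unfolding ecdf_at_def by (intro arg_cong2[where f = "(/)"] arg_cong[where f = card] arg_cong[where f = real]) auto

text \<open>As a sum of indicators the value is evidently measurable in the sample.\<close>

lemma ecdf_at_sum: "ecdf_at n y i = (\<Sum>k<n. of_bool (y k < y i \<or> y k = y i \<and> k \<le> i)) / real n"
proof -
  have "{..<n} \<inter> {k. y k < y i \<or> y k = y i \<and> k \<le> i} = {k. k < n \<and> (y k < y i \<or> y k = y i \<and> k \<le> i)}" by auto
  then show ?thesis unfolding ecdf_at_def by (simp add: of_bool_def sum.If_cases)
qed

lemma measurable_ecdf_at[measurable (raw)]:
  assumes [measurable]: "\<And>k. k < n \<Longrightarrow> (\<lambda>\<omega>. y \<omega> k) \<in> borel_measurable M" and "i < n"
  shows "(\<lambda>\<omega>. ecdf_at n (y \<omega>) i) \<in> borel_measurable M"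
proof -
  have [measurable]: "(\<lambda>\<omega>. y \<omega> i) \<in> borel_measurable M" using assms by simp
  have "(\<lambda>\<omega>. of_bool (y \<omega> k < y \<omega> i \<or> y \<omega> k = y \<omega> i \<and> k \<le> i) :: real) \<in> borel_measurable M" if "k < n" for k
  proof -
    have [measurable]: "(\<lambda>\<omega>. y \<omega> k) \<in> borel_measurable M" using that by simp
    show ?thesis by measurable
  qed
  then show ?thesis unfolding ecdf_at_sum by (intro borel_measurable_divide borel_measurable_sum) auto
qed

section \<open>Kernel weights as functions of the ranks\<close>

definition weight :: "(real \<Rightarrow> real) \<Rightarrow> real \<Rightarrow> nat \<Rightarrow> (nat \<Rightarrow> real) \<Rightarrow> nat \<Rightarrow> nat \<Rightarrow> real" where
  "weight K h n y i j = K ((ecdf_at n y i - ecdf_at n y j) / h)"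

lemma weight_rank: "weight K h n y i j = K ((real (sample_rank n y i) - real (sample_rank n y j)) / (real n * h))"
  by (simp add: weight_def ecdf_at_rank diff_divide_distrib)

lemma sum_split_at:
  fixes f :: "nat \<Rightarrow> real"
  assumes r: "r \<in> {1..n}"
  shows "(\<Sum>s\<in>{1..n} - {r}. f s) = (\<Sum>d=1..r-1. f (r - d)) + (\<Sum>d=1..n-r. f (r + d))"
proof -
  have eq: "{1..n} - {r} = {1..r-1} \<union> {r+1..n}" using r by auto
  have "(\<Sum>s\<in>{1..n} - {r}. f s) = (\<Sum>s=1..r-1. f s) + (\<Sum>s=r+1..n. f s)"
    unfolding eq by (rule sum.union_disjoint) auto
  also have "(\<Sum>s=1..r-1. f s) = (\<Sum>d=1..r-1. f (r - d))"
    by (rule sum.reindex_bij_witness[of _ "\<lambda>d. r - d" "\<lambda>d. r - d"]) auto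
  also have "(\<Sum>s=r+1..n. f s) = (\<Sum>d=1..n-r. f (r + d))"
    by (rule sum.reindex_bij_witness[of _ "\<lambda>d. r + d" "\<lambda>d. d - r"]) auto
  finally show ?thesis .
qed

context kernel
begin

lemma weight_nonneg: "0 \<le> weight K h n y i j" and weight_le: "weight K h n y i j \<le> K 0"
  by (simp_all add: weight_def nonneg le_K0)

lemma weight_commute: "weight K h n y i j = weight K h n y j i"
  unfolding weight_def by (metis even minus_diff_eq minus_divide_left)

text \<open>Read by ranks, row \<open>i\<close> runs over all ranks except \<open>r\<close>: there
  are \<open>r - 1\<close> of them below and \<open>n - r\<close> above, one at each distance. The
  values of the sample have disappeared from the right-hand side.\<close>

lemma sum_weight_split:
  fixes y :: "nat \<Rightarrow> real" and h :: real
  assumes "i < n"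
  defines "r \<equiv> sample_rank n y i" and "b \<equiv> real n * h"
  shows "(\<Sum>j\<in>{..<n} - {i}. weight K h n y i j) = (\<Sum>d=1..r-1. K (real d / b)) + (\<Sum>d=1..n-r. K (real d / b))"
proof -
  have r: "r \<in> {1..n}" using assms rank_pos[of i n y] rank_le[of n y i] by simp
  have "(\<Sum>j\<in>{..<n} - {i}. weight K h n y i j) = (\<Sum>j<n. weight K h n y i j) - weight K h n y i i"
    using assms by (simp add: sum_diff1)
  also have "\<dots> = (\<Sum>s=1..n. K ((real r - real s) / b)) - K ((real r - real r) / b)"
    unfolding weight_rank r_def[symmetric] b_def[symmetric]
    using sum_rank[of "\<lambda>s. K ((real r - real s) / b)" n y] by simp
  also have "\<dots> = (\<Sum>s\<in>{1..n} - {r}. K ((real r - real s) / b))"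
    using r by (simp add: sum_diff1)
  also have "\<dots> = (\<Sum>d=1..r-1. K ((real r - real (r - d)) / b)) + (\<Sum>d=1..n-r. K ((real r - real (r + d)) / b))"
    by (rule sum_split_at[OF r])
  also have "(\<Sum>d=1..r-1. K ((real r - real (r - d)) / b)) = (\<Sum>d=1..r-1. K (real d / b))"
    by (intro sum.cong) (auto simp: of_nat_diff)
  also have "(\<Sum>d=1..n-r. K ((real r - real (r + d)) / b)) = (\<Sum>d=1..n-r. K (real d / b))"
  proof (intro sum.cong refl)
    fix d show "K ((real r - real (r + d)) / b) = K (real d / b)" by (subst even) simp
  qed
  finally show ?thesis .
qed

lemma sum_weight_le:
  assumes "i < n" "h > 0"
  shows "(\<Sum>j\<in>{..<n} - {i}. weight K h n y i j) \<le> 2 * (real n * h)"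
proof -
  have "real n * h > 0" using assms by simp
  then have "(\<Sum>d=1..k. K (real d / (real n * h))) \<le> real n * h" for k by (rule Riemann_sum_le)
  then show ?thesis unfolding sum_weight_split[OF assms(1)] mult_2 by (intro add_mono)
qed

text \<open>An observation at the edge of the sample has neighbours on one side only. Since
  \<open>2 * m < n\<close>, at least one of the two sides contains \<open>m\<close> ranks, and that
  side alone gives the bound.\<close>

lemma sum_weight_ge:
  assumes "i < n" "2 * m < n"
  shows "(\<Sum>d=1..m. K (real d / (real n * h))) \<le> (\<Sum>j\<in>{..<n} - {i}. weight K h n y i j)"
proof -
  define r where "r = sample_rank n y i"
  have r: "1 \<le> r" "r \<le> n" using assms rank_pos rank_le by (auto simp: r_def)
  have *: "(\<Sum>d=1..m. K (real d / (real n * h))) \<le> (\<Sum>d=1..k. K (real d / (real n * h)))" if "m \<le> k" for k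
    using that nonneg by (intro sum_mono2) auto
  have **: "0 \<le> (\<Sum>d=1..k. K (real d / (real n * h)))" for k using nonneg by (intro sum_nonneg) auto
  consider "m \<le> r - 1" | "m \<le> n - r" using assms r by linarith
  then show ?thesis unfolding sum_weight_split[OF assms(1)] r_def[symmetric]
    using **[of "r - 1"] **[of "n - r"] by cases (drule *, linarith)+
qed

text \<open>Only pairs of ranks on different sides of \<open>N\<close> count. At most
  \<open>d\<close> of them are at distance \<open>d\<close>, because the lower rank must be one of
  the last \<open>d\<close> ranks up to \<open>N\<close>. The factor 2 accounts for both orders of a
  pair.\<close>

lemma sum_weight_halfline_le:
  assumes "h > 0"
  shows "(\<Sum>i<n. \<Sum>j<n. \<bar>of_bool (y i \<le> a) - of_bool (y j \<le> a)\<bar> * weight K h n y i j)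
    \<le> 2 * (\<Sum>d=1..n. real d * K (real d / (real n * h)))"
proof -
  define b where "b = real n * h"
  define N where "N = card {k. k < n \<and> y k \<le> a}"
  define f where "f s t = \<bar>of_bool (s \<le> N) - of_bool (t \<le> N)\<bar> * K ((real s - real t) / b)" for s t :: nat
  define A where "A = {(s, t). s \<in> {1..n} \<and> t \<in> {1..n} \<and> s \<le> N \<and> N < t}"
  have finA: "finite A" unfolding A_def by (rule finite_subset[of _ "{1..n} \<times> {1..n}"]) auto
  have A_le: "(\<Sum>(s, t)\<in>A. K ((real t - real s) / b)) \<le> (\<Sum>d=1..n. real d * K (real d / b))"
  proof -
    have "(\<Sum>(s, t)\<in>A. K ((real t - real s) / b)) =
        (\<Sum>d\<in>{1..n}. \<Sum>(s, t)\<in>{x \<in> A. (\<lambda>(s, t). t - s) x = d}. K ((real t - real s) / b))"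
      by (rule sum.group[symmetric, OF finA]) (auto simp: A_def)
    also have "\<dots> \<le> (\<Sum>d\<in>{1..n}. real d * K (real d / b))"
    proof (rule sum_mono)
      fix d assume d: "d \<in> {1..n}"
      let ?D = "{x \<in> A. (\<lambda>(s, t). t - s) x = d}"
      have "(\<Sum>(s, t)\<in>?D. K ((real t - real s) / b)) = (\<Sum>x\<in>?D. K (real d / b))"
        by (rule sum.cong) (auto simp: A_def of_nat_diff)
      also have "\<dots> = real (card ?D) * K (real d / b)" by simp
      \<comment> \<open>At a given distance the pair is determined by its lower rank
        \<open>s\<close>, and \<open>s \<le> N < s + d\<close> confines \<open>s\<close> to this
        interval. For \<open>d > N\<close> truncated subtraction yields \<open>{0..N}\<close>, which
        still has at most \<open>d\<close> elements.\<close>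
      also have "card ?D \<le> card {N + 1 - d..N}"
      proof (rule card_inj_on_le[of fst])
        show "inj_on fst ?D" by (auto simp: inj_on_def A_def)
        show "fst ` ?D \<subseteq> {N + 1 - d..N}" by (auto simp: A_def)
      qed simp
      then have "real (card ?D) * K (real d / b) \<le> real d * K (real d / b)"
        using nonneg by (intro mult_right_mono) auto
      finally show "(\<Sum>(s, t)\<in>?D. K ((real t - real s) / b)) \<le> real d * K (real d / b)" .
    qed
    finally show ?thesis .
  qed
  have "(\<Sum>i<n. \<Sum>j<n. \<bar>of_bool (y i \<le> a) - of_bool (y j \<le> a)\<bar> * weight K h n y i j)
      = (\<Sum>i<n. \<Sum>j<n. f (sample_rank n y i) (sample_rank n y j))"
    by (intro sum.cong refl) (simp add: f_def N_def rank_le_count_iff weight_rank b_def)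
  also have "\<dots> = (\<Sum>s=1..n. \<Sum>t=1..n. f s t)"
    using sum_rank[of "\<lambda>t. \<Sum>j<n. f t (sample_rank n y j)" n y] by (simp add: sum_rank)
  also have "\<dots> = (\<Sum>(s, t)\<in>{1..n} \<times> {1..n}. f s t)" by (simp add: sum.cartesian_product)
  also have "\<dots> = (\<Sum>(s, t)\<in>A. f s t) + (\<Sum>(s, t)\<in>prod.swap ` A. f s t)"
  proof -
    have "(\<Sum>(s, t)\<in>{1..n} \<times> {1..n}. f s t) = (\<Sum>(s, t)\<in>A \<union> prod.swap ` A. f s t)"
      by (rule sum.mono_neutral_right) (auto simp: A_def f_def image_iff split: prod.splits)
    also have "\<dots> = (\<Sum>(s, t)\<in>A. f s t) + (\<Sum>(s, t)\<in>prod.swap ` A. f s t)"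
      by (rule sum.union_disjoint) (use finA in \<open>auto simp: A_def\<close>)
    finally show ?thesis .
  qed
  also have "(\<Sum>(s, t)\<in>prod.swap ` A. f s t) = (\<Sum>(s, t)\<in>A. f t s)"
    by (subst sum.reindex) (auto simp: case_prod_beta)
  also have "(\<Sum>(s, t)\<in>A. f s t) = (\<Sum>(s, t)\<in>A. K ((real t - real s) / b))"
  proof (intro sum.cong refl, clarify)
    fix s t assume "(s, t) \<in> A"
    then show "f s t = K ((real t - real s) / b)"
      using even[of "(real s - real t) / b"] minus_divide_left[of "real s - real t" b]
      by (simp add: f_def A_def)
  qed
  also have "(\<Sum>(s, t)\<in>A. f t s) = (\<Sum>(s, t)\<in>A. K ((real t - real s) / b))"
    by (intro sum.cong refl) (auto simp: A_def f_def)
  finally show ?thesis using A_le by (simp add: b_def)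
qed

end

section \<open>Off-diagonal bilinear forms with symmetric weights\<close>

definition wform :: "nat \<Rightarrow> (nat \<Rightarrow> nat \<Rightarrow> real) \<Rightarrow> (nat \<Rightarrow> 'a::real_inner) \<Rightarrow> (nat \<Rightarrow> 'a) \<Rightarrow> real" where
  "wform n k u v = (\<Sum>i<n. \<Sum>j\<in>{..<n} - {i}. inner (u i) (v j) * k i j)"

lemma sum_offdiag_swap:
  fixes f :: "nat \<Rightarrow> nat \<Rightarrow> 'b::comm_monoid_add"
  shows "(\<Sum>i<n. \<Sum>j\<in>{..<n} - {i}. f i j) = (\<Sum>i<n. \<Sum>j\<in>{..<n} - {i}. f j i)"
proof -
  have "(\<Sum>j\<in>{..<n} - {i}. g j) = (\<Sum>j<n. if j \<noteq> i then g j else 0)" for i and g :: "nat \<Rightarrow> 'b"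
    by (subst sum.inter_filter[symmetric]) (auto intro!: sum.cong)
  then show ?thesis by (simp only:) (subst sum.swap, intro sum.cong refl, auto)
qed

lemma wform_commute:
  assumes "\<And>i j. k i j = k j i"
  shows "wform n k u v = wform n k v u"
  unfolding wform_def by (subst sum_offdiag_swap) (simp add: inner_commute assms[symmetric])

text \<open>Used with \<open>c = 1\<close> for the splitting of the signal and with
  \<open>c = r n\<close> for the sum of noise and signal; symmetry merges the two cross
  terms.\<close>

lemma wform_add_scale:
  assumes "\<And>i j. k i j = k j i"
  shows "wform n k (\<lambda>i. u i + c *\<^sub>R v i) (\<lambda>i. u i + c *\<^sub>R v i) =
    wform n k u u + 2 * c * wform n k u v + c\<^sup>2 * wform n k v v"
proof -
  have "wform n k (\<lambda>i. u i + c *\<^sub>R v i) (\<lambda>i. u i + c *\<^sub>R v i) =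
    wform n k u u + c * wform n k u v + c * wform n k v u + c\<^sup>2 * wform n k v v"
    unfolding wform_def sum_distrib_left sum.distrib[symmetric]
    by (intro sum.cong refl) (simp add: inner_add_left inner_add_right algebra_simps power2_eq_square)
  then show ?thesis using wform_commute[OF assms, where u = u and v = v] by simp
qed

lemma weighted_AM_GM:
  fixes a b t :: real
  assumes "t > 0"
  shows "2 * (a * b) \<le> t * a\<^sup>2 + b\<^sup>2 / t"
proof -
  have "0 \<le> (t * a - b)\<^sup>2 / t" using assms by simp
  also have "\<dots> = t * a\<^sup>2 + b\<^sup>2 / t - 2 * (a * b)"
    using assms by (simp add: power2_eq_square field_simps)
  finally show ?thesis by simp
qed

text \<open>A Schur test: each inner product is split by \<open>weighted_AM_GM\<close>, after which
  symmetry turns column sums into row sums. The free parameter \<open>t\<close> makes a form with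
  one small argument small: a small \<open>t\<close> tames the other argument, and the small one
  absorbs \<open>1 / t\<close>.\<close>

lemma abs_wform_le:
  assumes sym: "\<And>i j. k i j = k j i" and nonneg: "\<And>i j. 0 \<le> k i j"
    and row: "\<And>i. i < n \<Longrightarrow> (\<Sum>j\<in>{..<n} - {i}. k i j) \<le> L" and t: "t > 0"
  shows "2 * \<bar>wform n k u v\<bar> \<le> L * (t * (\<Sum>i<n. (norm (u i))\<^sup>2) + (\<Sum>i<n. (norm (v i))\<^sup>2) / t)"
proof -
  have "2 * \<bar>wform n k u v\<bar> \<le> (\<Sum>i<n. \<Sum>j\<in>{..<n} - {i}. (t * (norm (u i))\<^sup>2 + (norm (v j))\<^sup>2 / t) * k i j)"
  proof -
    have "\<bar>wform n k u v\<bar> \<le> (\<Sum>i<n. \<Sum>j\<in>{..<n} - {i}. \<bar>inner (u i) (v j) * k i j\<bar>)"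
      unfolding wform_def by (intro order.trans[OF sum_abs] sum_mono order.refl)
    then have "2 * \<bar>wform n k u v\<bar> \<le> (\<Sum>i<n. \<Sum>j\<in>{..<n} - {i}. 2 * \<bar>inner (u i) (v j) * k i j\<bar>)"
      by (simp add: sum_distrib_left[symmetric])
    also have "\<dots> \<le> (\<Sum>i<n. \<Sum>j\<in>{..<n} - {i}. (t * (norm (u i))\<^sup>2 + (norm (v j))\<^sup>2 / t) * k i j)"
    proof (intro sum_mono)
      fix i j
      have "2 * \<bar>inner (u i) (v j)\<bar> \<le> t * (norm (u i))\<^sup>2 + (norm (v j))\<^sup>2 / t"
        using weighted_AM_GM[OF t, of "norm (u i)" "norm (v j)"] Cauchy_Schwarz_ineq2[of "u i" "v j"] by linarith
      then show "2 * \<bar>inner (u i) (v j) * k i j\<bar> \<le> (t * (norm (u i))\<^sup>2 + (norm (v j))\<^sup>2 / t) * k i j"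
        using mult_right_mono[OF _ nonneg[of i j], of "2 * \<bar>inner (u i) (v j)\<bar>"] nonneg[of i j]
        by (simp add: abs_mult mult.assoc)
    qed
    finally show ?thesis .
  qed
  also have "\<dots> = (\<Sum>i<n. \<Sum>j\<in>{..<n} - {i}. t * (norm (u i))\<^sup>2 * k i j)
      + (\<Sum>i<n. \<Sum>j\<in>{..<n} - {i}. (norm (v i))\<^sup>2 / t * k i j)"
    by (subst sum_offdiag_swap[of "\<lambda>i j. (norm (v i))\<^sup>2 / t * k i j"])
      (simp add: sum.distrib[symmetric] distrib_right, simp add: sym)
  also have "\<dots> \<le> (\<Sum>i<n. t * (norm (u i))\<^sup>2 * L) + (\<Sum>i<n. (norm (v i))\<^sup>2 / t * L)"
    unfolding sum_distrib_left[symmetric] using row t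
    by (intro add_mono sum_mono mult_left_mono) auto
  also have "\<dots> = L * (t * (\<Sum>i<n. (norm (u i))\<^sup>2) + (\<Sum>i<n. (norm (v i))\<^sup>2) / t)"
    by (simp add: sum_distrib_left sum_divide_distrib algebra_simps)
  finally show ?thesis .
qed

text \<open>Encoding by jumps: a pair \<open>(a, c)\<close> contributes \<open>c\<close> on the
  half-line up to \<open>a\<close>. The variation along the ranks is then bounded jump by jump, so
  that an estimate for one half-line suffices. The thresholds need be neither sorted nor
  distinct.\<close>

definition step :: "(real \<times> 'a::real_vector) list \<Rightarrow> real \<Rightarrow> 'a" where
  "step cs w = (\<Sum>(a, c)\<leftarrow>cs. of_bool (w \<le> a) *\<^sub>R c)"

text \<open>The sum of the jump sizes bounds the total variation and, as a step function vanishes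
  far to the right, also its norm.\<close>

definition step_var :: "(real \<times> 'a::real_normed_vector) list \<Rightarrow> real" where
  "step_var cs = (\<Sum>(a, c)\<leftarrow>cs. norm c)"

lemma step_var_nonneg: "0 \<le> step_var cs"
  unfolding step_var_def by (induction cs) auto

lemma norm_step_le: "norm (step cs w) \<le> step_var cs"
proof (induction cs)
  case (Cons ac cs)
  then show ?case
    by (cases ac) (auto simp: step_def step_var_def of_bool_def intro: norm_triangle_le add_increasing)
qed (simp add: step_def step_var_def)

lemma norm_step_diff_le: "norm (step cs v - step cs w) \<le> (\<Sum>(a, c)\<leftarrow>cs. \<bar>of_bool (v \<le> a) - of_bool (w \<le> a)\<bar> * norm c)"
proof (induction cs)
  case (Cons ac cs)
  obtain a c where ac: "ac = (a, c)" by force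
  have "step (ac # cs) v - step (ac # cs) w = (of_bool (v \<le> a) - of_bool (w \<le> a)) *\<^sub>R c + (step cs v - step cs w)"
    by (simp add: step_def ac algebra_simps)
  then have "norm (step (ac # cs) v - step (ac # cs) w) \<le>
      norm ((of_bool (v \<le> a) - of_bool (w \<le> a) :: real) *\<^sub>R c) + norm (step cs v - step cs w)"
    using norm_triangle_ineq by metis
  then show ?case using Cons by (simp add: ac)
qed (simp add: step_def)

lemma step_append: "step (cs @ cs') w = step cs w + step cs' w"
  by (simp add: step_def)

lemma measurable_step[measurable]: "step cs \<in> borel_measurable (borel :: real measure)"
  for cs :: "(real \<times> 'a::{real_normed_vector, second_countable_topology}) list"
proof (induction cs)
  case (Cons ac cs)
  have "step (ac # cs) = (\<lambda>w. of_bool (w \<le> fst ac) *\<^sub>R snd ac + step cs w)"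
    by (auto simp: step_def fun_eq_iff case_prod_beta)
  then show ?case using Cons by simp
qed (simp add: step_def)

lemma (in kernel) sum_step_diff_le:
  assumes "h > 0"
  shows "(\<Sum>i<n. \<Sum>j<n. norm (step cs (y i) - step cs (y j)) * weight K h n y i j)
    \<le> step_var cs * (2 * (\<Sum>d=1..n. real d * K (real d / (real n * h))))"
proof -
  let ?D = "2 * (\<Sum>d=1..n. real d * K (real d / (real n * h)))"
  have "(\<Sum>i<n. \<Sum>j<n. norm (step cs (y i) - step cs (y j)) * weight K h n y i j) \<le>
    (\<Sum>i<n. \<Sum>j<n. (\<Sum>(a, c)\<leftarrow>cs. \<bar>of_bool (y i \<le> a) - of_bool (y j \<le> a)\<bar> * norm c) * weight K h n y i j)"
    by (intro sum_mono mult_right_mono norm_step_diff_le weight_nonneg)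
  also have "\<dots> \<le> step_var cs * ?D"
  proof (induction cs)
    case (Cons ac cs)
    obtain a c where ac: "ac = (a, c)" by force
    have "(\<Sum>i<n. \<Sum>j<n. (\<Sum>(a, c)\<leftarrow>ac # cs. \<bar>of_bool (y i \<le> a) - of_bool (y j \<le> a)\<bar> * norm c) * weight K h n y i j)
      = norm c * (\<Sum>i<n. \<Sum>j<n. \<bar>of_bool (y i \<le> a) - of_bool (y j \<le> a)\<bar> * weight K h n y i j)
        + (\<Sum>i<n. \<Sum>j<n. (\<Sum>(a, c)\<leftarrow>cs. \<bar>of_bool (y i \<le> a) - of_bool (y j \<le> a)\<bar> * norm c) * weight K h n y i j)"
      by (simp add: ac sum_distrib_left sum.distrib[symmetric] algebra_simps)
    also have "\<dots> \<le> norm c * ?D + step_var cs * ?D"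
      using sum_weight_halfline_le[OF assms] Cons by (intro add_mono mult_left_mono) auto
    also have "\<dots> = step_var (ac # cs) * ?D" by (simp add: ac step_var_def algebra_simps)
    finally show ?case .
  qed (simp add: step_var_def)
  finally show ?thesis .
qed

text \<open>Replacing the second factor \<open>step cs (y j)\<close> by \<open>step cs (y i)\<close>
  turns the form into squared norms times row sums, which is where \<open>l\<close> enters. The
  error is at most \<open>step_var cs\<close>, as a bound of the norm, times the weighted variation;
  the latter carries another factor \<open>step_var cs\<close>, hence the square.\<close>

lemma (in kernel) wform_step_ge:
  assumes h: "h > 0" and low: "\<And>i. i < n \<Longrightarrow> l \<le> (\<Sum>j\<in>{..<n} - {i}. weight K h n y i j)"
  shows "l * (\<Sum>i<n. (norm (step cs (y i)))\<^sup>2) - (step_var cs)\<^sup>2 * (2 * (\<Sum>d=1..n. real d * K (real d / (real n * h))))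
    \<le> wform n (weight K h n y) (\<lambda>i. step cs (y i)) (\<lambda>i. step cs (y i))"
proof -
  let ?G = "\<lambda>i. step cs (y i)" and ?w = "weight K h n y" and ?V = "step_var cs"
  have "l * (\<Sum>i<n. (norm (?G i))\<^sup>2) \<le> (\<Sum>i<n. (norm (?G i))\<^sup>2 * (\<Sum>j\<in>{..<n} - {i}. ?w i j))"
    unfolding sum_distrib_left[of l]
  proof (intro sum_mono)
    fix i assume "i \<in> {..<n}"
    then show "l * (norm (?G i))\<^sup>2 \<le> (norm (?G i))\<^sup>2 * (\<Sum>j\<in>{..<n} - {i}. ?w i j)"
      using mult_left_mono[OF low, of i "(norm (?G i))\<^sup>2"] by (simp add: mult.commute)
  qed
  also have "\<dots> = (\<Sum>i<n. \<Sum>j\<in>{..<n} - {i}. inner (?G i) (?G i) * ?w i j)"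
    by (simp add: sum_distrib_left power2_norm_eq_inner)
  also have "\<dots> \<le> (\<Sum>i<n. \<Sum>j\<in>{..<n} - {i}. inner (?G i) (?G j) * ?w i j + ?V * (norm (?G i - ?G j) * ?w i j))"
  proof (intro sum_mono)
    fix i j
    have "inner (?G i) (?G i) - inner (?G i) (?G j) \<le> norm (?G i) * norm (?G i - ?G j)"
      using norm_cauchy_schwarz[of "?G i" "?G i - ?G j"] by (simp add: inner_diff_right)
    also have "\<dots> \<le> ?V * norm (?G i - ?G j)" by (intro mult_right_mono norm_step_le) simp
    finally have "(inner (?G i) (?G i) - inner (?G i) (?G j)) * ?w i j \<le> ?V * norm (?G i - ?G j) * ?w i j"
      by (intro mult_right_mono weight_nonneg)
    then show "inner (?G i) (?G i) * ?w i j \<le> inner (?G i) (?G j) * ?w i j + ?V * (norm (?G i - ?G j) * ?w i j)"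
      by (simp add: algebra_simps)
  qed
  also have "\<dots> = wform n ?w ?G ?G + ?V * (\<Sum>i<n. \<Sum>j\<in>{..<n} - {i}. norm (?G i - ?G j) * ?w i j)"
    by (simp add: wform_def sum.distrib sum_distrib_left)
  also have "\<dots> \<le> wform n ?w ?G ?G + ?V * (?V * (2 * (\<Sum>d=1..n. real d * K (real d / (real n * h)))))"
  proof (intro add_left_mono mult_left_mono step_var_nonneg)
    have "(\<Sum>i<n. \<Sum>j\<in>{..<n} - {i}. norm (?G i - ?G j) * ?w i j) \<le> (\<Sum>i<n. \<Sum>j<n. norm (?G i - ?G j) * ?w i j)"
      by (intro sum_mono sum_mono2) (auto intro: mult_nonneg_nonneg weight_nonneg)
    also have "\<dots> \<le> ?V * (2 * (\<Sum>d=1..n. real d * K (real d / (real n * h))))"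
      by (rule sum_step_diff_le[OF h])
    finally show "(\<Sum>i<n. \<Sum>j\<in>{..<n} - {i}. norm (?G i - ?G j) * ?w i j) \<le>
      ?V * (2 * (\<Sum>d=1..n. real d * K (real d / (real n * h))))" .
  qed
  finally show ?thesis by (simp add: power2_eq_square algebra_simps)
qed

section \<open>Degenerate terms\<close>

lemma weight_cong:
  "(\<And>k. k < n \<Longrightarrow> y k = y' k) \<Longrightarrow> i < n \<Longrightarrow> j < n \<Longrightarrow> weight K h n y i j = weight K h n y' i j"
  unfolding weight_def using ecdf_at_cong[of n y y' i] ecdf_at_cong[of n y y' j] by simp

lemma (in kernel) measurable_weight[measurable (raw)]:
  assumes "\<And>k. k < n \<Longrightarrow> (\<lambda>\<omega>. y \<omega> k) \<in> borel_measurable M" "i < n" "j < n"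
  shows "(\<lambda>\<omega>. weight K h n (y \<omega>) i j) \<in> borel_measurable M"
  unfolding weight_def
  using measurable_ecdf_at[OF assms(1,2)] measurable_ecdf_at[OF assms(1,3)] by simp

text \<open>\<open>e\<close> has conditional mean zero given \<open>w\<close>, in a form that needs no version of the conditional
  expectation.\<close>

definition cond_centered ::
    "'z measure \<Rightarrow> 't measure \<Rightarrow> ('z \<Rightarrow> 't) \<Rightarrow> ('z \<Rightarrow> 'a::{real_inner, second_countable_topology}) \<Rightarrow> bool" where
  "cond_centered P T w e \<longleftrightarrow> e \<in> borel_measurable P \<and> w \<in> P \<rightarrow>\<^sub>M T \<and>
     (\<forall>H\<in>borel_measurable T. integrable P (\<lambda>y. norm (e y) * norm (H (w y))) \<longrightarrow>
        (\<integral>y. inner (e y) (H (w y)) \<partial>P) = 0)"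

text \<open>For a simple \<open>H\<close> the integral is a finite sum of values of \<open>H\<close>
  paired with set integrals of \<open>e\<close>, all zero. The approximants satisfy
  \<open>norm (s i x) \<le> 2 * norm (H x)\<close>, so the assumed integrability supplies the
  dominating function for the passage to the limit.\<close>

lemma cond_centeredI:
  fixes T :: "'t measure" and e :: "'z \<Rightarrow> 'a::{real_inner, banach, second_countable_topology}"
  assumes e[measurable]: "integrable P e" and w[measurable]: "w \<in> P \<rightarrow>\<^sub>M T"
    and zero: "\<And>A. A \<in> sets T \<Longrightarrow> (\<integral>y. indicator A (w y) *\<^sub>R e y \<partial>P) = 0"
  shows "cond_centered P T w e"
  unfolding cond_centered_def
proof (intro conjI ballI impI)
  fix H :: "'t \<Rightarrow> 'a" assume H[measurable]: "H \<in> borel_measurable T"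
    and int: "integrable P (\<lambda>y. norm (e y) * norm (H (w y)))"
  obtain s where s: "\<And>i. simple_function T (s i)" "\<And>x. x \<in> space T \<Longrightarrow> (\<lambda>i. s i x) \<longlonglongrightarrow> H x"
      "\<And>i x. x \<in> space T \<Longrightarrow> norm (s i x) \<le> 2 * norm (H x)"
    using borel_measurable_implies_sequence_metric[OF H, of 0] unfolding dist_0_norm dist_norm diff_0_right by blast
  have [measurable]: "s i \<in> borel_measurable T" for i
    using s(1) by (rule borel_measurable_simple_function)
  have wsp: "w y \<in> space T" if "y \<in> space P" for y using measurable_space[OF w that] .
  have s0: "(\<integral>y. inner (e y) (s i (w y)) \<partial>P) = 0" for i
  proof -
    let ?V = "s i ` space T" and ?A = "\<lambda>v. s i -` {v} \<inter> space T"
    have fin: "finite ?V" and A: "?A v \<in> sets T" for v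
      using s(1)[of i] by (auto simp: simple_function_def intro: simple_functionD)
    have eq: "inner (e y) (s i (w y)) = (\<Sum>v\<in>?V. inner (indicator (?A v) (w y) *\<^sub>R e y) v)" if "y \<in> space P" for y
    proof -
      have "(\<Sum>v\<in>?V. inner (indicator (?A v) (w y) *\<^sub>R e y) v) = (\<Sum>v\<in>?V. if v = s i (w y) then inner (e y) v else 0)"
        using wsp[OF that] by (intro sum.cong) (auto simp: indicator_def)
      also have "\<dots> = inner (e y) (s i (w y))" using fin wsp[OF that] by (simp add: sum.delta')
      finally show ?thesis by simp
    qed
    have int: "integrable P (\<lambda>y. indicator (?A v) (w y) *\<^sub>R e y)" for v
    proof -
      have "w -` ?A v \<inter> space P \<in> sets P" using A by measurable
      note * = integrable_mult_indicator[OF this e]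
      have "integrable P (\<lambda>y. indicator (?A v) (w y) *\<^sub>R e y) \<longleftrightarrow>
          integrable P (\<lambda>y. indicator (w -` ?A v \<inter> space P) y *\<^sub>R e y)"
        by (rule Bochner_Integration.integrable_cong) (auto simp: indicator_def)
      with * show ?thesis by simp
    qed
    have "(\<integral>y. inner (e y) (s i (w y)) \<partial>P) = (\<integral>y. (\<Sum>v\<in>?V. inner (indicator (?A v) (w y) *\<^sub>R e y) v) \<partial>P)"
      by (rule Bochner_Integration.integral_cong) (use eq in auto)
    also have "\<dots> = (\<Sum>v\<in>?V. \<integral>y. inner (indicator (?A v) (w y) *\<^sub>R e y) v \<partial>P)"
      by (rule Bochner_Integration.integral_sum) (rule integrable_inner_left, rule int)
    also have "\<dots> = (\<Sum>v\<in>?V. inner (\<integral>y. indicator (?A v) (w y) *\<^sub>R e y \<partial>P) v)"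
      by (intro sum.cong refl integral_inner_left int)
    also have "\<dots> = 0" using zero A by simp
    finally show ?thesis .
  qed
  have "(\<lambda>i. \<integral>y. inner (e y) (s i (w y)) \<partial>P) \<longlonglongrightarrow> (\<integral>y. inner (e y) (H (w y)) \<partial>P)"
  proof (rule integral_dominated_convergence[where w = "\<lambda>y. 2 * (norm (e y) * norm (H (w y)))"])
    show "AE y in P. (\<lambda>i. inner (e y) (s i (w y))) \<longlonglongrightarrow> inner (e y) (H (w y))"
      by (rule AE_I2) (intro tendsto_intros s wsp)
    show "AE y in P. norm (inner (e y) (s i (w y))) \<le> 2 * (norm (e y) * norm (H (w y)))" for i
    proof (rule AE_I2)
      fix y assume "y \<in> space P"
      then have "norm (e y) * norm (s i (w y)) \<le> norm (e y) * (2 * norm (H (w y)))"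
        by (intro mult_left_mono s wsp) auto
      then show "norm (inner (e y) (s i (w y))) \<le> 2 * (norm (e y) * norm (H (w y)))"
        using Cauchy_Schwarz_ineq2[of "e y" "s i (w y)"] by simp
    qed
  qed (use int in \<open>auto intro!: borel_measurable_inner\<close>)
  then show "(\<integral>y. inner (e y) (H (w y)) \<partial>P) = 0"
    unfolding s0 by (simp add: LIMSEQ_const_iff)
qed (use e w in auto)

lemma cond_centeredD:
  "cond_centered P T w e \<Longrightarrow> H \<in> borel_measurable T \<Longrightarrow> integrable P (\<lambda>y. norm (e y) * norm (H (w y))) \<Longrightarrow>
    (\<integral>y. inner (e y) (H (w y)) \<partial>P) = 0"
  unfolding cond_centered_def by simp

lemma integrable_mult_of_squares:
  fixes f g :: "'w \<Rightarrow> real"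
  assumes [measurable]: "f \<in> borel_measurable M" "g \<in> borel_measurable M"
    and "integrable M (\<lambda>x. (f x)\<^sup>2)" "integrable M (\<lambda>x. (g x)\<^sup>2)"
  shows "integrable M (\<lambda>x. f x * g x)"
proof (rule Bochner_Integration.integrable_bound)
  show "integrable M (\<lambda>x. (f x)\<^sup>2 + (g x)\<^sup>2)" using assms by simp
  show "AE x in M. norm (f x * g x) \<le> norm ((f x)\<^sup>2 + (g x)\<^sup>2)"
  proof (rule AE_I2)
    fix x
    have "2 * (\<bar>f x\<bar> * \<bar>g x\<bar>) \<le> (f x)\<^sup>2 + (g x)\<^sup>2"
      using weighted_AM_GM[of 1 "\<bar>f x\<bar>" "\<bar>g x\<bar>"] by simp
    moreover have "0 \<le> \<bar>f x\<bar> * \<bar>g x\<bar>" by simp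
    ultimately have "\<bar>f x\<bar> * \<bar>g x\<bar> \<le> (f x)\<^sup>2 + (g x)\<^sup>2" by linarith
    then show "norm (f x * g x) \<le> norm ((f x)\<^sup>2 + (g x)\<^sup>2)" by (simp add: abs_mult)
  qed
qed measurable

lemma integral_square_sum_orthogonal:
  fixes D :: "'i \<Rightarrow> 'w \<Rightarrow> real"
  assumes fin: "finite A" and [measurable]: "\<And>a. a \<in> A \<Longrightarrow> D a \<in> borel_measurable M"
    and sq: "\<And>a. a \<in> A \<Longrightarrow> integrable M (\<lambda>x. (D a x)\<^sup>2)"
    and orth: "\<And>a b. a \<in> A \<Longrightarrow> b \<in> A \<Longrightarrow> a \<noteq> b \<Longrightarrow> (\<integral>x. D a x * D b x \<partial>M) = 0"
  shows "integrable M (\<lambda>x. (\<Sum>a\<in>A. D a x)\<^sup>2)"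
    and "(\<integral>x. (\<Sum>a\<in>A. D a x)\<^sup>2 \<partial>M) = (\<Sum>a\<in>A. \<integral>x. (D a x)\<^sup>2 \<partial>M)"
proof -
  have eq: "(\<Sum>a\<in>A. D a x)\<^sup>2 = (\<Sum>a\<in>A. \<Sum>b\<in>A. D a x * D b x)" for x
    by (simp add: power2_eq_square sum_product)
  have int: "integrable M (\<lambda>x. D a x * D b x)" if "a \<in> A" "b \<in> A" for a b
    using that by (intro integrable_mult_of_squares sq) auto
  show "integrable M (\<lambda>x. (\<Sum>a\<in>A. D a x)\<^sup>2)"
    unfolding eq by (intro Bochner_Integration.integrable_sum int)
  have "(\<integral>x. (\<Sum>a\<in>A. D a x)\<^sup>2 \<partial>M) = (\<Sum>a\<in>A. \<Sum>b\<in>A. \<integral>x. D a x * D b x \<partial>M)"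
    unfolding eq by (subst Bochner_Integration.integral_sum, intro Bochner_Integration.integrable_sum int)
      (auto intro!: sum.cong Bochner_Integration.integral_sum int)
  also have "\<dots> = (\<Sum>a\<in>A. \<Sum>b\<in>A. if b = a then \<integral>x. (D a x)\<^sup>2 \<partial>M else 0)"
    by (intro sum.cong refl) (auto simp: orth power2_eq_square)
  also have "\<dots> = (\<Sum>a\<in>A. \<integral>x. (D a x)\<^sup>2 \<partial>M)" using fin by (simp add: sum.delta)
  finally show "(\<integral>x. (\<Sum>a\<in>A. D a x)\<^sup>2 \<partial>M) = (\<Sum>a\<in>A. \<integral>x. (D a x)\<^sup>2 \<partial>M)" .
qed

section \<open>Independent samples and integration over one observation\<close>

locale iid_sample = prob_space M for M :: "'w measure" +
  fixes S :: "'z measure" and P :: "'z measure" and Z :: "nat \<Rightarrow> 'w \<Rightarrow> 'z"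
  assumes indep: "indep_vars (\<lambda>_. S) Z UNIV"
    and distr: "\<And>i. distr M S (Z i) = P"
begin

lemma measurable_Z[measurable]: "Z i \<in> M \<rightarrow>\<^sub>M S"
  using indep by (auto simp: indep_vars_def)

lemma sets_P[measurable_cong, simp]: "sets P = sets S" and space_P[simp]: "space P = space S"
  using distr[of 0] by (auto dest: arg_cong[where f = sets] arg_cong[where f = space])

lemma prob_space_P: "prob_space P"
  unfolding distr[of 0, symmetric] by (rule prob_space_distr) measurable

lemma integral_Z: "f \<in> borel_measurable S \<Longrightarrow> (\<integral>\<omega>. f (Z i \<omega>) \<partial>M) = integral\<^sup>L P f"
  for f :: "'z \<Rightarrow> 'b::{banach, second_countable_topology}"
  unfolding distr[of i, symmetric] by (subst integral_distr) auto

lemma integrable_Z: "f \<in> borel_measurable S \<Longrightarrow> integrable P f \<Longrightarrow> integrable M (\<lambda>\<omega>. f (Z i \<omega>))"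
  for f :: "'z \<Rightarrow> 'b::{banach, second_countable_topology}"
  unfolding distr[of i, symmetric] by (subst (asm) integrable_distr_eq) auto

text \<open>Fubini for the product law of the first \<open>n\<close> observations, with coordinate
  \<open>i\<close> integrated first. By \<open>cong\<close>, the function \<open>F\<close> sees only
  these coordinates although it takes infinite sequences, so the sample may be replaced by its
  restriction.\<close>

lemma integral_eq_0_if_section_integral_eq_0:
  fixes F :: "(nat \<Rightarrow> 'z) \<Rightarrow> real"
  assumes i: "i < n" and F[measurable]: "F \<in> borel_measurable (PiM {..<n} (\<lambda>_. S))"
    and cong: "\<And>x x'. (\<And>j. j < n \<Longrightarrow> x j = x' j) \<Longrightarrow> F x = F x'"
    and zero: "\<And>x. (\<And>j. j < n \<Longrightarrow> j \<noteq> i \<Longrightarrow> x j \<in> space S) \<Longrightarrow> (\<integral>y. F (x(i := y)) \<partial>P) = 0"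
  shows "(\<integral>\<omega>. F (\<lambda>j. Z j \<omega>) \<partial>M) = 0"
proof -
  interpret P: prob_space P by (rule prob_space_P)
  interpret product_sigma_finite "\<lambda>_. P" by standard
  let ?R = "\<lambda>\<omega>. \<lambda>j\<in>{..<n}. Z j \<omega>"
  have PiM: "distr M (PiM {..<n} (\<lambda>_. S)) ?R = PiM {..<n} (\<lambda>_. P)"
  proof -
    have "indep_vars (\<lambda>_. S) Z {..<n}" using indep by (rule indep_vars_subset) simp
    then show ?thesis using i by (subst (asm) indep_vars_iff_distr_eq_PiM') (auto simp: distr)
  qed
  have "(\<integral>\<omega>. F (\<lambda>j. Z j \<omega>) \<partial>M) = (\<integral>\<omega>. F (?R \<omega>) \<partial>M)"
    by (intro Bochner_Integration.integral_cong refl cong) simp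
  also have "\<dots> = integral\<^sup>L (PiM {..<n} (\<lambda>_. P)) F"
    unfolding PiM[symmetric] by (subst integral_distr) auto
  also have "\<dots> = 0"
  \<comment> \<open>Fubini requires integrability; a function that is not integrable has integral 0
    by convention, so the equation holds in that case too.\<close>
  proof (cases "integrable (PiM {..<n} (\<lambda>_. P)) F")
    case True
    have eq: "insert i ({..<n} - {i}) = {..<n}" using i by auto
    have "integral\<^sup>L (PiM (insert i ({..<n} - {i})) (\<lambda>_. P)) F =
        (\<integral>x. (\<integral>y. F (x(i := y)) \<partial>P) \<partial>PiM ({..<n} - {i}) (\<lambda>_. P))"
      by (rule product_integral_insert) (use True eq in auto)
    also have "\<dots> = (\<integral>x. 0 \<partial>PiM ({..<n} - {i}) (\<lambda>_. P))"
    proof (intro Bochner_Integration.integral_cong refl zero)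
      fix x j assume "x \<in> space (PiM ({..<n} - {i}) (\<lambda>_. P))" "j < n" "j \<noteq> i"
      then show "x j \<in> space S" by (auto simp: space_PiM PiE_iff)
    qed
    finally show ?thesis unfolding eq by simp
  qed (rule not_integrable_integral_eq)
  finally show ?thesis .
qed

end

text \<open>Here \<open>w\<close> is the part of an observation through which it may enter the
  weights, and \<open>f\<close> is the score that is ranked. Keeping them apart allows centering
  given more than the ranked score, as for \<open>U0\<close>, which is centered given the whole
  covariate.\<close>

locale weighted_sample = iid_sample M S P Z + kernel K
  for M :: "'w measure" and S P :: "'z measure" and Z :: "nat \<Rightarrow> 'w \<Rightarrow> 'z" and K :: "real \<Rightarrow> real" +
  fixes T :: "'t measure" and w :: "'z \<Rightarrow> 't" and f :: "'t \<Rightarrow> real"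
  assumes measurable_w[measurable]: "w \<in> S \<rightarrow>\<^sub>M T" and measurable_f[measurable]: "f \<in> borel_measurable T"
begin

abbreviation \<kappa> :: "real \<Rightarrow> nat \<Rightarrow> (nat \<Rightarrow> 'z) \<Rightarrow> nat \<Rightarrow> nat \<Rightarrow> real" where
  "\<kappa> h n x \<equiv> weight K h n (\<lambda>k. f (w (x k)))"

lemma \<kappa>_cong: "(\<And>k. k < n \<Longrightarrow> x k = x' k) \<Longrightarrow> i < n \<Longrightarrow> j < n \<Longrightarrow> \<kappa> h n x i j = \<kappa> h n x' i j"
  by (rule weight_cong) auto

lemma measurable_\<kappa>: "i < n \<Longrightarrow> j < n \<Longrightarrow> (\<lambda>x. \<kappa> h n x i j) \<in> borel_measurable (PiM {..<n} (\<lambda>_. S))"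
  by (rule measurable_weight) auto

lemma measurable_\<kappa>_Z: "i < n \<Longrightarrow> j < n \<Longrightarrow> (\<lambda>\<omega>. \<kappa> h n (\<lambda>k. Z k \<omega>) i j) \<in> borel_measurable M"
  by (rule measurable_weight) auto

text \<open>A change of one observation may alter every weight, but only through
  \<open>f (w y)\<close>. This is what makes the section of a product of terms a function of
  \<open>w y\<close>, apart from the factor \<open>e y\<close>.\<close>

lemma \<kappa>_update: "\<kappa> h n (x(m := y)) = weight K h n ((\<lambda>k. f (w (x k)))(m := f (w y)))"
  by (intro arg_cong[where f = "weight K h n"]) auto

lemma measurable_weight_update:
  "i < n \<Longrightarrow> j < n \<Longrightarrow> (\<lambda>t. weight K h n (y(m := f t)) i j) \<in> borel_measurable T"
  by (rule measurable_weight) (auto simp: fun_upd_def)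

text \<open>Observation \<open>m\<close> occurs in exactly one of the four vectors and elsewhere
  only through the weights. With all other observations fixed, the product is
  \<open>inner (e y) (H (w y))\<close> with \<open>H\<close> bounded, and the centering of
  \<open>e\<close> gives 0. The indices \<open>a\<close>, \<open>b\<close>, \<open>c\<close> may
  partly coincide.\<close>

lemma degenerate_orthogonal:
  fixes e :: "'z \<Rightarrow> 'a::{real_inner, banach, second_countable_topology}"
  assumes e: "cond_centered P T w e" and e1: "integrable P e"
    and lt: "m < n" "a < n" "b < n" "c < n" and ne: "m \<noteq> a" "m \<noteq> b" "m \<noteq> c"
  shows "(\<integral>\<omega>. (inner (e (Z m \<omega>)) (e (Z a \<omega>)) * \<kappa> h n (\<lambda>k. Z k \<omega>) m a) *
      (inner (e (Z b \<omega>)) (e (Z c \<omega>)) * \<kappa> h n (\<lambda>k. Z k \<omega>) b c) \<partial>M) = 0"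
proof -
  have [measurable]: "e \<in> borel_measurable S"
    using e unfolding cond_centered_def measurable_cong_sets[OF sets_P refl] by simp
  define F where "F x = (inner (e (x m)) (e (x a)) * \<kappa> h n x m a) * (inner (e (x b)) (e (x c)) * \<kappa> h n x b c)" for x
  have "(\<integral>\<omega>. F (\<lambda>j. Z j \<omega>) \<partial>M) = 0"
  proof (rule integral_eq_0_if_section_integral_eq_0[OF lt(1)])
    show "F \<in> borel_measurable (PiM {..<n} (\<lambda>_. S))"
    proof -
      have x: "(\<lambda>x. x k) \<in> PiM {..<n} (\<lambda>_. S) \<rightarrow>\<^sub>M S" if "k < n" for k using that by simp
      note [measurable] = x[OF lt(1)] x[OF lt(2)] x[OF lt(3)] x[OF lt(4)]
        measurable_\<kappa>[OF lt(1,2)] measurable_\<kappa>[OF lt(3,4)]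
      show ?thesis unfolding F_def by measurable
    qed
    show "F x = F x'" if "\<And>j. j < n \<Longrightarrow> x j = x' j" for x x'
    proof -
      have "\<kappa> h n x m a = \<kappa> h n x' m a" "\<kappa> h n x b c = \<kappa> h n x' b c"
        using that lt by (auto intro!: \<kappa>_cong)
      then show ?thesis using that lt by (simp add: F_def)
    qed
    fix x :: "nat \<Rightarrow> 'z"
    define v where "v = (\<lambda>k. f (w (x k)))"
    define H where "H t = (weight K h n (v(m := f t)) m a * (inner (e (x b)) (e (x c)) * weight K h n (v(m := f t)) b c)) *\<^sub>R e (x a)" for t
    have F_eq: "F (x(m := y)) = inner (e y) (H (w y))" for y
      using ne unfolding F_def \<kappa>_update H_def v_def[symmetric] by (simp add: v_def)
    note [measurable] = measurable_weight_update[OF lt(1,2)] measurable_weight_update[OF lt(3,4)]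
    have H[measurable]: "H \<in> borel_measurable T" unfolding H_def by measurable
    have "integrable P (\<lambda>y. norm (e y) * norm (H (w y)))"
    proof (rule Bochner_Integration.integrable_bound)
      define C where "C = K 0 * (\<bar>inner (e (x b)) (e (x c))\<bar> * K 0) * norm (e (x a))"
      show "integrable P (\<lambda>y. norm (e y) * C)" using e1 by simp
      have "norm (H t) \<le> C" for t
        unfolding H_def C_def norm_scaleR real_norm_def abs_mult
        using weight_nonneg weight_le K0_pos
        by (intro mult_mono) (auto simp: weight_nonneg)
      moreover have "0 \<le> C" using K0_pos by (simp add: C_def)
      ultimately show "AE y in P. norm (norm (e y) * norm (H (w y))) \<le> norm (norm (e y) * C)"
        by (intro AE_I2) (auto simp: abs_mult intro!: mult_left_mono)
    qed measurable
    then show "(\<integral>y. F (x(m := y)) \<partial>P) = 0"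
      unfolding F_eq by (rule cond_centeredD[OF e H])
  qed
  then show ?thesis by (simp add: F_def)
qed

lemma norm_power4_integrable_imp:
  fixes e :: "'z \<Rightarrow> 'a::{real_inner, banach, second_countable_topology}"
  assumes [measurable]: "e \<in> borel_measurable P" and e4: "integrable P (\<lambda>z. norm (e z) ^ 4)"
  shows "integrable P (\<lambda>z. (norm (e z))\<^sup>2)" "integrable P e"
proof -
  interpret P: prob_space P by (rule prob_space_P)
  have le: "x \<le> 1 + x\<^sup>2" for x :: real
  proof -
    have "2 * x \<le> x\<^sup>2 + 1" using weighted_AM_GM[of 1 x 1] by simp
    with zero_le_power2[of x] show ?thesis by linarith
  qed
  have "(norm (e z))\<^sup>2 \<le> 1 + norm (e z) ^ 4" for z
    using le[of "(norm (e z))\<^sup>2"] by (simp add: power_mult[symmetric])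
  then show 2: "integrable P (\<lambda>z. (norm (e z))\<^sup>2)"
    using e4 by - (rule Bochner_Integration.integrable_bound[of P "\<lambda>z. 1 + norm (e z) ^ 4"], auto)
  show "integrable P e"
    using 2 le by - (rule Bochner_Integration.integrable_bound[of P "\<lambda>z. 1 + (norm (e z))\<^sup>2"], auto)
qed

text \<open>The form is twice a sum over unordered pairs. Two different pairs always leave an index
  that occurs in only one of them, so the terms are orthogonal and only their squares remain. In
  each square one factor of the weight is bounded by \<open>K 0\<close> and the other is summed
  along a row, which keeps the factor \<open>h\<close>.\<close>

lemma degenerate_second_moment:
  fixes e :: "'z \<Rightarrow> 'a::{real_inner, banach, second_countable_topology}" and h :: real and n :: nat
  assumes e: "cond_centered P T w e" and e4: "integrable P (\<lambda>z. norm (e z) ^ 4)" and h: "h > 0"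
  defines "W \<equiv> \<lambda>\<omega>. wform n (\<kappa> h n (\<lambda>k. Z k \<omega>)) (\<lambda>i. e (Z i \<omega>)) (\<lambda>i. e (Z i \<omega>))"
  shows "integrable M (\<lambda>\<omega>. (W \<omega>)\<^sup>2)"
    and "(\<integral>\<omega>. (W \<omega>)\<^sup>2 \<partial>M) \<le> 8 * K 0 * (real n * h) * (real n * (\<integral>z. norm (e z) ^ 4 \<partial>P))"
proof -
  have eP: "e \<in> borel_measurable P" using e by (simp add: cond_centered_def)
  then have [measurable]: "e \<in> borel_measurable S"
    unfolding measurable_cong_sets[OF sets_P refl] .
  note e1 = norm_power4_integrable_imp(2)[OF eP e4]
  have e4Z: "integrable M (\<lambda>\<omega>. norm (e (Z i \<omega>)) ^ 4)" for i
    using e4 by (intro integrable_Z[of "\<lambda>z. norm (e z) ^ 4"]) auto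
  define k' where "k' \<omega> = \<kappa> h n (\<lambda>k. Z k \<omega>)" for \<omega>
  have k'[measurable]: "(\<lambda>\<omega>. k' \<omega> i j) \<in> borel_measurable M" if "i < n" "j < n" for i j
    unfolding k'_def using that by (rule measurable_\<kappa>_Z)
  have k'_nn: "0 \<le> k' \<omega> i j" and k'_le: "k' \<omega> i j \<le> K 0" and k'_comm: "k' \<omega> i j = k' \<omega> j i" for \<omega> i j
    unfolding k'_def by (auto simp: weight_nonneg weight_le intro: weight_commute)
  define D where "D i j \<omega> = inner (e (Z i \<omega>)) (e (Z j \<omega>)) * k' \<omega> i j" for i j \<omega>
  have D_comm: "D i j = D j i" for i j
    unfolding D_def by (intro ext) (subst k'_comm, simp add: inner_commute)
  have Dm[measurable]: "D i j \<in> borel_measurable M" if "i < n" "j < n" for i j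
    unfolding D_def using that by measurable
  have D_sq: "(D i j \<omega>)\<^sup>2 \<le> K 0 * ((norm (e (Z i \<omega>)) ^ 4 + norm (e (Z j \<omega>)) ^ 4) * k' \<omega> i j)" for i j \<omega>
  proof -
    let ?a = "norm (e (Z i \<omega>))" and ?b = "norm (e (Z j \<omega>))"
    have "(inner (e (Z i \<omega>)) (e (Z j \<omega>)))\<^sup>2 \<le> (?a * ?b)\<^sup>2"
      using Cauchy_Schwarz_ineq2[of "e (Z i \<omega>)" "e (Z j \<omega>)"] by (simp add: abs_le_square_iff[symmetric])
    also have "\<dots> \<le> ?a ^ 4 + ?b ^ 4"
    proof -
      have "2 * (?a\<^sup>2 * ?b\<^sup>2) \<le> ?a ^ 4 + ?b ^ 4"
        using weighted_AM_GM[of 1 "?a\<^sup>2" "?b\<^sup>2"] by (simp add: power_mult[symmetric])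
      moreover have "0 \<le> ?a\<^sup>2 * ?b\<^sup>2" by simp
      ultimately show ?thesis unfolding power_mult_distrib by linarith
    qed
    finally have "(inner (e (Z i \<omega>)) (e (Z j \<omega>)))\<^sup>2 * (k' \<omega> i j)\<^sup>2 \<le> (?a ^ 4 + ?b ^ 4) * (K 0 * k' \<omega> i j)"
      using k'_nn k'_le by (intro mult_mono) (auto simp: power2_eq_square intro: mult_right_mono)
    then show ?thesis by (simp add: D_def power_mult_distrib algebra_simps)
  qed
  have \<kappa>_int: "integrable M (\<lambda>\<omega>. (norm (e (Z i \<omega>)) ^ 4 + norm (e (Z j \<omega>)) ^ 4) * k' \<omega> i j)"
    if "i < n" "j < n" for i j
  proof (rule Bochner_Integration.integrable_bound)
    show "integrable M (\<lambda>\<omega>. (norm (e (Z i \<omega>)) ^ 4 + norm (e (Z j \<omega>)) ^ 4) * K 0)"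
      using e4Z by auto
    show "AE \<omega> in M. norm ((norm (e (Z i \<omega>)) ^ 4 + norm (e (Z j \<omega>)) ^ 4) * k' \<omega> i j)
        \<le> norm ((norm (e (Z i \<omega>)) ^ 4 + norm (e (Z j \<omega>)) ^ 4) * K 0)"
      using k'_nn k'_le K0_pos by (intro AE_I2) (auto simp: abs_mult intro!: mult_left_mono)
  qed (use that in measurable)
  have D2_int: "integrable M (\<lambda>\<omega>. (D i j \<omega>)\<^sup>2)" if "i < n" "j < n" for i j
  proof (rule Bochner_Integration.integrable_bound)
    show "integrable M (\<lambda>\<omega>. K 0 * ((norm (e (Z i \<omega>)) ^ 4 + norm (e (Z j \<omega>)) ^ 4) * k' \<omega> i j))"
      using \<kappa>_int[OF that] by simp
    show "AE \<omega> in M. norm ((D i j \<omega>)\<^sup>2) \<le> norm (K 0 * ((norm (e (Z i \<omega>)) ^ 4 + norm (e (Z j \<omega>)) ^ 4) * k' \<omega> i j))"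
      using D_sq by (intro AE_I2) (auto intro: order.trans[OF D_sq])
  qed (use that in measurable)
  define A where "A = (SIGMA j:{..<n}. {..<j})"
  define E where "E = (\<lambda>(j, i). D j i)"
  have finA: "finite A" by (simp add: A_def)
  have orth: "(\<integral>\<omega>. E a \<omega> * E b \<omega> \<partial>M) = 0" if "a \<in> A" "b \<in> A" "a \<noteq> b" for a b
  proof -
    obtain j i l k where ab: "a = (j, i)" "b = (l, k)" by (metis surj_pair)
    have lt: "i < j" "j < n" "k < l" "l < n" using that by (auto simp: A_def ab)
    have zero: "(\<integral>\<omega>. D m p \<omega> * D q r \<omega> \<partial>M) = 0" if "m < n" "p < n" "q < n" "r < n" "m \<noteq> p" "m \<noteq> q" "m \<noteq> r" for m p q r
      unfolding D_def k'_def by (rule degenerate_orthogonal[OF e e1 that])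
    \<comment> \<open>The index occurring in one pair only is the larger of the two maxima or, when
      the maxima agree, the minimum of the first pair.\<close>
    consider "j < l" | "l < j" | "j = l" "i \<noteq> k" using \<open>a \<noteq> b\<close> ab by (metis linorder_neqE_nat)
    then have "(\<integral>\<omega>. D j i \<omega> * D l k \<omega> \<partial>M) = 0"
    proof cases
      case 1
      then have "(\<integral>\<omega>. D l k \<omega> * D j i \<omega> \<partial>M) = 0" using lt by (intro zero) auto
      then show ?thesis by (simp add: mult.commute)
    next
      case 2
      then show ?thesis using lt by (intro zero) auto
    next
      case 3
      then have "(\<integral>\<omega>. D i j \<omega> * D l k \<omega> \<partial>M) = 0" using lt by (intro zero) auto
      then show ?thesis by (simp add: D_comm[of i j])
    qed
    then show ?thesis by (simp add: E_def ab)
  qed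
  have Em: "E a \<in> borel_measurable M" and E2: "integrable M (\<lambda>\<omega>. (E a \<omega>)\<^sup>2)" if "a \<in> A" for a
    using that by (auto simp: A_def E_def intro!: Dm D2_int)
  have offdiag: "(\<Sum>i<n. \<Sum>j\<in>{..<n} - {i}. g i j) = (\<Sum>(j, i)\<in>A. g j i + g i j)" for g :: "nat \<Rightarrow> nat \<Rightarrow> real"
  proof -
    have "(\<Sum>i<n. \<Sum>j\<in>{..<n} - {i}. g i j) = (\<Sum>(i, j)\<in>(SIGMA i:{..<n}. {..<n} - {i}). g i j)"
      by (simp add: sum.Sigma)
    also have "(SIGMA i:{..<n}. {..<n} - {i}) = A \<union> prod.swap ` A"
      by (auto simp: A_def image_iff)
    also have "(\<Sum>(i, j)\<in>A \<union> prod.swap ` A. g i j) = (\<Sum>(i, j)\<in>A. g i j) + (\<Sum>(i, j)\<in>prod.swap ` A. g i j)"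
      by (rule sum.union_disjoint) (use finA in \<open>auto simp: A_def\<close>)
    also have "(\<Sum>(i, j)\<in>prod.swap ` A. g i j) = (\<Sum>(i, j)\<in>A. g j i)"
      by (subst sum.reindex) (auto simp: case_prod_beta)
    finally show ?thesis by (simp add: sum.distrib case_prod_beta)
  qed
  have W_eq: "W \<omega> = 2 * (\<Sum>a\<in>A. E a \<omega>)" for \<omega>
  proof -
    have "W \<omega> = (\<Sum>i<n. \<Sum>j\<in>{..<n} - {i}. D i j \<omega>)" by (simp add: W_def wform_def D_def k'_def)
    also have "\<dots> = (\<Sum>(j, i)\<in>A. D j i \<omega> + D i j \<omega>)" by (rule offdiag)
    also have "\<dots> = (\<Sum>a\<in>A. 2 * E a \<omega>)"
      by (intro sum.cong) (auto simp: E_def D_comm)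
    finally show ?thesis by (simp add: sum_distrib_left)
  qed
  note sq = integral_square_sum_orthogonal[OF finA Em E2 orth]
  show "integrable M (\<lambda>\<omega>. (W \<omega>)\<^sup>2)" unfolding W_eq power_mult_distrib using sq(1) by simp
  have "(\<integral>\<omega>. (W \<omega>)\<^sup>2 \<partial>M) = 4 * (\<Sum>a\<in>A. \<integral>\<omega>. (E a \<omega>)\<^sup>2 \<partial>M)"
    unfolding W_eq power_mult_distrib using sq(2) by simp
  also have "(\<Sum>a\<in>A. \<integral>\<omega>. (E a \<omega>)\<^sup>2 \<partial>M) = (\<integral>\<omega>. (\<Sum>a\<in>A. (E a \<omega>)\<^sup>2) \<partial>M)"
    by (rule Bochner_Integration.integral_sum[symmetric]) (rule E2)
  also have "\<dots> \<le> (\<integral>\<omega>. 2 * K 0 * (real n * h) * (\<Sum>i<n. norm (e (Z i \<omega>)) ^ 4) \<partial>M)"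
  proof (rule integral_mono)
    show "integrable M (\<lambda>\<omega>. \<Sum>a\<in>A. (E a \<omega>)\<^sup>2)" using E2 by auto
    show "integrable M (\<lambda>\<omega>. 2 * K 0 * (real n * h) * (\<Sum>i<n. norm (e (Z i \<omega>)) ^ 4))" using e4Z by auto
    fix \<omega>
    let ?q = "\<lambda>i. norm (e (Z i \<omega>)) ^ 4"
    \<comment> \<open>Bounding each square by a sum of two one-sided terms allows the sum over
      \<open>A\<close> to be read again as a full off-diagonal sum, to which the row bound
      applies.\<close>
    have "(\<Sum>a\<in>A. (E a \<omega>)\<^sup>2) \<le> (\<Sum>(j, i)\<in>A. K 0 * (?q j * k' \<omega> j i + ?q i * k' \<omega> i j))"
      using D_sq by (intro sum_mono) (auto simp: E_def k'_comm algebra_simps)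
    also have "\<dots> = K 0 * (\<Sum>i<n. \<Sum>j\<in>{..<n} - {i}. ?q i * k' \<omega> i j)"
      unfolding offdiag by (simp add: sum_distrib_left case_prod_beta)
    also have "\<dots> \<le> K 0 * (\<Sum>i<n. ?q i * (2 * (real n * h)))"
      unfolding sum_distrib_left[symmetric] k'_def using K0_pos
      by (intro mult_left_mono sum_mono sum_weight_le h) auto
    also have "\<dots> = 2 * K 0 * (real n * h) * (\<Sum>i<n. ?q i)"
      by (simp add: sum_distrib_left sum_distrib_right algebra_simps)
    finally show "(\<Sum>a\<in>A. (E a \<omega>)\<^sup>2) \<le> 2 * K 0 * (real n * h) * (\<Sum>i<n. ?q i)" .
  qed
  also have "\<dots> = 2 * K 0 * (real n * h) * (real n * (\<integral>z. norm (e z) ^ 4 \<partial>P))"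
    using e4Z integral_Z[of "\<lambda>z. norm (e z) ^ 4"] by simp
  finally show "(\<integral>\<omega>. (W \<omega>)\<^sup>2 \<partial>M) \<le> 8 * K 0 * (real n * h) * (real n * (\<integral>z. norm (e z) ^ 4 \<partial>P))"
    by simp
qed

end

section \<open>Terms centered in one argument only\<close>

lemma weighted_sum_square_le:
  fixes k b :: "'i \<Rightarrow> real"
  assumes "\<And>j. j \<in> A \<Longrightarrow> 0 \<le> k j"
  shows "(\<Sum>j\<in>A. k j * b j)\<^sup>2 \<le> (\<Sum>j\<in>A. k j) * (\<Sum>j\<in>A. k j * (b j)\<^sup>2)"
proof -
  have "(\<Sum>j\<in>A. k j * b j)\<^sup>2 = (\<Sum>j\<in>A. sqrt (k j) * (sqrt (k j) * b j))\<^sup>2"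
    using assms by (intro arg_cong[where f = "\<lambda>x. x\<^sup>2"] sum.cong) (auto simp: mult.assoc[symmetric])
  also have "\<dots> \<le> (\<Sum>j\<in>A. (sqrt (k j))\<^sup>2) * (\<Sum>j\<in>A. (sqrt (k j) * b j)\<^sup>2)"
    by (rule Cauchy_Schwarz_ineq_sum)
  also have "\<dots> = (\<Sum>j\<in>A. k j) * (\<Sum>j\<in>A. k j * (b j)\<^sup>2)"
    using assms by (intro arg_cong2[where f = "(*)"] sum.cong) (auto simp: power_mult_distrib)
  finally show ?thesis .
qed

context weighted_sample
begin

text \<open>Up to normalization, the leave-one-out kernel regression of \<open>g \<circ> w\<close>
  on the ranks, evaluated at observation \<open>i\<close>. It depends on the sample only through the
  values of \<open>w\<close>.\<close>

definition smooth :: "real \<Rightarrow> nat \<Rightarrow> ('t \<Rightarrow> 'a::real_inner) \<Rightarrow> (nat \<Rightarrow> 'z) \<Rightarrow> nat \<Rightarrow> 'a" where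
  "smooth h n g x i = (\<Sum>j\<in>{..<n} - {i}. \<kappa> h n x i j *\<^sub>R g (w (x j)))"

text \<open>Both smooths depend on observation \<open>i\<close> only through \<open>w\<close>, so
  the argument of \<open>degenerate_orthogonal\<close> applies. The difference is that the smooth at
  \<open>j\<close> contains the value \<open>g (w y)\<close> itself, so that \<open>H\<close> may be
  unbounded. It grows at most linearly in \<open>norm (g t)\<close>, and square integrability of
  \<open>e\<close> and \<open>g \<circ> w\<close> replaces boundedness.\<close>

lemma regression_orthogonal:
  fixes e :: "'z \<Rightarrow> 'a::{real_inner, banach, second_countable_topology}"
  assumes e: "cond_centered P T w e" and e2: "integrable P (\<lambda>z. (norm (e z))\<^sup>2)" and e1: "integrable P e"
    and g[measurable]: "g \<in> borel_measurable T" and g2: "integrable P (\<lambda>z. (norm (g (w z)))\<^sup>2)"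
    and lt: "i < n" "j < n" and ne: "i \<noteq> j"
  shows "(\<integral>\<omega>. inner (e (Z i \<omega>)) (smooth h n g (\<lambda>k. Z k \<omega>) i) *
      inner (e (Z j \<omega>)) (smooth h n g (\<lambda>k. Z k \<omega>) j) \<partial>M) = 0"
proof -
  have [measurable]: "e \<in> borel_measurable S"
    using e unfolding cond_centered_def measurable_cong_sets[OF sets_P refl] by simp
  define F where "F x = inner (e (x i)) (smooth h n g x i) * inner (e (x j)) (smooth h n g x j)" for x
  have "(\<integral>\<omega>. F (\<lambda>j. Z j \<omega>) \<partial>M) = 0"
  proof (rule integral_eq_0_if_section_integral_eq_0[OF lt(1)])
    have smooth: "(\<lambda>x. smooth h n g x m) \<in> borel_measurable (PiM {..<n} (\<lambda>_. S))" if "m < n" for m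
      unfolding smooth_def
    proof (intro borel_measurable_sum borel_measurable_scaleR)
      fix l assume l: "l \<in> {..<n} - {m}"
      then show "(\<lambda>x. \<kappa> h n x m l) \<in> borel_measurable (PiM {..<n} (\<lambda>_. S))"
        using that by (intro measurable_\<kappa>) auto
      have [measurable]: "(\<lambda>x. x l) \<in> PiM {..<n} (\<lambda>_. S) \<rightarrow>\<^sub>M S" using l by simp
      show "(\<lambda>x. g (w (x l))) \<in> borel_measurable (PiM {..<n} (\<lambda>_. S))" by measurable
    qed
    show "F \<in> borel_measurable (PiM {..<n} (\<lambda>_. S))"
    proof -
      have x: "(\<lambda>x. x k) \<in> PiM {..<n} (\<lambda>_. S) \<rightarrow>\<^sub>M S" if "k < n" for k using that by simp
      note [measurable] = x[OF lt(1)] x[OF lt(2)] smooth[OF lt(1)] smooth[OF lt(2)]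
      show ?thesis unfolding F_def by measurable
    qed
    show "F x = F x'" if eq: "\<And>j. j < n \<Longrightarrow> x j = x' j" for x x'
    proof -
      have "smooth h n g x m = smooth h n g x' m" if "m < n" for m
        unfolding smooth_def using that
        by (intro sum.cong refl arg_cong2[where f = scaleR] \<kappa>_cong) (auto simp: eq)
      then show ?thesis using eq lt by (simp add: F_def)
    qed
    fix x :: "nat \<Rightarrow> 'z"
    define v where "v = (\<lambda>k. f (w (x k)))"
    define u where "u = (\<lambda>k. g (w (x k)))"
    define A where "A m t = (\<Sum>l\<in>{..<n} - {m}. weight K h n (v(i := f t)) m l *\<^sub>R (u(i := g t)) l)" for m t
    define H where "H t = inner (e (x j)) (A j t) *\<^sub>R A i t" for t
    have A_eq: "smooth h n g (x(i := y)) m = A m (w y)" for m y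
      unfolding smooth_def A_def \<kappa>_update v_def[symmetric] by (intro sum.cong refl) (auto simp: u_def)
    have F_eq: "F (x(i := y)) = inner (e y) (H (w y))" for y
      using ne unfolding F_def A_eq H_def by simp
    have A_meas: "A m \<in> borel_measurable T" if "m < n" for m
      unfolding A_def
      by (intro borel_measurable_sum borel_measurable_scaleR measurable_weight_update) (use that in \<open>auto simp: fun_upd_def\<close>)
    note [measurable] = A_meas[OF lt(1)] A_meas[OF lt(2)]
    have H[measurable]: "H \<in> borel_measurable T" unfolding H_def by measurable
    define c where "c = (\<Sum>l<n. norm (u l))"
    have c: "0 \<le> c" by (simp add: c_def sum_nonneg)
    have A_le: "norm (A m t) \<le> K 0 * (\<Sum>l\<in>{..<n} - {m}. norm ((u(i := g t)) l))" for m t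
      unfolding A_def sum_distrib_left
      by (intro order.trans[OF norm_sum] sum_mono) (auto intro!: mult_right_mono simp: weight_nonneg weight_le)
    \<comment> \<open>The smooth at \<open>i\<close> leaves out its own observation, hence its bound
      does not involve \<open>g t\<close>; the smooth at \<open>j\<close> includes that
      observation.\<close>
    have Ai: "norm (A i t) \<le> K 0 * c" for t
    proof -
      have "(\<Sum>l\<in>{..<n} - {i}. norm ((u(i := g t)) l)) \<le> c"
        unfolding c_def by (rule order.trans[OF eq_refl sum_mono2[of "{..<n}" "{..<n} - {i}"]]) (auto intro: sum.cong)
      then show ?thesis using A_le[of i t] K0_pos by (meson mult_left_mono less_imp_le order.trans)
    qed
    have Aj: "norm (A j t) \<le> K 0 * (c + norm (g t))" for t
    proof -
      have "(\<Sum>l\<in>{..<n} - {j}. norm ((u(i := g t)) l)) \<le> (\<Sum>l<n. norm ((u(i := g t)) l))"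
        by (rule sum_mono2) auto
      also have "\<dots> \<le> (\<Sum>l<n. norm (u l) + (if l = i then norm (g t) else 0))" by (rule sum_mono) auto
      also have "\<dots> = c + norm (g t)" using lt by (simp add: sum.distrib c_def)
      finally show ?thesis using A_le[of j t] K0_pos by (meson mult_left_mono less_imp_le order.trans)
    qed
    have "integrable P (\<lambda>y. norm (e y) * norm (H (w y)))"
    proof (rule Bochner_Integration.integrable_bound)
      define C where "C = norm (e (x j)) * K 0 * (K 0 * c)"
      have C: "0 \<le> C" using K0_pos c by (simp add: C_def)
      show "integrable P (\<lambda>y. C * (c * norm (e y) + norm (e y) * norm (g (w y))))"
        using e1 e2 g2 by (intro integrable_mult_right Bochner_Integration.integrable_add integrable_mult_of_squares) auto
      have "norm (H t) \<le> C * (c + norm (g t))" for t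
      proof -
        have "norm (H t) \<le> (norm (e (x j)) * norm (A j t)) * norm (A i t)"
          unfolding H_def norm_scaleR by (intro mult_right_mono) (auto simp: Cauchy_Schwarz_ineq2)
        also have "\<dots> \<le> (norm (e (x j)) * (K 0 * (c + norm (g t)))) * (K 0 * c)"
          using Ai Aj K0_pos c by (intro mult_mono mult_left_mono mult_nonneg_nonneg) auto
        also have "\<dots> = C * (c + norm (g t))" by (simp add: C_def)
        finally show ?thesis .
      qed
      then have "norm (e y) * norm (H (w y)) \<le> norm (e y) * (C * (c + norm (g (w y))))" for y
        by (intro mult_left_mono) auto
      moreover have "norm (e y) * (C * (c + norm (g (w y)))) = C * (c * norm (e y) + norm (e y) * norm (g (w y)))" for y
        by (simp add: algebra_simps)
      ultimately show "AE y in P. norm (norm (e y) * norm (H (w y))) \<le> norm (C * (c * norm (e y) + norm (e y) * norm (g (w y))))"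
        using C c by (intro AE_I2) simp
    qed measurable
    then show "(\<integral>y. F (x(i := y)) \<partial>P) = 0"
      unfolding F_eq by (rule cond_centeredD[OF e H])
  qed
  then show ?thesis by (simp add: F_def)
qed

text \<open>The form is a sum of orthogonal terms, the inner products of \<open>e\<close> with the
  smooth at the same observation. Cauchy-Schwarz with the weights as a measure bounds the squared
  smooth by \<open>2 * (n * h)\<close>, the row bound, times a weighted sum of squares. After
  division by \<open>n * (n * h)\<close> the second moment is of order \<open>1 / n\<close>.\<close>

lemma regression_second_moment:
  fixes e :: "'z \<Rightarrow> 'a::{real_inner, banach, second_countable_topology}" and h :: real and n :: nat
  assumes e: "cond_centered P T w e" and e4: "integrable P (\<lambda>z. norm (e z) ^ 4)"
    and g[measurable]: "g \<in> borel_measurable T" and g4: "integrable P (\<lambda>z. norm (g (w z)) ^ 4)" and h: "h > 0"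
  defines "W \<equiv> \<lambda>\<omega>. wform n (\<kappa> h n (\<lambda>k. Z k \<omega>)) (\<lambda>i. e (Z i \<omega>)) (\<lambda>i. g (w (Z i \<omega>)))"
  shows "integrable M (\<lambda>\<omega>. (W \<omega>)\<^sup>2)"
    and "(\<integral>\<omega>. (W \<omega>)\<^sup>2 \<partial>M) \<le> 2 * (real n * h)\<^sup>2 * (real n * ((\<integral>z. norm (e z) ^ 4 \<partial>P) + (\<integral>z. norm (g (w z)) ^ 4 \<partial>P)))"
proof -
  have eP: "e \<in> borel_measurable P" using e by (simp add: cond_centered_def)
  then have [measurable]: "e \<in> borel_measurable S"
    unfolding measurable_cong_sets[OF sets_P refl] .
  have gwP: "(\<lambda>z. g (w z)) \<in> borel_measurable P" by measurable
  note e12 = norm_power4_integrable_imp[OF eP e4]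
  note g12 = norm_power4_integrable_imp[OF gwP g4]
  have e4Z: "integrable M (\<lambda>\<omega>. norm (e (Z i \<omega>)) ^ 4)" for i
    using e4 by (intro integrable_Z[of "\<lambda>z. norm (e z) ^ 4"]) auto
  have g4Z: "integrable M (\<lambda>\<omega>. norm (g (w (Z i \<omega>))) ^ 4)" for i
    using g4 by (intro integrable_Z[of "\<lambda>z. norm (g (w z)) ^ 4"]) auto
  define k' where "k' \<omega> = \<kappa> h n (\<lambda>k. Z k \<omega>)" for \<omega>
  have k'[measurable]: "(\<lambda>\<omega>. k' \<omega> i j) \<in> borel_measurable M" if "i < n" "j < n" for i j
    unfolding k'_def using that by (rule measurable_\<kappa>_Z)
  have k'_nn: "0 \<le> k' \<omega> i j" and k'_le: "k' \<omega> i j \<le> K 0" and k'_comm: "k' \<omega> i j = k' \<omega> j i" for \<omega> i j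
    unfolding k'_def by (auto simp: weight_nonneg weight_le intro: weight_commute)
  define a where "a i \<omega> = norm (e (Z i \<omega>))" for i \<omega>
  define b where "b i \<omega> = norm (g (w (Z i \<omega>)))" for i \<omega>
  define D where "D i \<omega> = inner (e (Z i \<omega>)) (smooth h n g (\<lambda>k. Z k \<omega>) i)" for i \<omega>
  have Dm: "D i \<in> borel_measurable M" if "i < n" for i
    unfolding D_def smooth_def k'_def[symmetric]
    by (intro borel_measurable_inner borel_measurable_sum borel_measurable_scaleR k') (use that in auto)
  define B where "B i \<omega> = real n * h * (\<Sum>j\<in>{..<n} - {i}. (a i \<omega> ^ 4 + b j \<omega> ^ 4) * k' \<omega> i j)" for i \<omega>
  have D_sq: "(D i \<omega>)\<^sup>2 \<le> B i \<omega>" if "i < n" for i \<omega>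
  proof -
    have "\<bar>D i \<omega>\<bar> \<le> a i \<omega> * (\<Sum>j\<in>{..<n} - {i}. k' \<omega> i j * b j \<omega>)"
    proof -
      have "norm (smooth h n g (\<lambda>k. Z k \<omega>) i) \<le> (\<Sum>j\<in>{..<n} - {i}. k' \<omega> i j * b j \<omega>)"
        unfolding smooth_def k'_def b_def
        by (rule order.trans[OF norm_sum]) (auto intro!: sum_mono simp: weight_nonneg)
      then have "a i \<omega> * norm (smooth h n g (\<lambda>k. Z k \<omega>) i) \<le> a i \<omega> * (\<Sum>j\<in>{..<n} - {i}. k' \<omega> i j * b j \<omega>)"
        by (intro mult_left_mono) (auto simp: a_def)
      then show ?thesis
        using Cauchy_Schwarz_ineq2[of "e (Z i \<omega>)" "smooth h n g (\<lambda>k. Z k \<omega>) i"] by (simp add: D_def a_def)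
    qed
    then have "\<bar>D i \<omega>\<bar>\<^sup>2 \<le> (a i \<omega> * (\<Sum>j\<in>{..<n} - {i}. k' \<omega> i j * b j \<omega>))\<^sup>2"
      by (rule power_mono) simp
    then have "(D i \<omega>)\<^sup>2 \<le> (a i \<omega>)\<^sup>2 * (\<Sum>j\<in>{..<n} - {i}. k' \<omega> i j * b j \<omega>)\<^sup>2"
      by (simp add: power_mult_distrib)
    also have "\<dots> \<le> (a i \<omega>)\<^sup>2 * ((\<Sum>j\<in>{..<n} - {i}. k' \<omega> i j) * (\<Sum>j\<in>{..<n} - {i}. k' \<omega> i j * (b j \<omega>)\<^sup>2))"
      by (intro mult_left_mono weighted_sum_square_le) (auto simp: k'_nn)
    also have "\<dots> \<le> (a i \<omega>)\<^sup>2 * ((2 * (real n * h)) * (\<Sum>j\<in>{..<n} - {i}. k' \<omega> i j * (b j \<omega>)\<^sup>2))"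
      unfolding k'_def
      by (intro mult_left_mono mult_right_mono sum_weight_le that h) (auto intro!: sum_nonneg mult_nonneg_nonneg simp: weight_nonneg)
    also have "\<dots> = real n * h * (\<Sum>j\<in>{..<n} - {i}. 2 * ((a i \<omega>)\<^sup>2 * (b j \<omega>)\<^sup>2) * k' \<omega> i j)"
      by (simp add: sum_distrib_left algebra_simps)
    also have "\<dots> \<le> B i \<omega>"
      unfolding B_def
    proof (intro mult_left_mono sum_mono mult_right_mono)
      fix j show "2 * ((a i \<omega>)\<^sup>2 * (b j \<omega>)\<^sup>2) \<le> a i \<omega> ^ 4 + b j \<omega> ^ 4"
        using weighted_AM_GM[of 1 "(a i \<omega>)\<^sup>2" "(b j \<omega>)\<^sup>2"] by (simp add: power_mult[symmetric])
    qed (use h k'_nn in auto)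
    finally show ?thesis .
  qed
  have B_int: "integrable M (B i)" if "i < n" for i
    unfolding B_def
  proof (intro integrable_mult_right Bochner_Integration.integrable_sum)
    fix j assume j: "j \<in> {..<n} - {i}"
    show "integrable M (\<lambda>\<omega>. (a i \<omega> ^ 4 + b j \<omega> ^ 4) * k' \<omega> i j)"
    proof (rule Bochner_Integration.integrable_bound)
      show "integrable M (\<lambda>\<omega>. (a i \<omega> ^ 4 + b j \<omega> ^ 4) * K 0)"
        using e4Z g4Z by (auto simp: a_def b_def)
      show "AE \<omega> in M. norm ((a i \<omega> ^ 4 + b j \<omega> ^ 4) * k' \<omega> i j) \<le> norm ((a i \<omega> ^ 4 + b j \<omega> ^ 4) * K 0)"
        using k'_nn k'_le K0_pos by (intro AE_I2) (auto simp: abs_mult intro!: mult_left_mono)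
      show "(\<lambda>\<omega>. (a i \<omega> ^ 4 + b j \<omega> ^ 4) * k' \<omega> i j) \<in> borel_measurable M"
      proof -
        have [measurable]: "(\<lambda>\<omega>. k' \<omega> i j) \<in> borel_measurable M" using j that by (intro k') auto
        show ?thesis unfolding a_def b_def by measurable
      qed
    qed
  qed
  have D2_int: "integrable M (\<lambda>\<omega>. (D i \<omega>)\<^sup>2)" if "i < n" for i
  proof (rule Bochner_Integration.integrable_bound)
    show "integrable M (B i)" using B_int[OF that] .
    show "AE \<omega> in M. norm ((D i \<omega>)\<^sup>2) \<le> norm (B i \<omega>)"
      using D_sq[OF that] by (intro AE_I2) (auto intro: order.trans[OF D_sq[OF that]])
  qed (use Dm[OF that] in measurable)
  have W_eq: "W \<omega> = (\<Sum>i<n. D i \<omega>)" for \<omega>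
    by (simp add: W_def wform_def D_def smooth_def inner_sum_right mult.commute)
  have orth: "(\<integral>\<omega>. D i \<omega> * D j \<omega> \<partial>M) = 0" if "i \<in> {..<n}" "j \<in> {..<n}" "i \<noteq> j" for i j
    unfolding D_def using that by (intro regression_orthogonal e e12 g g12) auto
  note sq = integral_square_sum_orthogonal[OF finite_lessThan, of n D M, OF _ _ orth]
  show "integrable M (\<lambda>\<omega>. (W \<omega>)\<^sup>2)" unfolding W_eq using Dm D2_int by (intro sq(1)) auto
  have "(\<integral>\<omega>. (W \<omega>)\<^sup>2 \<partial>M) = (\<Sum>i<n. \<integral>\<omega>. (D i \<omega>)\<^sup>2 \<partial>M)"
    unfolding W_eq using Dm D2_int by (intro sq(2)) auto
  also have "\<dots> = (\<integral>\<omega>. (\<Sum>i<n. (D i \<omega>)\<^sup>2) \<partial>M)"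
    by (rule Bochner_Integration.integral_sum[symmetric]) (use D2_int in auto)
  also have "\<dots> \<le> (\<integral>\<omega>. 2 * (real n * h)\<^sup>2 * ((\<Sum>i<n. a i \<omega> ^ 4) + (\<Sum>i<n. b i \<omega> ^ 4)) \<partial>M)"
  proof (rule integral_mono)
    show "integrable M (\<lambda>\<omega>. \<Sum>i<n. (D i \<omega>)\<^sup>2)" using D2_int by auto
    show "integrable M (\<lambda>\<omega>. 2 * (real n * h)\<^sup>2 * ((\<Sum>i<n. a i \<omega> ^ 4) + (\<Sum>i<n. b i \<omega> ^ 4)))"
      using e4Z g4Z by (auto simp: a_def b_def)
    fix \<omega>
    have row: "(\<Sum>i<n. \<Sum>j\<in>{..<n} - {i}. c i * k' \<omega> i j) \<le> 2 * (real n * h) * (\<Sum>i<n. c i)"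
      if "\<And>i. 0 \<le> c i" for c :: "nat \<Rightarrow> real"
    proof -
      have "(\<Sum>i<n. \<Sum>j\<in>{..<n} - {i}. c i * k' \<omega> i j) \<le> (\<Sum>i<n. c i * (2 * (real n * h)))"
        unfolding sum_distrib_left[symmetric] k'_def using that
        by (intro sum_mono mult_left_mono sum_weight_le h) auto
      then show ?thesis by (simp add: sum_distrib_left[symmetric] sum_distrib_right[symmetric] mult.commute)
    qed
    have "(\<Sum>i<n. (D i \<omega>)\<^sup>2) \<le> (\<Sum>i<n. B i \<omega>)" using D_sq by (intro sum_mono) auto
    also have "\<dots> = real n * h * ((\<Sum>i<n. \<Sum>j\<in>{..<n} - {i}. a i \<omega> ^ 4 * k' \<omega> i j) + (\<Sum>i<n. \<Sum>j\<in>{..<n} - {i}. b j \<omega> ^ 4 * k' \<omega> i j))"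
      by (simp add: B_def sum_distrib_left[symmetric] distrib_right sum.distrib)
    also have "(\<Sum>i<n. \<Sum>j\<in>{..<n} - {i}. b j \<omega> ^ 4 * k' \<omega> i j) = (\<Sum>i<n. \<Sum>j\<in>{..<n} - {i}. b i \<omega> ^ 4 * k' \<omega> i j)"
      by (subst sum_offdiag_swap) (simp add: k'_comm)
    also have "real n * h * ((\<Sum>i<n. \<Sum>j\<in>{..<n} - {i}. a i \<omega> ^ 4 * k' \<omega> i j) + (\<Sum>i<n. \<Sum>j\<in>{..<n} - {i}. b i \<omega> ^ 4 * k' \<omega> i j))
      \<le> real n * h * (2 * (real n * h) * (\<Sum>i<n. a i \<omega> ^ 4) + 2 * (real n * h) * (\<Sum>i<n. b i \<omega> ^ 4))"
      using h by (intro mult_left_mono add_mono row) (auto simp: a_def b_def)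
    also have "\<dots> = 2 * (real n * h)\<^sup>2 * ((\<Sum>i<n. a i \<omega> ^ 4) + (\<Sum>i<n. b i \<omega> ^ 4))"
      by (simp add: power2_eq_square algebra_simps)
    finally show "(\<Sum>i<n. (D i \<omega>)\<^sup>2) \<le> 2 * (real n * h)\<^sup>2 * ((\<Sum>i<n. a i \<omega> ^ 4) + (\<Sum>i<n. b i \<omega> ^ 4))" .
  qed
  also have "\<dots> = 2 * (real n * h)\<^sup>2 * (real n * ((\<integral>z. norm (e z) ^ 4 \<partial>P) + (\<integral>z. norm (g (w z)) ^ 4 \<partial>P)))"
    unfolding a_def b_def
    using e4Z g4Z integral_Z[of "\<lambda>z. norm (e z) ^ 4"] integral_Z[of "\<lambda>z. norm (g (w z)) ^ 4"]
    by (simp add: distrib_left)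
  finally show "(\<integral>\<omega>. (W \<omega>)\<^sup>2 \<partial>M) \<le> 2 * (real n * h)\<^sup>2 * (real n * ((\<integral>z. norm (e z) ^ 4 \<partial>P) + (\<integral>z. norm (g (w z)) ^ 4 \<partial>P)))" .
qed

end

section \<open>Approximation by step functions of the projection\<close>

definition sq_integrable :: "'z measure \<Rightarrow> ('z \<Rightarrow> 'a::{real_normed_vector, second_countable_topology}) \<Rightarrow> bool" where
  "sq_integrable P u \<longleftrightarrow> u \<in> borel_measurable P \<and> integrable P (\<lambda>x. (norm (u x))\<^sup>2)"

lemma norm_add_sq_le: "(norm (x + y))\<^sup>2 \<le> 2 * (norm x)\<^sup>2 + 2 * (norm y)\<^sup>2"
proof -
  have "(norm (x + y))\<^sup>2 \<le> (norm x + norm y)\<^sup>2" by (intro power_mono norm_triangle_ineq) simp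
  also have "\<dots> \<le> 2 * (norm x)\<^sup>2 + 2 * (norm y)\<^sup>2"
    using zero_le_power2[of "norm x - norm y"] by (simp add: power2_eq_square algebra_simps)
  finally show ?thesis .
qed

lemma sq_integrable_add:
  assumes "sq_integrable P u" "sq_integrable P v"
  shows "sq_integrable P (\<lambda>x. u x + v x)"
    and "(\<integral>x. (norm (u x + v x))\<^sup>2 \<partial>P) \<le> 2 * (\<integral>x. (norm (u x))\<^sup>2 \<partial>P) + 2 * (\<integral>x. (norm (v x))\<^sup>2 \<partial>P)"
proof -
  have [measurable]: "u \<in> borel_measurable P" "v \<in> borel_measurable P"
    and int: "integrable P (\<lambda>x. (norm (u x))\<^sup>2)" "integrable P (\<lambda>x. (norm (v x))\<^sup>2)"
    using assms by (auto simp: sq_integrable_def)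
  have i: "integrable P (\<lambda>x. (norm (u x + v x))\<^sup>2)"
  proof (rule Bochner_Integration.integrable_bound)
    show "integrable P (\<lambda>x. 2 * (norm (u x))\<^sup>2 + 2 * (norm (v x))\<^sup>2)" using int by simp
  qed (use norm_add_sq_le in auto)
  then show "sq_integrable P (\<lambda>x. u x + v x)" by (simp add: sq_integrable_def)
  have "(\<integral>x. (norm (u x + v x))\<^sup>2 \<partial>P) \<le> (\<integral>x. 2 * (norm (u x))\<^sup>2 + 2 * (norm (v x))\<^sup>2 \<partial>P)"
    using i int by (intro integral_mono norm_add_sq_le) auto
  then show "(\<integral>x. (norm (u x + v x))\<^sup>2 \<partial>P) \<le> 2 * (\<integral>x. (norm (u x))\<^sup>2 \<partial>P) + 2 * (\<integral>x. (norm (v x))\<^sup>2 \<partial>P)"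
    using int by simp
qed

lemma sq_integrable_scaleR: "sq_integrable P u \<Longrightarrow> sq_integrable P (\<lambda>x. c *\<^sub>R u x)"
  by (auto simp: sq_integrable_def power_mult_distrib)

lemma sq_integrable_diff: "sq_integrable P u \<Longrightarrow> sq_integrable P v \<Longrightarrow> sq_integrable P (\<lambda>x. u x - v x)"
  using sq_integrable_add(1)[of P u "\<lambda>x. -1 *\<^sub>R v x"] sq_integrable_scaleR[of P v "-1"] by simp

lemma (in finite_measure) sq_integrable_bounded:
  assumes "u \<in> borel_measurable M" "AE x in M. norm (u x) \<le> C"
  shows "sq_integrable M u"
  unfolding sq_integrable_def
proof
  have "AE x in M. norm ((norm (u x))\<^sup>2) \<le> \<bar>C\<bar>\<^sup>2"
    using assms(2) by eventually_elim (auto intro!: power_mono)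
  then show "integrable M (\<lambda>x. (norm (u x))\<^sup>2)" using assms(1) by (intro integrable_const_bound) auto
qed (use assms in auto)

text \<open>The approximants stay measurable for \<open>F\<close>, which is taken below to be the
  whole space or the sigma-algebra of the projection. Domination comes from
  \<open>norm (s i x) \<le> 2 * norm (u x)\<close>, whence the constant
  \<open>9 = (1 + 2)\<^sup>2\<close>.\<close>

lemma sq_integrable_simple_approx:
  fixes u :: "'z \<Rightarrow> 'a::{banach, second_countable_topology}"
  assumes u: "sq_integrable P u" and uF: "u \<in> borel_measurable F" and F: "subalgebra P F" and eta: "\<eta> > 0"
  obtains s where "simple_function F s" "(\<integral>x. (norm (u x - s x))\<^sup>2 \<partial>P) < \<eta>"
proof -
  have sp: "space F = space P" using F by (simp add: subalgebra_def)
  obtain s where s: "\<And>i. simple_function F (s i)" "\<And>x. x \<in> space P \<Longrightarrow> (\<lambda>i. s i x) \<longlonglongrightarrow> u x"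
      "\<And>i x. x \<in> space P \<Longrightarrow> norm (s i x) \<le> 2 * norm (u x)"
    using borel_measurable_implies_sequence_metric[OF uF, of 0]
    unfolding dist_0_norm dist_norm diff_0_right sp by blast
  have [measurable]: "s i \<in> borel_measurable P" for i
    using measurable_from_subalg[OF F borel_measurable_simple_function[OF s(1)]] .
  have [measurable]: "u \<in> borel_measurable P" using u by (simp add: sq_integrable_def)
  have "(\<lambda>i. \<integral>x. (norm (u x - s i x))\<^sup>2 \<partial>P) \<longlonglongrightarrow> (\<integral>x. 0 \<partial>P)"
  proof (rule integral_dominated_convergence[where w = "\<lambda>x. 9 * (norm (u x))\<^sup>2"])
    show "integrable P (\<lambda>x. 9 * (norm (u x))\<^sup>2)" using u by (simp add: sq_integrable_def)
    show "AE x in P. (\<lambda>i. (norm (u x - s i x))\<^sup>2) \<longlonglongrightarrow> 0"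
    proof (rule AE_I2)
      fix x assume "x \<in> space P"
      then have "(\<lambda>i. (norm (u x - s i x))\<^sup>2) \<longlonglongrightarrow> (norm (u x - u x))\<^sup>2" by (intro tendsto_intros s)
      then show "(\<lambda>i. (norm (u x - s i x))\<^sup>2) \<longlonglongrightarrow> 0" by simp
    qed
    show "AE x in P. norm ((norm (u x - s i x))\<^sup>2) \<le> 9 * (norm (u x))\<^sup>2" for i
    proof (rule AE_I2)
      fix x assume x: "x \<in> space P"
      have "norm (u x - s i x) \<le> 3 * norm (u x)"
        using norm_triangle_ineq4[of "u x" "s i x"] s(3)[OF x, of i] by linarith
      then have "(norm (u x - s i x))\<^sup>2 \<le> (3 * norm (u x))\<^sup>2" by (rule power_mono) simp
      then show "norm ((norm (u x - s i x))\<^sup>2) \<le> 9 * (norm (u x))\<^sup>2" by (simp add: power_mult_distrib)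
    qed
  qed auto
  then have "\<forall>\<^sub>F i in sequentially. (\<integral>x. (norm (u x - s i x))\<^sup>2 \<partial>P) < \<eta>"
    by (rule order_tendstoD(2)) (use eta in simp)
  then obtain i where "(\<integral>x. (norm (u x - s i x))\<^sup>2 \<partial>P) < \<eta>" by (auto simp: eventually_sequentially)
  then show ?thesis using that s(1) by blast
qed

lemma simple_function_sum_indicator:
  fixes s :: "'z \<Rightarrow> 'a::real_vector"
  assumes "simple_function F s" "x \<in> space F"
  shows "s x = (\<Sum>v\<in>s ` space F. indicator (s -` {v} \<inter> space F) x *\<^sub>R v)"
proof -
  have "(\<Sum>v\<in>s ` space F. indicator (s -` {v} \<inter> space F) x *\<^sub>R v) = (\<Sum>v\<in>s ` space F. if v = s x then v else 0)"
    using assms by (intro sum.cong) (auto simp: indicator_def)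
  also have "\<dots> = s x" using assms by (simp add: simple_function_def)
  finally show ?thesis by simp
qed

section \<open>Mean-square closure of the step functions of the projection\<close>

locale prob_space_with_projection = prob_space P for P :: "'z measure" +
  fixes \<pi> :: "'z \<Rightarrow> real"
  assumes measurable_\<pi>[measurable]: "\<pi> \<in> borel_measurable P"
begin

definition step_approx :: "('z \<Rightarrow> 'a::{real_normed_vector, second_countable_topology}) \<Rightarrow> bool" where
  "step_approx u \<longleftrightarrow> sq_integrable P u \<and> (\<forall>\<eta>>0. \<exists>cs. (\<integral>x. (norm (u x - step cs (\<pi> x)))\<^sup>2 \<partial>P) < \<eta>)"

lemma sq_integrable_step: "sq_integrable P (\<lambda>x. step cs (\<pi> x))"
  for cs :: "(real \<times> 'a::{real_normed_vector, second_countable_topology}) list"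
  by (rule sq_integrable_bounded[where C = "step_var cs"]) (auto intro: norm_step_le)

lemma step_approx_step: "step_approx (\<lambda>x. step cs (\<pi> x))"
  unfolding step_approx_def by (auto intro!: sq_integrable_step exI[of _ cs])

text \<open>A closure is closed. The share \<open>\<eta> / 4\<close> of each of the two errors
  compensates the factor 2 in \<open>norm_add_sq_le\<close>.\<close>

lemma step_approx_limit:
  assumes u: "sq_integrable P u" and v: "\<And>\<eta>. \<eta> > 0 \<Longrightarrow> \<exists>v. step_approx v \<and> (\<integral>x. (norm (u x - v x))\<^sup>2 \<partial>P) < \<eta>"
  shows "step_approx u"
  unfolding step_approx_def
proof (intro conjI allI impI u)
  fix \<eta> :: real assume "\<eta> > 0"
  then have e4: "\<eta> / 4 > 0" by simp
  obtain v where v: "step_approx v" "(\<integral>x. (norm (u x - v x))\<^sup>2 \<partial>P) < \<eta> / 4" using v[OF e4] by blast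
  then obtain cs where cs: "(\<integral>x. (norm (v x - step cs (\<pi> x)))\<^sup>2 \<partial>P) < \<eta> / 4"
    using e4 unfolding step_approx_def by blast
  have vi: "sq_integrable P v" using v by (simp add: step_approx_def)
  have "(\<integral>x. (norm (u x - step cs (\<pi> x)))\<^sup>2 \<partial>P) < \<eta>"
    using sq_integrable_add(2)[OF sq_integrable_diff[OF u vi] sq_integrable_diff[OF vi sq_integrable_step[of cs]]] v cs
    by simp
  then show "\<exists>cs. (\<integral>x. (norm (u x - step cs (\<pi> x)))\<^sup>2 \<partial>P) < \<eta>" ..
qed

lemma step_approx_add:
  assumes "step_approx u" "step_approx v"
  shows "step_approx (\<lambda>x. u x + v x)"
  unfolding step_approx_def
proof (intro conjI allI impI)
  have ui: "sq_integrable P u" and vi: "sq_integrable P v" using assms by (auto simp: step_approx_def)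
  show "sq_integrable P (\<lambda>x. u x + v x)" using ui vi by (rule sq_integrable_add)
  fix \<eta> :: real assume "\<eta> > 0"
  then have e4: "\<eta> / 4 > 0" by simp
  obtain cs where cs: "(\<integral>x. (norm (u x - step cs (\<pi> x)))\<^sup>2 \<partial>P) < \<eta> / 4"
    using assms(1) e4 unfolding step_approx_def by blast
  obtain cs' where cs': "(\<integral>x. (norm (v x - step cs' (\<pi> x)))\<^sup>2 \<partial>P) < \<eta> / 4"
    using assms(2) e4 unfolding step_approx_def by blast
  have "(\<integral>x. (norm (u x + v x - step (cs @ cs') (\<pi> x)))\<^sup>2 \<partial>P) < \<eta>"
    using sq_integrable_add(2)[OF sq_integrable_diff[OF ui sq_integrable_step[of cs]] sq_integrable_diff[OF vi sq_integrable_step[of cs']]] cs cs'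
    by (simp add: step_append algebra_simps)
  then show "\<exists>cs. (\<integral>x. (norm (u x + v x - step cs (\<pi> x)))\<^sup>2 \<partial>P) < \<eta>" ..
qed

lemma step_approx_zero: "step_approx (\<lambda>_. 0)"
  using step_approx_step[of "[]"] by (simp add: step_def)

lemma step_approx_sum: "finite I \<Longrightarrow> (\<And>i. i \<in> I \<Longrightarrow> step_approx (u i)) \<Longrightarrow> step_approx (\<lambda>x. \<Sum>i\<in>I. u i x)"
  by (induction I rule: finite_induct) (auto intro: step_approx_zero step_approx_add)

lemma step_approx_scaleR_left:
  fixes q :: "'z \<Rightarrow> real" and c :: "'a::{real_normed_vector, second_countable_topology}"
  assumes "step_approx q"
  shows "step_approx (\<lambda>x. q x *\<^sub>R c)"
  unfolding step_approx_def
proof (intro conjI allI impI)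
  show "sq_integrable P (\<lambda>x. q x *\<^sub>R c)"
    using assms by (auto simp: step_approx_def sq_integrable_def power_mult_distrib)
  fix \<eta> :: real assume "\<eta> > 0"
  \<comment> \<open>Adding 1 covers the case \<open>c = 0\<close>.\<close>
  then have "\<eta> / (1 + (norm c)\<^sup>2) > 0" by (simp add: add_pos_nonneg)
  then obtain cs where cs: "(\<integral>x. (norm (q x - step cs (\<pi> x)))\<^sup>2 \<partial>P) < \<eta> / (1 + (norm c)\<^sup>2)"
    using assms unfolding step_approx_def by blast
  define cs' where "cs' = map (\<lambda>(a, r). (a, r *\<^sub>R c)) cs"
  have step: "step cs' w = step cs w *\<^sub>R c" for w
    unfolding cs'_def by (induction cs) (auto simp: step_def scaleR_left_distrib)
  have "(\<integral>x. (norm (q x *\<^sub>R c - step cs' (\<pi> x)))\<^sup>2 \<partial>P) = (\<integral>x. (norm (q x - step cs (\<pi> x)))\<^sup>2 \<partial>P) * (norm c)\<^sup>2"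
    unfolding step scaleR_left_diff_distrib[symmetric] norm_scaleR power_mult_distrib by simp
  also have "\<dots> \<le> (\<integral>x. (norm (q x - step cs (\<pi> x)))\<^sup>2 \<partial>P) * (1 + (norm c)\<^sup>2)"
    by (intro mult_left_mono integral_nonneg) auto
  also have "\<dots> < \<eta>" using cs by (simp add: pos_less_divide_eq add_pos_nonneg)
  finally show "\<exists>cs. (\<integral>x. (norm (q x *\<^sub>R c - step cs (\<pi> x)))\<^sup>2 \<partial>P) < \<eta>" ..
qed

lemma sq_integrable_indicator:
  assumes "A \<in> sets borel"
  shows "sq_integrable P (\<lambda>x. indicator A (\<pi> x) :: real)"
  using assms by (intro sq_integrable_bounded[where C = 1]) (auto simp: indicator_def)

lemma step_approx_indicator_halfline: "step_approx (\<lambda>x. indicator {..a} (\<pi> x) :: real)"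
proof -
  have "(\<lambda>x. indicator {..a} (\<pi> x) :: real) = (\<lambda>x. step [(a, 1)] (\<pi> x))"
    by (auto simp: step_def indicator_def)
  then show ?thesis by (simp only: step_approx_step)
qed

lemma step_approx_monotone_limit:
  assumes u: "\<And>i. step_approx (\<lambda>x. indicator (A i) (\<pi> x) :: real)"
    and A: "\<And>i. A i \<in> sets borel" "\<And>i. A i \<subseteq> A (Suc i)"
  shows "step_approx (\<lambda>x. indicator (\<Union>i. A i) (\<pi> x) :: real)"
proof (rule step_approx_limit)
  have [measurable]: "(\<Union>i. A i) \<in> sets borel" "A i \<in> sets borel" for i using A by auto
  show "sq_integrable P (\<lambda>x. indicator (\<Union>i. A i) (\<pi> x) :: real)" by (rule sq_integrable_indicator) measurable
  fix \<eta> :: real assume eta: "\<eta> > 0"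
  have "(\<lambda>i. \<integral>x. (norm (indicator (\<Union>i. A i) (\<pi> x) - indicator (A i) (\<pi> x) :: real))\<^sup>2 \<partial>P) \<longlonglongrightarrow> (\<integral>x. 0 \<partial>P)"
  proof (rule integral_dominated_convergence[where w = "\<lambda>x. 1"])
    show "AE x in P. (\<lambda>i. (norm (indicator (\<Union>i. A i) (\<pi> x) - indicator (A i) (\<pi> x) :: real))\<^sup>2) \<longlonglongrightarrow> 0"
    proof (rule AE_I2)
      fix x
      have "(\<lambda>i. indicator (A i) (\<pi> x) :: real) \<longlonglongrightarrow> indicator (\<Union>i. A i) (\<pi> x)"
        by (rule LIMSEQ_indicator_incseq) (use A in \<open>auto intro: incseq_SucI\<close>)
      then have "(\<lambda>i. (norm (indicator (\<Union>i. A i) (\<pi> x) - indicator (A i) (\<pi> x) :: real))\<^sup>2) \<longlonglongrightarrow>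
          (norm (indicator (\<Union>i. A i) (\<pi> x) - indicator (\<Union>i. A i) (\<pi> x) :: real))\<^sup>2"
        by (intro tendsto_intros)
      then show "(\<lambda>i. (norm (indicator (\<Union>i. A i) (\<pi> x) - indicator (A i) (\<pi> x) :: real))\<^sup>2) \<longlonglongrightarrow> 0" by simp
    qed
  qed (auto simp: indicator_def)
  then have "\<forall>\<^sub>F i in sequentially. (\<integral>x. (norm (indicator (\<Union>i. A i) (\<pi> x) - indicator (A i) (\<pi> x) :: real))\<^sup>2 \<partial>P) < \<eta>"
    by (rule order_tendstoD(2)) (use eta in simp)
  then obtain i where "(\<integral>x. (norm (indicator (\<Union>i. A i) (\<pi> x) - indicator (A i) (\<pi> x) :: real))\<^sup>2 \<partial>P) < \<eta>"
    by (auto simp: eventually_sequentially)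
  then show "\<exists>v. step_approx v \<and> (\<integral>x. (norm (indicator (\<Union>i. A i) (\<pi> x) - v x :: real))\<^sup>2 \<partial>P) < \<eta>"
    using u by blast
qed

text \<open>Half-lines are stable under intersection and generate the Borel sets, so closure under
  complements and countable disjoint unions is enough.\<close>

lemma step_approx_indicator:
  assumes "A \<in> sets borel"
  shows "step_approx (\<lambda>x. indicator A (\<pi> x) :: real)"
proof -
  have "Int_stable (range (\<lambda>a::real. {..a}))" "range (\<lambda>a::real. {..a}) \<subseteq> Pow UNIV"
    by (auto simp: Int_stable_def)
  moreover have "A \<in> sigma_sets UNIV (range (\<lambda>a::real. {..a}))"
    using assms by (simp add: borel_eq_atMost)
  ultimately show ?thesis
  proof (induction rule: sigma_sets_induct_disjoint)
    case (basic A)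
    then show ?case using step_approx_indicator_halfline by auto
  next
    case empty
    then show ?case using step_approx_zero by simp
  next
    case (compl A)
    \<comment> \<open>The constant 1 is not a \<open>step\<close>, since every step function
      vanishes beyond its thresholds. It is reached as an increasing limit of half-lines.\<close>
    have "step_approx (\<lambda>x. indicator (\<Union>i::nat. {..real i}) (\<pi> x) :: real)"
      by (rule step_approx_monotone_limit) (auto intro: step_approx_indicator_halfline)
    moreover have "(\<Union>i::nat. {..real i}) = UNIV" using real_arch_simple by auto
    ultimately have "step_approx (\<lambda>x. 1 + indicator A (\<pi> x) *\<^sub>R (-1) :: real)"
      by (intro step_approx_add step_approx_scaleR_left compl(2)) simp
    moreover have "(\<lambda>x. 1 + indicator A (\<pi> x) *\<^sub>R (-1) :: real) = (\<lambda>x. indicator (UNIV - A) (\<pi> x))"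
      by (auto simp: indicator_def)
    ultimately show ?case by simp
  next
    case (union A)
    define C where "C i = (\<Union>j\<le>i. A j)" for i
    have Am: "A i \<in> sets borel" for i using union(2) by (auto simp: borel_eq_atMost)
    have eq: "(\<lambda>x. indicator (C i) (\<pi> x) :: real) = (\<lambda>x. \<Sum>j\<le>i. indicator (A j) (\<pi> x))" for i
      unfolding C_def using union(1)
      by (intro ext indicator_UN_disjoint) (auto simp: disjoint_family_on_def)
    have "step_approx (\<lambda>x. indicator (\<Union>i. C i) (\<pi> x) :: real)"
    proof (rule step_approx_monotone_limit)
      show "step_approx (\<lambda>x. indicator (C i) (\<pi> x) :: real)" for i
        unfolding eq by (rule step_approx_sum) (use union in auto)
      show "C i \<in> sets borel" for i unfolding C_def using Am by auto
      show "C i \<subseteq> C (Suc i)" for i unfolding C_def by fastforce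
    qed
    moreover have "(\<Union>i. C i) = (\<Union>i. A i)" unfolding C_def by auto
    ultimately show ?case by simp
  qed
qed

abbreviation \<F> :: "'z measure" where "\<F> \<equiv> vimage_algebra (space P) \<pi> borel"

lemma subalgebra_\<F>: "subalgebra P \<F>"
  unfolding subalgebra_def by (auto simp: sets_vimage_algebra2)

lemma sets_\<F>E:
  assumes "D \<in> sets \<F>" obtains A where "A \<in> sets borel" "D = \<pi> -` A \<inter> space P"
  using assms by (auto simp: sets_vimage_algebra2)

text \<open>Level sets of a simple function measurable for \<open>\<F>\<close> are preimages of
  Borel sets under \<pi>, which reduces the claim to indicators.\<close>

lemma step_approx_if_measurable_\<F>:
  fixes u :: "'z \<Rightarrow> 'a::{banach, second_countable_topology}"
  assumes u: "sq_integrable P u" and uF: "u \<in> borel_measurable \<F>"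
  shows "step_approx u"
proof (rule step_approx_limit[OF u])
  fix \<eta> :: real assume "\<eta> > 0"
  then obtain s where s: "simple_function \<F> s" "(\<integral>x. (norm (u x - s x))\<^sup>2 \<partial>P) < \<eta>"
    using sq_integrable_simple_approx[OF u uF subalgebra_\<F>] by blast
  let ?V = "s ` space P"
  have "\<exists>A. A \<in> sets borel \<and> s -` {v} \<inter> space P = \<pi> -` A \<inter> space P" for v
    using simple_functionD(2)[OF s(1), of "{v}"] sets_\<F>E by (metis space_vimage_algebra)
  then obtain A where A: "\<And>v. A v \<in> sets borel" "\<And>v. s -` {v} \<inter> space P = \<pi> -` A v \<inter> space P" by metis
  define v where "v x = (\<Sum>c\<in>?V. indicator (A c) (\<pi> x) *\<^sub>R c)" for x
  have "step_approx v"
    unfolding v_def using s(1) A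
    by (intro step_approx_sum step_approx_scaleR_left step_approx_indicator) (auto simp: simple_function_def)
  moreover have "(\<integral>x. (norm (u x - v x))\<^sup>2 \<partial>P) = (\<integral>x. (norm (u x - s x))\<^sup>2 \<partial>P)"
  proof (rule Bochner_Integration.integral_cong[OF refl])
    fix x assume x: "x \<in> space P"
    have "s x = (\<Sum>c\<in>?V. indicator (s -` {c} \<inter> space P) x *\<^sub>R c)"
      using simple_function_sum_indicator[OF s(1)] x unfolding space_vimage_algebra .
    also have "\<dots> = v x" unfolding v_def A(2) using x by (intro sum.cong) (auto simp: indicator_def)
    finally show "(norm (u x - v x))\<^sup>2 = (norm (u x - s x))\<^sup>2" by simp
  qed
  ultimately show "\<exists>v. step_approx v \<and> (\<integral>x. (norm (u x - v x))\<^sup>2 \<partial>P) < \<eta>" using s(2) by auto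
qed

text \<open>Passing to a simple function \<open>s\<close> at the start has two effects. The
  conditional mean \<open>g\<close> of \<open>s\<close> is a finite combination of vectors with
  conditional probabilities as coefficients. Moreover \<open>\<epsilon> = s - g\<close> is bounded
  almost everywhere, so it has the fourth moment that the degenerate terms require, although
  \<open>u\<close> is only square integrable. The remainder is the sum of \<open>u - s\<close> and
  the step approximation error of \<open>g\<close>.\<close>

lemma cond_exp_decomposition:
  fixes u :: "'z \<Rightarrow> 'a::{real_inner, banach, second_countable_topology}"
  assumes u: "sq_integrable P u" and eta: "\<eta> > 0"
  obtains cs \<epsilon> where "cond_centered P borel \<pi> \<epsilon>" "integrable P (\<lambda>x. norm (\<epsilon> x) ^ 4)"
    "(\<integral>x. (norm (u x - step cs (\<pi> x) - \<epsilon> x))\<^sup>2 \<partial>P) < \<eta>"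
proof -
  interpret finite_measure_subalgebra P \<F> by standard (rule subalgebra_\<F>)
  have e4: "\<eta> / 4 > 0" using eta by simp
  have um: "u \<in> borel_measurable P" using u by (simp add: sq_integrable_def)
  obtain s where s: "simple_function P s" "(\<integral>x. (norm (u x - s x))\<^sup>2 \<partial>P) < \<eta> / 4"
    using sq_integrable_simple_approx[OF u um _ e4] by (auto simp: subalgebra_def)
  let ?V = "s ` space P" and ?A = "\<lambda>c. s -` {c} \<inter> space P"
  have fin: "finite ?V" using s(1) by (simp add: simple_function_def)
  have A[measurable]: "?A c \<in> sets P" for c using s(1) by (rule simple_functionD)
  have [measurable]: "s \<in> borel_measurable P" using s(1) by (rule borel_measurable_simple_function)
  \<comment> \<open>The conditional probability, given \<pi>, that \<open>s\<close> takes the value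
    \<open>c\<close>.\<close>
  define q where "q c = real_cond_exp P \<F> (indicator (?A c))" for c
  have iA: "integrable P (indicator (?A c) :: _ \<Rightarrow> real)" for c by (intro integrable_real_indicator) (auto simp: emeasure_eq_measure)
  have qF: "q c \<in> borel_measurable \<F>" for c unfolding q_def by simp
  have q[measurable]: "q c \<in> borel_measurable P" for c
    using measurable_from_subalg[OF subalgebra_\<F> qF] .
  have qi: "integrable P (q c)" for c unfolding q_def by (rule real_cond_exp_int(1)[OF iA])
  have q0: "AE x in P. q c x \<ge> 0" for c unfolding q_def by (rule real_cond_exp_ge_c[OF iA]) simp
  have q_le: "AE x in P. q c x \<le> 1" for c unfolding q_def by (rule real_cond_exp_le_c[OF iA]) (simp add: indicator_def)
  have q1: "AE x in P. norm (q c x) \<le> 1" for c using q0[of c] q_le[of c] by eventually_elim simp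
  have q_sq: "sq_integrable P (q c)" for c using q q1 by (rule sq_integrable_bounded)
  define g where "g x = (\<Sum>c\<in>?V. q c x *\<^sub>R c)" for x
  have g_approx: "step_approx g"
    unfolding g_def by (intro step_approx_sum step_approx_scaleR_left step_approx_if_measurable_\<F> q_sq qF fin)
  then obtain cs where cs: "(\<integral>x. (norm (g x - step cs (\<pi> x)))\<^sup>2 \<partial>P) < \<eta> / 4"
    using e4 unfolding step_approx_def by blast
  have g_sq: "sq_integrable P g" using g_approx by (simp add: step_approx_def)
  have [measurable]: "g \<in> borel_measurable P" using g_sq by (simp add: sq_integrable_def)
  define \<epsilon> where "\<epsilon> x = s x - g x" for x
  have \<epsilon>[measurable]: "\<epsilon> \<in> borel_measurable P" unfolding \<epsilon>_def by measurable
  define C where "C = 2 * (\<Sum>c\<in>?V. norm c)"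
  have s_eq: "s x = (\<Sum>c\<in>?V. indicator (?A c) x *\<^sub>R c)" if "x \<in> space P" for x
    using simple_function_sum_indicator[OF s(1) that] .
  have bound: "AE x in P. norm (\<epsilon> x) \<le> C"
  proof -
    have "AE x in P. \<forall>c\<in>?V. norm (q c x) \<le> 1" using fin q1 by (intro AE_finite_allI) auto
    then show ?thesis
    proof (rule AE_mp, intro AE_I2 impI)
      fix x assume x: "x \<in> space P" and "\<forall>c\<in>?V. norm (q c x) \<le> 1"
      then have "norm (g x) \<le> (\<Sum>c\<in>?V. norm c)"
        unfolding g_def by (intro order.trans[OF norm_sum] sum_mono) (auto intro: mult_left_le_one_le)
      moreover have "norm (s x) \<le> (\<Sum>c\<in>?V. norm c)"
        unfolding s_eq[OF x] by (intro order.trans[OF norm_sum] sum_mono) (auto simp: indicator_def)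
      ultimately show "norm (\<epsilon> x) \<le> C"
        using norm_triangle_ineq4[of "s x" "g x"] by (simp add: \<epsilon>_def C_def)
    qed
  qed
  have s_sq: "sq_integrable P s"
  proof (rule sq_integrable_bounded[where C = C])
    show "AE x in P. norm (s x) \<le> C"
    proof (rule AE_I2)
      fix x assume x: "x \<in> space P"
      have "norm (s x) \<le> (\<Sum>c\<in>?V. norm c)"
        unfolding s_eq[OF x] by (intro order.trans[OF norm_sum] sum_mono) (auto simp: indicator_def)
      also have "\<dots> \<le> C" by (simp add: C_def sum_nonneg)
      finally show "norm (s x) \<le> C" .
    qed
  qed simp
  have \<epsilon>_int: "integrable P \<epsilon>" using bound by (rule integrable_const_bound) simp
  show ?thesis
  proof (rule that)
    show "integrable P (\<lambda>x. norm (\<epsilon> x) ^ 4)"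
    proof (rule integrable_const_bound[where B = "C ^ 4"])
      show "AE x in P. norm (norm (\<epsilon> x) ^ 4) \<le> C ^ 4" using bound by eventually_elim (auto intro: power_mono)
    qed measurable
    show "cond_centered P borel \<pi> \<epsilon>"
    proof (rule cond_centeredI[OF \<epsilon>_int measurable_\<pi>])
      fix D :: "real set" assume D: "D \<in> sets borel"
      define E where "E = \<pi> -` D \<inter> space P"
      have EF: "E \<in> sets \<F>" using D unfolding E_def by (auto simp: sets_vimage_algebra2)
      have E[measurable]: "E \<in> sets P" using EF subalgebra_\<F> by (auto simp: subalgebra_def)
      have int1: "integrable P (\<lambda>x. indicator E x * indicator (?A c) x :: real)" for c
        using integrable_mult_indicator[OF E iA[of c]] by simp
      have int2: "integrable P (\<lambda>x. indicator E x * q c x)" for c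
        using integrable_mult_indicator[OF E qi[of c]] by simp
      have eq: "(\<integral>x. indicator E x * indicator (?A c) x \<partial>P) = (\<integral>x. indicator E x * q c x \<partial>P)" for c
        using real_cond_exp_intA[OF iA EF, of c] by (simp add: q_def set_lebesgue_integral_def)
      have "(\<integral>x. indicator D (\<pi> x) *\<^sub>R \<epsilon> x \<partial>P) =
          (\<integral>x. (\<Sum>c\<in>?V. (indicator E x * indicator (?A c) x - indicator E x * q c x) *\<^sub>R c) \<partial>P)"
      proof (rule Bochner_Integration.integral_cong[OF refl])
        fix x assume x: "x \<in> space P"
        have "indicator D (\<pi> x) = (indicator E x :: real)" using x by (auto simp: E_def indicator_def)
        then show "indicator D (\<pi> x) *\<^sub>R \<epsilon> x = (\<Sum>c\<in>?V. (indicator E x * indicator (?A c) x - indicator E x * q c x) *\<^sub>R c)"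
          unfolding \<epsilon>_def s_eq[OF x] g_def
          by (simp add: scaleR_right_diff_distrib scaleR_left_diff_distrib scaleR_sum_right sum_subtractf)
      qed
      also have "\<dots> = (\<Sum>c\<in>?V. (\<integral>x. indicator E x * indicator (?A c) x - indicator E x * q c x \<partial>P) *\<^sub>R c)"
        using int1 int2 by (subst Bochner_Integration.integral_sum) auto
      also have "\<dots> = 0" using int1 int2 eq by simp
      finally show "(\<integral>x. indicator D (\<pi> x) *\<^sub>R \<epsilon> x \<partial>P) = 0" .
    qed
    have "(\<integral>x. (norm ((u x - s x) + (g x - step cs (\<pi> x))))\<^sup>2 \<partial>P) < \<eta>"
      using sq_integrable_add(2)[OF sq_integrable_diff[OF u s_sq] sq_integrable_diff[OF g_sq sq_integrable_step[of cs]]] s(2) cs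
      by simp
    moreover have "(u x - s x) + (g x - step cs (\<pi> x)) = u x - step cs (\<pi> x) - \<epsilon> x" for x
      by (simp add: \<epsilon>_def)
    ultimately show "(\<integral>x. (norm (u x - step cs (\<pi> x) - \<epsilon> x))\<^sup>2 \<partial>P) < \<eta>" by simp
  qed
qed

end

section \<open>The signal term\<close>

text \<open>Nonnegativity of the variance of the absolute value.\<close>

lemma (in prob_space) expectation_abs_le_sqrt:
  fixes Y :: "'a \<Rightarrow> real"
  assumes [measurable]: "Y \<in> borel_measurable M" and int: "integrable M (\<lambda>\<omega>. (Y \<omega>)\<^sup>2)"
    and le: "expectation (\<lambda>\<omega>. (Y \<omega>)\<^sup>2) \<le> c"
  shows "integrable M (\<lambda>\<omega>. \<bar>Y \<omega>\<bar>)" and "expectation (\<lambda>\<omega>. \<bar>Y \<omega>\<bar>) \<le> sqrt c"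
proof -
  have "integrable M (\<lambda>\<omega>. 1 * Y \<omega>)" by (rule integrable_mult_of_squares) (use int in auto)
  then show i: "integrable M (\<lambda>\<omega>. \<bar>Y \<omega>\<bar>)" by simp
  have "0 \<le> variance (\<lambda>\<omega>. \<bar>Y \<omega>\<bar>)" by (rule variance_positive)
  also have "\<dots> = expectation (\<lambda>\<omega>. (Y \<omega>)\<^sup>2) - (expectation (\<lambda>\<omega>. \<bar>Y \<omega>\<bar>))\<^sup>2"
    using variance_eq[OF i] int by simp
  finally have "(expectation (\<lambda>\<omega>. \<bar>Y \<omega>\<bar>))\<^sup>2 \<le> c" using le by simp
  then show "expectation (\<lambda>\<omega>. \<bar>Y \<omega>\<bar>) \<le> sqrt c" by (rule real_le_rsqrt)
qed

text \<open>A weak law in mean: the centered summands are orthogonal by independence, and each is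
  bounded by \<open>2 * C\<close>, because the mean itself is at most \<open>C\<close> in absolute
  value.\<close>

lemma (in iid_sample) mean_deviation_le:
  fixes \<phi> :: "'z \<Rightarrow> real"
  assumes \<phi>[measurable]: "\<phi> \<in> borel_measurable S" and bound: "\<And>z. \<bar>\<phi> z\<bar> \<le> C" and n: "n > 0"
  defines "Y \<equiv> \<lambda>\<omega>. (\<Sum>i<n. \<phi> (Z i \<omega>)) / real n - integral\<^sup>L P \<phi>"
  shows "integrable M (\<lambda>\<omega>. \<bar>Y \<omega>\<bar>)" and "expectation (\<lambda>\<omega>. \<bar>Y \<omega>\<bar>) \<le> sqrt ((2 * C)\<^sup>2 / real n)"
proof -
  interpret P: prob_space P by (rule prob_space_P)
  define m where "m = integral\<^sup>L P \<phi>"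
  have \<phi>_int: "integrable P \<phi>" by (rule P.integrable_const_bound[of _ C]) (auto simp: bound)
  have "\<phi> z \<le> C" "- C \<le> \<phi> z" for z using bound[of z] by linarith+
  then have m: "\<bar>m\<bar> \<le> C"
    unfolding m_def abs_le_iff
    using P.integral_ge_const[OF \<phi>_int, of "- C"] P.integral_le_const[OF \<phi>_int, of C] by auto
  define D where "D i \<omega> = \<phi> (Z i \<omega>) - m" for i \<omega>
  have Dm[measurable]: "D i \<in> borel_measurable M" for i unfolding D_def by measurable
  have D_le: "(D i \<omega>)\<^sup>2 \<le> (2 * C)\<^sup>2" for i \<omega>
  proof -
    have "\<bar>D i \<omega>\<bar> \<le> \<bar>2 * C\<bar>" using bound[of "Z i \<omega>"] m by (simp add: D_def)
    then show ?thesis by (simp only: abs_le_square_iff)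
  qed
  have D2: "integrable M (\<lambda>\<omega>. (D i \<omega>)\<^sup>2)" for i
    by (rule integrable_const_bound[of _ "(2 * C)\<^sup>2"]) (use D_le in auto)
  have orth: "(\<integral>\<omega>. D i \<omega> * D j \<omega> \<partial>M) = 0" if "i \<in> {..<n}" "j \<in> {..<n}" "i \<noteq> j" for i j
    unfolding D_def
  proof (rule integral_eq_0_if_section_integral_eq_0[where F = "\<lambda>x. (\<phi> (x i) - m) * (\<phi> (x j) - m)" and n = n and i = i])
    have [measurable]: "(\<lambda>x. x i) \<in> PiM {..<n} (\<lambda>_. S) \<rightarrow>\<^sub>M S" "(\<lambda>x. x j) \<in> PiM {..<n} (\<lambda>_. S) \<rightarrow>\<^sub>M S"
      using that by auto
    show "(\<lambda>x. (\<phi> (x i) - m) * (\<phi> (x j) - m)) \<in> borel_measurable (PiM {..<n} (\<lambda>_. S))" by measurable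
    show "(\<integral>y. (\<phi> ((x(i := y)) i) - m) * (\<phi> ((x(i := y)) j) - m) \<partial>P) = 0" for x
      using that \<phi>_int by (simp add: m_def P.prob_space[unfolded space_P])
  qed (use that in auto)
  have Y: "Y = (\<lambda>\<omega>. (\<Sum>i<n. D i \<omega>) / real n)"
    using n by (auto simp: Y_def D_def m_def sum_subtractf field_simps)
  note sq = integral_square_sum_orthogonal[OF finite_lessThan, of n D M, OF Dm D2 orth]
  have i: "integrable M (\<lambda>\<omega>. (Y \<omega>)\<^sup>2)" unfolding Y power_divide using sq(1) by simp
  have "expectation (\<lambda>\<omega>. (Y \<omega>)\<^sup>2) = (\<Sum>i<n. expectation (\<lambda>\<omega>. (D i \<omega>)\<^sup>2)) / (real n)\<^sup>2"
    unfolding Y power_divide using sq(2) by simp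
  also have "\<dots> \<le> (\<Sum>i<n. (2 * C)\<^sup>2) / (real n)\<^sup>2"
  proof (intro divide_right_mono sum_mono)
    fix i show "expectation (\<lambda>\<omega>. (D i \<omega>)\<^sup>2) \<le> (2 * C)\<^sup>2"
      by (rule integral_le_const[OF D2]) (use D_le in simp)
  qed simp
  also have "\<dots> = (2 * C)\<^sup>2 / real n" using n by (simp add: power2_eq_square)
  finally have le: "expectation (\<lambda>\<omega>. (Y \<omega>)\<^sup>2) \<le> (2 * C)\<^sup>2 / real n" .
  have Ym: "Y \<in> borel_measurable M" unfolding Y by measurable
  show "integrable M (\<lambda>\<omega>. \<bar>Y \<omega>\<bar>)" "expectation (\<lambda>\<omega>. \<bar>Y \<omega>\<bar>) \<le> sqrt ((2 * C)\<^sup>2 / real n)"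
    by (rule expectation_abs_le_sqrt[OF Ym i le])+
qed

context weighted_sample
begin

lemma measurable_wform:
  fixes u v :: "'z \<Rightarrow> 'a::{real_inner, second_countable_topology}"
  assumes [measurable]: "u \<in> borel_measurable S" "v \<in> borel_measurable S"
  shows "(\<lambda>\<omega>. wform n (\<kappa> h n (\<lambda>k. Z k \<omega>)) (\<lambda>i. u (Z i \<omega>)) (\<lambda>i. v (Z i \<omega>))) \<in> borel_measurable M"
  unfolding wform_def
  by (intro borel_measurable_sum borel_measurable_times borel_measurable_inner measurable_\<kappa>_Z) auto

text \<open>The divisor \<open>n * (n * h)\<close> is the order of the sum of all weights; it turns
  the second moment of the form into one of order \<open>1 / (n * (n * h))\<close>.\<close>

lemma degenerate_expectation_abs_le:
  fixes e :: "'z \<Rightarrow> 'a::{real_inner, banach, second_countable_topology}" and h :: real and n :: nat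
  assumes e: "cond_centered P T w e" and e4: "integrable P (\<lambda>z. norm (e z) ^ 4)" and h: "h > 0" and n: "n > 0"
  defines "W \<equiv> \<lambda>\<omega>. wform n (\<kappa> h n (\<lambda>k. Z k \<omega>)) (\<lambda>i. e (Z i \<omega>)) (\<lambda>i. e (Z i \<omega>)) / (real n * (real n * h))"
  shows "integrable M (\<lambda>\<omega>. \<bar>W \<omega>\<bar>)"
    and "expectation (\<lambda>\<omega>. \<bar>W \<omega>\<bar>) \<le> sqrt (8 * K 0 * (\<integral>z. norm (e z) ^ 4 \<partial>P) / (real n * (real n * h)))"
proof -
  have [measurable]: "e \<in> borel_measurable S"
    using e unfolding cond_centered_def measurable_cong_sets[OF sets_P refl] by simp
  have b: "real n * (real n * h) > 0" using n h by simp
  have Wm: "W \<in> borel_measurable M" unfolding W_def by (intro borel_measurable_divide measurable_wform) auto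
  have i: "integrable M (\<lambda>\<omega>. (W \<omega>)\<^sup>2)" unfolding W_def power_divide
    using degenerate_second_moment(1)[OF e e4 h, of n] by simp
  have "expectation (\<lambda>\<omega>. (W \<omega>)\<^sup>2) \<le> 8 * K 0 * (real n * h) * (real n * (\<integral>z. norm (e z) ^ 4 \<partial>P)) / (real n * (real n * h))\<^sup>2"
    unfolding W_def power_divide using degenerate_second_moment(2)[OF e e4 h, of n]
    by (simp add: divide_right_mono)
  also have "\<dots> = 8 * K 0 * (\<integral>z. norm (e z) ^ 4 \<partial>P) / (real n * (real n * h))"
    using b by (simp add: power2_eq_square field_simps)
  finally have le: "expectation (\<lambda>\<omega>. (W \<omega>)\<^sup>2) \<le> \<dots>" .
  show "integrable M (\<lambda>\<omega>. \<bar>W \<omega>\<bar>)"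
    "expectation (\<lambda>\<omega>. \<bar>W \<omega>\<bar>) \<le> sqrt (8 * K 0 * (\<integral>z. norm (e z) ^ 4 \<partial>P) / (real n * (real n * h)))"
    by (rule expectation_abs_le_sqrt[OF Wm i le])+
qed

lemma regression_expectation_abs_le:
  fixes e :: "'z \<Rightarrow> 'a::{real_inner, banach, second_countable_topology}" and h :: real and n :: nat
  assumes e: "cond_centered P T w e" and e4: "integrable P (\<lambda>z. norm (e z) ^ 4)"
    and g[measurable]: "g \<in> borel_measurable T" and g4: "integrable P (\<lambda>z. norm (g (w z)) ^ 4)"
    and h: "h > 0" and n: "n > 0"
  defines "W \<equiv> \<lambda>\<omega>. wform n (\<kappa> h n (\<lambda>k. Z k \<omega>)) (\<lambda>i. e (Z i \<omega>)) (\<lambda>i. g (w (Z i \<omega>))) / (real n * (real n * h))"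
  shows "integrable M (\<lambda>\<omega>. \<bar>W \<omega>\<bar>)"
    and "expectation (\<lambda>\<omega>. \<bar>W \<omega>\<bar>) \<le> sqrt (2 * ((\<integral>z. norm (e z) ^ 4 \<partial>P) + (\<integral>z. norm (g (w z)) ^ 4 \<partial>P)) / real n)"
proof -
  have [measurable]: "e \<in> borel_measurable S"
    using e unfolding cond_centered_def measurable_cong_sets[OF sets_P refl] by simp
  have b: "real n * (real n * h) > 0" using n h by simp
  have gw: "(\<lambda>z. g (w z)) \<in> borel_measurable S" by measurable
  have Wm: "W \<in> borel_measurable M" unfolding W_def
    using measurable_wform[OF _ gw] by (intro borel_measurable_divide) auto
  have i: "integrable M (\<lambda>\<omega>. (W \<omega>)\<^sup>2)" unfolding W_def power_divide
    using regression_second_moment(1)[OF e e4 g g4 h, of n] by simp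
  let ?m = "(\<integral>z. norm (e z) ^ 4 \<partial>P) + (\<integral>z. norm (g (w z)) ^ 4 \<partial>P)"
  have "expectation (\<lambda>\<omega>. (W \<omega>)\<^sup>2) \<le> 2 * (real n * h)\<^sup>2 * (real n * ?m) / (real n * (real n * h))\<^sup>2"
    unfolding W_def power_divide using regression_second_moment(2)[OF e e4 g g4 h, of n]
    by (simp add: divide_right_mono)
  also have "\<dots> = 2 * ?m / real n"
    using b n h by (simp add: power2_eq_square divide_simps)
  finally have le: "expectation (\<lambda>\<omega>. (W \<omega>)\<^sup>2) \<le> 2 * ?m / real n" .
  show "integrable M (\<lambda>\<omega>. \<bar>W \<omega>\<bar>)" "expectation (\<lambda>\<omega>. \<bar>W \<omega>\<bar>) \<le> sqrt (2 * ?m / real n)"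
    by (rule expectation_abs_le_sqrt[OF Wm i le])+
qed

end

text \<open>Row sums are governed by ranks alone, so one constant \<open>c\<close> serves every
  realization \<open>y\<close> and every row \<open>i\<close>.\<close>

lemma (in kernel) eventually_weight_sum_ge:
  assumes h0: "\<forall>\<^sub>F n in sequentially. h n > 0" and h: "h \<longlonglongrightarrow> 0"
    and nh: "filterlim (\<lambda>n. real n * h n) at_top sequentially"
  obtains c where "c > 0" "\<forall>\<^sub>F n in sequentially. \<forall>y i. i < n \<longrightarrow>
    c * (real n * h n) \<le> (\<Sum>j\<in>{..<n} - {i}. weight K (h n) n y i j)"
proof -
  obtain c x0 where c: "c > 0" and x0: "x0 > 0"
    and R: "\<And>b m. b * x0 \<ge> 2 \<Longrightarrow> real m \<ge> b * x0 \<Longrightarrow> c * b \<le> (\<Sum>d=1..m. K (real d / b))"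
    using Riemann_sum_ge by blast
  have 1: "\<forall>\<^sub>F n in sequentially. real n * h n \<ge> 2 / x0" using nh by (simp add: filterlim_at_top)
  have 2: "\<forall>\<^sub>F n in sequentially. h n < 1 / (4 * x0)"
    by (rule order_tendstoD(2)[OF h]) (use x0 in simp)
  have "\<forall>\<^sub>F n in sequentially. \<forall>y i. i < n \<longrightarrow>
    c * (real n * h n) \<le> (\<Sum>j\<in>{..<n} - {i}. weight K (h n) n y i j)"
    using 1 2 h0 eventually_ge_at_top[of 4]
  proof eventually_elim
    case (elim n)
    \<comment> \<open>About half the sample, so that every rank has \<open>m\<close> ranks on some
      side. For \<open>n \<ge> 4\<close> one has \<open>n \<le> 4 * m\<close>, and with
      \<open>h n * x0 \<le> 1 / 4\<close> the points counted in \<open>Riemann_sum_ge\<close> fit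
      into that side.\<close>
    define m where "m = (n - 1) div 2"
    have m: "2 * m < n" "real n \<le> 4 * real m" using elim by (auto simp: m_def)
    have "h n * x0 \<le> 1 / 4" using elim x0 by (simp add: field_simps)
    then have "real n * (h n * x0) \<le> real n * (1 / 4)" by (rule mult_left_mono) simp
    moreover have "real n * (h n * x0) = real n * h n * x0" by simp
    ultimately have mx: "real n * h n * x0 \<le> real m" using m by linarith
    have "2 \<le> real n * h n * x0" using elim x0 by (simp add: field_simps)
    then have "c * (real n * h n) \<le> (\<Sum>d=1..m. K (real d / (real n * h n)))" using mx by (intro R) auto
    then show ?case using sum_weight_ge[OF _ m(1)] order.trans by blast
  qed
  with c that show ?thesis by blast
qed

text \<open>A deterministic inequality for each sample, whose subtracted terms will be small in
  mean. The parts involving \<rho> are bounded by \<open>abs_wform_le\<close> rather than by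
  orthogonality, since nothing is known about \<rho> but its size. As
  \<open>\<epsilon> + G = u - \<rho>\<close>, the sum of squares of \<open>\<epsilon> + G\<close> is
  at most twice that of \<open>u\<close> plus twice that of \<rho>; this produces the coefficients
  \<open>4 * t\<close> and \<open>4 * t + 2 / t + 2\<close>.\<close>

lemma (in kernel) wform_decomposition_ge:
  fixes u \<epsilon> :: "nat \<Rightarrow> 'a::real_inner" and n :: nat and h :: real and y :: "nat \<Rightarrow> real"
    and cs :: "(real \<times> 'a) list"
  assumes h: "h > 0" and n: "n > 0" and t: "t > 0"
    and low: "\<And>i. i < n \<Longrightarrow> c * (real n * h) \<le> (\<Sum>j\<in>{..<n} - {i}. weight K h n y i j)"
  defines "W \<equiv> wform n (weight K h n y)" and "G \<equiv> \<lambda>i. step cs (y i)" and "N \<equiv> real n * (real n * h)"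
  defines "\<rho> \<equiv> \<lambda>i. u i - G i - \<epsilon> i"
  shows "c * ((\<Sum>i<n. (norm (G i))\<^sup>2) / real n)
    - (step_var cs)\<^sup>2 * (2 * ((\<Sum>d=1..n. real d * K (real d / (real n * h))) / N))
    - \<bar>W \<epsilon> \<epsilon> / N\<bar> - 2 * \<bar>W \<epsilon> G / N\<bar>
    - (4 * t * ((\<Sum>i<n. (norm (u i))\<^sup>2) / real n) + (4 * t + 2 / t + 2) * ((\<Sum>i<n. (norm (\<rho> i))\<^sup>2) / real n))
    \<le> W u u / N"
proof -
  have N: "N > 0" using n h by (simp add: N_def)
  define D where "D = (\<Sum>d=1..n. real d * K (real d / (real n * h)))"
  define f where "f i = \<epsilon> i + 1 *\<^sub>R G i" for i
  define su where "su = (\<Sum>i<n. (norm (u i))\<^sup>2)"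
  define sr where "sr = (\<Sum>i<n. (norm (\<rho> i))\<^sup>2)"
  define sf where "sf = (\<Sum>i<n. (norm (f i))\<^sup>2)"
  note sym = weight_commute[of h n y]
  note bnd = abs_wform_le[where k = "weight K h n y" and n = n, OF sym weight_nonneg sum_weight_le[OF _ h]]
  have u: "u = (\<lambda>i. f i + 1 *\<^sub>R \<rho> i)" by (simp add: f_def \<rho>_def)
  have "W u u = W f f + 2 * 1 * W f \<rho> + 1\<^sup>2 * W \<rho> \<rho>"
    unfolding W_def u by (rule wform_add_scale) (rule sym)
  moreover have "W f f = W \<epsilon> \<epsilon> + 2 * 1 * W \<epsilon> G + 1\<^sup>2 * W G G"
    unfolding W_def f_def by (rule wform_add_scale) (rule sym)
  ultimately have eq: "W u u = W \<epsilon> \<epsilon> + 2 * W \<epsilon> G + W G G + 2 * W f \<rho> + W \<rho> \<rho>" by simp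
  have f\<rho>: "2 * \<bar>W f \<rho>\<bar> \<le> 2 * (real n * h) * (t * sf + sr / t)"
    unfolding W_def sf_def sr_def by (rule bnd[OF _ t])
  have \<rho>\<rho>: "2 * \<bar>W \<rho> \<rho>\<bar> \<le> 2 * (real n * h) * (1 * sr + sr / 1)"
    unfolding W_def sr_def by (rule bnd) auto
  have sf: "sf \<le> 2 * su + 2 * sr"
  proof -
    have "(norm (f i))\<^sup>2 \<le> 2 * (norm (u i))\<^sup>2 + 2 * (norm (\<rho> i))\<^sup>2" for i
      using norm_add_sq_le[of "u i" "- \<rho> i"] norm_minus_commute[of "\<epsilon> i" "u i - G i"] by (simp add: f_def \<rho>_def)
    then show ?thesis unfolding sf_def su_def sr_def sum_distrib_left sum.distrib[symmetric] by (intro sum_mono)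
  qed
  have GG: "c * (real n * h) * (\<Sum>i<n. (norm (G i))\<^sup>2) - (step_var cs)\<^sup>2 * (2 * D) \<le> W G G"
    unfolding W_def G_def D_def by (rule wform_step_ge[OF h low])
  have "2 * (real n * h) * (t * sf + sr / t) + 2 * (real n * h) * sr \<le>
      (real n * h) * (4 * t * su + (4 * t + 2 / t + 2) * sr)"
  proof -
    have "t * sf \<le> t * (2 * su + 2 * sr)" using sf t by (intro mult_left_mono) auto
    then have "2 * (t * sf + sr / t) + 2 * sr \<le> 4 * t * su + (4 * t + 2 / t + 2) * sr"
      by (simp add: algebra_simps)
    then have "real n * h * (2 * (t * sf + sr / t) + 2 * sr) \<le> real n * h * (4 * t * su + (4 * t + 2 / t + 2) * sr)"
      using h by (intro mult_left_mono) auto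
    then show ?thesis by (simp add: algebra_simps)
  qed
  then have "c * (real n * h) * (\<Sum>i<n. (norm (G i))\<^sup>2) - (step_var cs)\<^sup>2 * (2 * D) - \<bar>W \<epsilon> \<epsilon>\<bar> - 2 * \<bar>W \<epsilon> G\<bar>
      - (real n * h) * (4 * t * su + (4 * t + 2 / t + 2) * sr) \<le> W u u"
    unfolding eq using GG f\<rho> \<rho>\<rho> by (simp add: algebra_simps)
  then have "(c * (real n * h) * (\<Sum>i<n. (norm (G i))\<^sup>2) - (step_var cs)\<^sup>2 * (2 * D) - \<bar>W \<epsilon> \<epsilon>\<bar> - 2 * \<bar>W \<epsilon> G\<bar>
      - (real n * h) * (4 * t * su + (4 * t + 2 / t + 2) * sr)) / N \<le> W u u / N"
    using N by (intro divide_right_mono) auto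
  moreover have "(c * (real n * h) * x) / N = c * (x / real n)" "(real n * h * x) / N = x / real n" for x
    using n h by (auto simp: N_def field_simps)
  ultimately show ?thesis
    unfolding su_def[symmetric] sr_def[symmetric] D_def[symmetric] using N
    by (simp add: diff_divide_distrib add_divide_distrib abs_divide)
qed

context weighted_sample
begin

text \<open>The order of quantifiers matters: \<open>c0\<close> is fixed by the set integral in
  \<open>ne\<close>, and then every error level \<open>q\<close> is reached by an approximation that
  may depend on \<open>q\<close>. The remainder \<open>R\<close> is nonnegative with small mean, in
  the form that Markov's inequality needs.\<close>

lemma signal_form_lower_bound:
  fixes u :: "'z \<Rightarrow> 'a::{real_inner, banach, second_countable_topology}" and h :: "nat \<Rightarrow> real"
  assumes h0: "\<forall>\<^sub>F n in sequentially. h n > 0" and h: "h \<longlonglongrightarrow> 0"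
    and nh: "filterlim (\<lambda>n. real n * h n) at_top sequentially"
    and u: "sq_integrable P u"
    and A: "A \<in> sets borel" and ne: "(\<integral>z. indicator A (f (w z)) *\<^sub>R u z \<partial>P) \<noteq> 0"
  obtains c0 where "c0 > 0"
    "\<And>q. q > 0 \<Longrightarrow> \<forall>\<^sub>F n in sequentially. \<exists>R. integrable M R \<and> (\<forall>\<omega>. 0 \<le> R \<omega>) \<and> expectation R \<le> q \<and>
      (\<forall>\<omega>. c0 - R \<omega> \<le> wform n (\<kappa> (h n) n (\<lambda>k. Z k \<omega>)) (\<lambda>i. u (Z i \<omega>)) (\<lambda>i. u (Z i \<omega>)) / (real n * (real n * h n)))"
proof -
  interpret P: prob_space P by (rule prob_space_P)
  define \<pi> where "\<pi> z = f (w z)" for z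
  have \<pi>S[measurable]: "\<pi> \<in> borel_measurable S" unfolding \<pi>_def by measurable
  interpret proj: prob_space_with_projection P \<pi>
    by standard simp
  \<comment> \<open>The same sample with only the projection as conditioning information, because
    \<epsilon> is known to be centered given \<pi> but not given \<open>w\<close>. The weights are
    unchanged, since both instances rank the values of \<pi>.\<close>
  interpret line: weighted_sample M S P Z K borel \<pi> "\<lambda>x. x"
    by standard simp_all
  have uS[measurable]: "u \<in> borel_measurable S"
    using u unfolding sq_integrable_def measurable_cong_sets[OF sets_P refl] by simp
  have u2: "integrable P (\<lambda>z. (norm (u z))\<^sup>2)" using u by (simp add: sq_integrable_def)
  define v where "v = (\<integral>z. indicator A (\<pi> z) *\<^sub>R u z \<partial>P)"
  have v: "norm v > 0" using ne by (simp add: v_def \<pi>_def)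
  define mu where "mu = (\<integral>z. (norm (u z))\<^sup>2 \<partial>P)"
  have mu: "0 \<le> mu" by (simp add: mu_def)
  obtain c where c: "c > 0" and low: "\<forall>\<^sub>F n in sequentially. \<forall>y i. i < n \<longrightarrow>
    c * (real n * h n) \<le> (\<Sum>j\<in>{..<n} - {i}. weight K (h n) n y i j)"
    using eventually_weight_sum_ge[OF h0 h nh] by blast
  show ?thesis
  proof (rule that[of "c * ((norm v)\<^sup>2 / 4)"])
    show "c * ((norm v)\<^sup>2 / 4) > 0" using c v by simp
    fix q :: real assume q: "q > 0"
    \<comment> \<open>The level \<open>q\<close> is shared as \<open>q / 4\<close> for the term with
      \<open>4 * t\<close>, \<open>q / 4\<close> for the remainder and \<open>q / 2\<close> for what
      vanishes with \<open>n\<close>. Hence \<open>t\<close> is chosen first, then the coefficient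
      \<open>B\<close>, then \<eta>.\<close>
    define t where "t = q / (16 * (mu + 1))"
    have t: "t > 0" using q mu by (simp add: t_def)
    have tmu: "4 * t * mu \<le> q / 4" using q mu by (simp add: t_def field_simps)
    define B where "B = 4 * t + 2 / t + 2"
    have B: "B > 0" using t by (simp add: B_def add_pos_pos)
    \<comment> \<open>The first bound keeps the mean of \<open>(norm (G z))\<^sup>2\<close> away
      from 0, the second makes the contribution of the remainder at most
      \<open>q / 4\<close>.\<close>
    define \<eta> where "\<eta> = min ((norm v)\<^sup>2 / 4) (q / (4 * B))"
    have eta: "\<eta> > 0" "\<eta> \<le> (norm v)\<^sup>2 / 4" "B * \<eta> \<le> q / 4"
      using v q B by (auto simp: \<eta>_def field_simps min_def)
    obtain cs \<epsilon> where \<epsilon>: "cond_centered P borel \<pi> \<epsilon>" "integrable P (\<lambda>x. norm (\<epsilon> x) ^ 4)"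
      and \<rho>: "(\<integral>x. (norm (u x - step cs (\<pi> x) - \<epsilon> x))\<^sup>2 \<partial>P) < \<eta>"
      using proj.cond_exp_decomposition[OF u eta(1)] by blast
    define G where "G z = step cs (\<pi> z)" for z
    define r where "r z = u z - G z - \<epsilon> z" for z
    have \<epsilon>P: "\<epsilon> \<in> borel_measurable P" using \<epsilon>(1) by (simp add: cond_centered_def)
    then have [measurable]: "\<epsilon> \<in> borel_measurable S" unfolding measurable_cong_sets[OF sets_P refl] .
    have GS[measurable]: "G \<in> borel_measurable S" unfolding G_def by measurable
    have rS[measurable]: "r \<in> borel_measurable S" unfolding r_def by measurable
    have G_sq: "sq_integrable P G" unfolding G_def by (rule proj.sq_integrable_step)
    have \<epsilon>_sq: "sq_integrable P \<epsilon>"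
      unfolding sq_integrable_def using \<epsilon>P norm_power4_integrable_imp(1)[OF \<epsilon>P \<epsilon>(2)] by simp
    have r_sq: "sq_integrable P r"
      unfolding r_def by (intro sq_integrable_diff u G_sq \<epsilon>_sq)
    have r_small: "(\<integral>x. (norm (r x))\<^sup>2 \<partial>P) < \<eta>" using \<rho> by (simp add: r_def G_def)
    define V where "V = step_var cs"
    have G_le: "norm (G z) \<le> V" for z unfolding G_def V_def by (rule norm_step_le)
    define mG where "mG = (\<integral>z. (norm (G z))\<^sup>2 \<partial>P)"
    \<comment> \<open>Being centered given \<pi>, the part \<epsilon> does not contribute to
      \<open>v\<close>. So \<open>v\<close> is a set integral of \<open>G + r\<close>, whence
      \<open>(norm v)\<^sup>2 \<le> 2 * mG + 2 * \<eta>\<close>, and the choice of \<eta> gives the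
      claim.\<close>
    have mG: "(norm v)\<^sup>2 / 4 \<le> mG"
    proof -
      have [measurable]: "A \<in> sets borel" by (rule A)
      have \<epsilon>0: "inner v (\<integral>z. indicator A (\<pi> z) *\<^sub>R \<epsilon> z \<partial>P) = 0"
      proof -
        have i\<epsilon>: "integrable P \<epsilon>" by (rule norm_power4_integrable_imp(2)[OF \<epsilon>P \<epsilon>(2)])
        have int: "integrable P (\<lambda>z. indicator A (\<pi> z) *\<^sub>R \<epsilon> z)"
          by (rule Bochner_Integration.integrable_bound[OF i\<epsilon>]) (auto simp: indicator_def)
        have "inner v (\<integral>z. indicator A (\<pi> z) *\<^sub>R \<epsilon> z \<partial>P) = (\<integral>z. inner v (indicator A (\<pi> z) *\<^sub>R \<epsilon> z) \<partial>P)"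
          by (rule integral_inner_right[symmetric]) (rule int)
        also have "\<dots> = (\<integral>z. inner (\<epsilon> z) (indicator A (\<pi> z) *\<^sub>R v) \<partial>P)"
          by (simp add: inner_commute)
        also have "\<dots> = 0"
        proof -
          have "(\<lambda>t. indicator A t *\<^sub>R v) \<in> borel_measurable borel" by measurable
          moreover have "integrable P (\<lambda>z. norm (\<epsilon> z) * norm (indicator A (\<pi> z) *\<^sub>R v))"
            by (rule Bochner_Integration.integrable_bound[of P "\<lambda>z. norm (\<epsilon> z) * norm v"])
              (use i\<epsilon> in \<open>auto simp: indicator_def\<close>)
          ultimately show ?thesis by (rule cond_centeredD[OF \<epsilon>(1)])
        qed
        finally show ?thesis .
      qed
      define g where "g z = G z + r z" for z
      have g_sq: "sq_integrable P g" unfolding g_def using G_sq r_sq by (rule sq_integrable_add)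
      have [measurable]: "g \<in> borel_measurable S" unfolding g_def by measurable
      have g_i: "integrable P (\<lambda>z. 1 * norm (g z))"
        using g_sq by (intro integrable_mult_of_squares) (auto simp: sq_integrable_def)
      then have gA: "integrable P (\<lambda>z. indicator A (\<pi> z) *\<^sub>R g z)"
        by (rule Bochner_Integration.integrable_bound) (auto simp: indicator_def)
      have \<epsilon>A: "integrable P (\<lambda>z. indicator A (\<pi> z) *\<^sub>R \<epsilon> z)"
        by (rule Bochner_Integration.integrable_bound[OF norm_power4_integrable_imp(2)[OF \<epsilon>P \<epsilon>(2)]]) (auto simp: indicator_def)
      have "v = (\<integral>z. indicator A (\<pi> z) *\<^sub>R g z + indicator A (\<pi> z) *\<^sub>R \<epsilon> z \<partial>P)"
        unfolding v_def by (intro Bochner_Integration.integral_cong refl) (simp add: g_def r_def algebra_simps)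
      also have "\<dots> = (\<integral>z. indicator A (\<pi> z) *\<^sub>R g z \<partial>P) + (\<integral>z. indicator A (\<pi> z) *\<^sub>R \<epsilon> z \<partial>P)"
        using gA \<epsilon>A by (rule Bochner_Integration.integral_add)
      finally have "inner v v = inner v (\<integral>z. indicator A (\<pi> z) *\<^sub>R g z \<partial>P)"
        using \<epsilon>0 by (metis add.right_neutral inner_add_right)
      also have "\<dots> \<le> norm v * norm (\<integral>z. indicator A (\<pi> z) *\<^sub>R g z \<partial>P)" by (rule norm_cauchy_schwarz)
      finally have "norm v \<le> norm (\<integral>z. indicator A (\<pi> z) *\<^sub>R g z \<partial>P)"
        using v by (simp add: power2_norm_eq_inner[symmetric] power2_eq_square)
      also have "\<dots> \<le> (\<integral>z. norm (indicator A (\<pi> z) *\<^sub>R g z) \<partial>P)" by (rule integral_norm_bound)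
      also have "\<dots> \<le> (\<integral>z. \<bar>norm (g z)\<bar> \<partial>P)"
        using g_i by (intro integral_mono integrable_norm gA) (auto simp: indicator_def)
      also have "\<dots> \<le> sqrt (\<integral>z. (norm (g z))\<^sup>2 \<partial>P)"
        using g_sq by (intro P.expectation_abs_le_sqrt(2)) (auto simp: sq_integrable_def)
      finally have "(norm v)\<^sup>2 \<le> (\<integral>z. (norm (g z))\<^sup>2 \<partial>P)"
        using sqrt_ge_absD by force
      also have "\<dots> \<le> 2 * mG + 2 * (\<integral>z. (norm (r z))\<^sup>2 \<partial>P)"
        unfolding g_def mG_def by (rule sq_integrable_add(2)[OF G_sq r_sq])
      finally show ?thesis using r_small eta(2) by simp
    qed
    define b where "b n = real n * (real n * h n)" for n
    define \<Phi> where "\<Phi> n = (\<Sum>d=1..n. real d * K (real d / (real n * h n))) / b n" for n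
    define W :: "nat \<Rightarrow> 'w \<Rightarrow> (nat \<Rightarrow> 'a) \<Rightarrow> (nat \<Rightarrow> 'a) \<Rightarrow> real"
      where "W n \<omega> = wform n (\<kappa> (h n) n (\<lambda>k. Z k \<omega>))" for n \<omega>
    define a1 where "a1 n \<omega> = (\<Sum>i<n. (norm (G (Z i \<omega>)))\<^sup>2) / real n - mG" for n \<omega>
    define a2 where "a2 n \<omega> = W n \<omega> (\<lambda>i. \<epsilon> (Z i \<omega>)) (\<lambda>i. \<epsilon> (Z i \<omega>)) / b n" for n \<omega>
    define a3 where "a3 n \<omega> = W n \<omega> (\<lambda>i. \<epsilon> (Z i \<omega>)) (\<lambda>i. G (Z i \<omega>)) / b n" for n \<omega>
    define a4 where "a4 n \<omega> = (\<Sum>i<n. (norm (u (Z i \<omega>)))\<^sup>2) / real n" for n \<omega>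
    define a5 where "a5 n \<omega> = (\<Sum>i<n. (norm (r (Z i \<omega>)))\<^sup>2) / real n" for n \<omega>
    define R where "R n \<omega> = c * \<bar>a1 n \<omega>\<bar> + V\<^sup>2 * (2 * \<Phi> n) + \<bar>a2 n \<omega>\<bar> + 2 * \<bar>a3 n \<omega>\<bar> + (4 * t * a4 n \<omega> + B * a5 n \<omega>)" for n \<omega>
    define m\<epsilon> where "m\<epsilon> = (\<integral>z. norm (\<epsilon> z) ^ 4 \<partial>P)"
    define mG4 where "mG4 = (\<integral>z. norm (G z) ^ 4 \<partial>P)"
    \<comment> \<open>Bound for the mean of the part of \<open>R\<close> that vanishes as
      \<open>n\<close> grows, with \<open>cs\<close> and \<epsilon> fixed: fluctuation of the
      average of \<open>(norm (G z))\<^sup>2\<close>, jumps of the step function, and the two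
      centered terms.\<close>
    define E where "E n = c * sqrt ((2 * V\<^sup>2)\<^sup>2 / real n) + V\<^sup>2 * (2 * \<Phi> n) + sqrt (8 * K 0 * m\<epsilon> / b n)
      + 2 * sqrt (2 * (m\<epsilon> + mG4) / real n)" for n
    have n_inf: "filterlim real at_top sequentially" by (rule filterlim_real_sequentially)
    have b_inf: "filterlim b at_top sequentially"
      unfolding b_def by (rule filterlim_at_top_mult_at_top[OF n_inf nh])
    have \<Phi>: "\<Phi> \<longlonglongrightarrow> 0" unfolding \<Phi>_def b_def by (rule first_moment_average_tendsto_0[OF h0 h])
    have "E \<longlonglongrightarrow> c * sqrt 0 + V\<^sup>2 * (2 * 0) + sqrt 0 + 2 * sqrt 0"
      unfolding E_def
      by (intro tendsto_intros tendsto_divide_0[OF tendsto_const filterlim_at_top_imp_at_infinity] n_inf b_inf \<Phi>)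
    then have "\<forall>\<^sub>F n in sequentially. E n < q / 2"
      by (rule order_tendstoD(2)) (use q in simp)
    then show "\<forall>\<^sub>F n in sequentially. \<exists>R. integrable M R \<and> (\<forall>\<omega>. 0 \<le> R \<omega>) \<and> expectation R \<le> q \<and>
      (\<forall>\<omega>. c * ((norm v)\<^sup>2 / 4) - R \<omega> \<le> wform n (\<kappa> (h n) n (\<lambda>k. Z k \<omega>)) (\<lambda>i. u (Z i \<omega>)) (\<lambda>i. u (Z i \<omega>)) / (real n * (real n * h n)))"
      using low h0 eventually_gt_at_top[of 0]
    proof eventually_elim
      case (elim n)
      have G4: "integrable P (\<lambda>z. norm (G z) ^ 4)"
        by (rule P.integrable_const_bound[of _ "V ^ 4"]) (auto intro!: power_mono G_le)
      have sq_le: "\<bar>(norm (G z))\<^sup>2\<bar> \<le> V\<^sup>2" for z using G_le[of z] by (simp add: power_mono)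
      have a1: "integrable M (\<lambda>\<omega>. \<bar>a1 n \<omega>\<bar>)" "expectation (\<lambda>\<omega>. \<bar>a1 n \<omega>\<bar>) \<le> sqrt ((2 * V\<^sup>2)\<^sup>2 / real n)"
        using mean_deviation_le[of "\<lambda>z. (norm (G z))\<^sup>2", OF _ sq_le elim(4)]
        unfolding a1_def mG_def by auto
      have W_line: "W n \<omega> = wform n (weight K (h n) n (\<lambda>k. \<pi> (Z k \<omega>)))" for \<omega>
        by (simp add: W_def \<pi>_def)
      have a2: "integrable M (\<lambda>\<omega>. \<bar>a2 n \<omega>\<bar>)" "expectation (\<lambda>\<omega>. \<bar>a2 n \<omega>\<bar>) \<le> sqrt (8 * K 0 * m\<epsilon> / b n)"
        using line.degenerate_expectation_abs_le[OF \<epsilon> elim(3,4)]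
        unfolding a2_def W_line m\<epsilon>_def b_def by auto
      have G_step: "G z = step cs (\<pi> z)" for z by (simp add: G_def)
      have a3: "integrable M (\<lambda>\<omega>. \<bar>a3 n \<omega>\<bar>)" "expectation (\<lambda>\<omega>. \<bar>a3 n \<omega>\<bar>) \<le> sqrt (2 * (m\<epsilon> + mG4) / real n)"
        using line.regression_expectation_abs_le[OF \<epsilon> measurable_step[of cs] G4[unfolded G_def] elim(3,4)]
        unfolding a3_def W_line m\<epsilon>_def mG4_def b_def G_step by auto
      have uZ: "integrable M (\<lambda>\<omega>. (norm (u (Z i \<omega>)))\<^sup>2)" "(\<integral>\<omega>. (norm (u (Z i \<omega>)))\<^sup>2 \<partial>M) = mu" for i
        using integrable_Z[of "\<lambda>z. (norm (u z))\<^sup>2"] integral_Z[of "\<lambda>z. (norm (u z))\<^sup>2"] u2 by (auto simp: mu_def)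
      have rZ: "integrable M (\<lambda>\<omega>. (norm (r (Z i \<omega>)))\<^sup>2)" "(\<integral>\<omega>. (norm (r (Z i \<omega>)))\<^sup>2 \<partial>M) \<le> \<eta>" for i
        using integrable_Z[of "\<lambda>z. (norm (r z))\<^sup>2"] integral_Z[of "\<lambda>z. (norm (r z))\<^sup>2"] r_sq r_small
        by (auto simp: sq_integrable_def)
      have a4: "integrable M (a4 n)" "expectation (a4 n) = mu"
        unfolding a4_def using uZ elim(4) by auto
      have a5: "integrable M (a5 n)" unfolding a5_def using rZ by auto
      have a5_le: "expectation (a5 n) \<le> \<eta>"
      proof -
        have "expectation (a5 n) = (\<Sum>i<n. \<integral>\<omega>. (norm (r (Z i \<omega>)))\<^sup>2 \<partial>M) / real n"
          unfolding a5_def using rZ(1) by simp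
        also have "\<dots> \<le> (\<Sum>i<n. \<eta>) / real n" using rZ(2) by (intro divide_right_mono sum_mono) auto
        finally show ?thesis using elim(4) by simp
      qed
      have R_int: "integrable M (R n)"
        unfolding R_def using a1 a2 a3 a4 a5 by (intro Bochner_Integration.integrable_add integrable_mult_right) auto
      have "expectation (R n) = c * expectation (\<lambda>\<omega>. \<bar>a1 n \<omega>\<bar>) + V\<^sup>2 * (2 * \<Phi> n) + expectation (\<lambda>\<omega>. \<bar>a2 n \<omega>\<bar>)
          + 2 * expectation (\<lambda>\<omega>. \<bar>a3 n \<omega>\<bar>) + (4 * t * expectation (a4 n) + B * expectation (a5 n))"
        unfolding R_def using a1(1) a2(1) a3(1) a4(1) a5 by (simp add: prob_space)
      also have "\<dots> \<le> E n + (4 * t * mu + B * \<eta>)"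
        unfolding E_def a4(2) using a1(2) a2(2) a3(2) a5_le c B
        by (intro add_mono mult_left_mono order.refl) auto
      also have "\<dots> \<le> q" using elim(1) tmu eta(3) by simp
      finally have R_le: "expectation (R n) \<le> q" .
      have "c * ((norm v)\<^sup>2 / 4) - R n \<omega> \<le> W n \<omega> (\<lambda>i. u (Z i \<omega>)) (\<lambda>i. u (Z i \<omega>)) / b n" for \<omega>
      proof -
        have "c * (a1 n \<omega> + mG) - V\<^sup>2 * (2 * \<Phi> n) - \<bar>a2 n \<omega>\<bar> - 2 * \<bar>a3 n \<omega>\<bar> - (4 * t * a4 n \<omega> + B * a5 n \<omega>)
            \<le> W n \<omega> (\<lambda>i. u (Z i \<omega>)) (\<lambda>i. u (Z i \<omega>)) / b n"
          using wform_decomposition_ge[OF elim(3,4) t, of c "\<lambda>k. \<pi> (Z k \<omega>)" cs "\<lambda>i. \<epsilon> (Z i \<omega>)" "\<lambda>i. u (Z i \<omega>)"] elim(2)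
          unfolding a1_def a2_def a3_def a4_def a5_def W_line r_def G_step V_def \<Phi>_def b_def B_def
          by simp
        moreover have "- (c * \<bar>a1 n \<omega>\<bar>) \<le> c * a1 n \<omega>" using c by (simp add: abs_if)
        moreover have "c * ((norm v)\<^sup>2 / 4) \<le> c * mG" using mG c by simp
        ultimately show ?thesis unfolding R_def by (simp add: distrib_left)
      qed
      moreover have "0 \<le> R n \<omega>" for \<omega>
      proof -
        have "0 \<le> \<Phi> n" unfolding \<Phi>_def b_def using nonneg elim(3) by (auto intro!: divide_nonneg_nonneg sum_nonneg)
        moreover have "0 \<le> a4 n \<omega>" "0 \<le> a5 n \<omega>" unfolding a4_def a5_def by (auto intro!: divide_nonneg_nonneg sum_nonneg)
        ultimately show ?thesis unfolding R_def using c t B by (intro add_nonneg_nonneg mult_nonneg_nonneg) auto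
      qed
      ultimately show ?case using R_int R_le unfolding W_def b_def by blast
    qed
  qed
qed

end

section \<open>The studentized statistic\<close>

context kernel
begin

text \<open>One factor of the squared weight is bounded by \<open>K 0\<close> and the other is
  summed by rows; fourth powers arise from splitting the squared inner product.\<close>

lemma inner_sq_weight_sq_le:
  assumes "h > 0"
  shows "(\<Sum>i<n. \<Sum>j\<in>{..<n} - {i}. (inner (u i) (u j))\<^sup>2 * (weight K h n y i j)\<^sup>2)
    \<le> 2 * K 0 * (real n * h) * (\<Sum>i<n. norm (u i) ^ 4)"
proof -
  let ?k = "weight K h n y" and ?q = "\<lambda>i. norm (u i) ^ 4"
  have "(\<Sum>i<n. \<Sum>j\<in>{..<n} - {i}. (inner (u i) (u j))\<^sup>2 * (?k i j)\<^sup>2)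
      \<le> (\<Sum>i<n. \<Sum>j\<in>{..<n} - {i}. (?q i / 2 + ?q j / 2) * (K 0 * ?k i j))"
  proof (intro sum_mono mult_mono)
    fix i j
    have "(inner (u i) (u j))\<^sup>2 \<le> (norm (u i) * norm (u j))\<^sup>2"
      using Cauchy_Schwarz_ineq2[of "u i" "u j"] by (simp add: abs_le_square_iff[symmetric])
    also have "\<dots> \<le> ?q i / 2 + ?q j / 2"
      using weighted_AM_GM[of 1 "(norm (u i))\<^sup>2" "(norm (u j))\<^sup>2"]
      by (simp add: power_mult[symmetric] power_mult_distrib)
    finally show "(inner (u i) (u j))\<^sup>2 \<le> ?q i / 2 + ?q j / 2" .
    show "(?k i j)\<^sup>2 \<le> K 0 * ?k i j"
      unfolding power2_eq_square by (intro mult_right_mono weight_le weight_nonneg)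
  qed auto
  also have "\<dots> = K 0 / 2 * ((\<Sum>i<n. \<Sum>j\<in>{..<n} - {i}. ?q i * ?k i j) + (\<Sum>i<n. \<Sum>j\<in>{..<n} - {i}. ?q j * ?k i j))"
    by (simp add: sum_distrib_left sum.distrib[symmetric] algebra_simps)
  also have "(\<Sum>i<n. \<Sum>j\<in>{..<n} - {i}. ?q j * ?k i j) = (\<Sum>i<n. \<Sum>j\<in>{..<n} - {i}. ?q i * ?k i j)"
    by (subst sum_offdiag_swap) (subst weight_commute, rule refl)
  also have "K 0 / 2 * ((\<Sum>i<n. \<Sum>j\<in>{..<n} - {i}. ?q i * ?k i j) + (\<Sum>i<n. \<Sum>j\<in>{..<n} - {i}. ?q i * ?k i j))
      = K 0 * (\<Sum>i<n. \<Sum>j\<in>{..<n} - {i}. ?q i * ?k i j)" by simp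
  also have "\<dots> \<le> K 0 * (\<Sum>i<n. ?q i * (2 * (real n * h)))"
    unfolding sum_distrib_left[symmetric] using K0_pos
    by (intro mult_left_mono sum_mono sum_weight_le assms) auto
  also have "\<dots> = 2 * K 0 * (real n * h) * (\<Sum>i<n. ?q i)"
    by (simp add: sum_distrib_left sum_distrib_right algebra_simps)
  finally show ?thesis .
qed

text \<open>The factor 8 is the 4 left by the row bound, doubled because
  \<open>n - 1 \<ge> n / 2\<close>.\<close>

lemma v_stat_le:
  assumes h: "h > 0" and n: "n \<ge> 2"
  shows "v_stat K h n u y \<le> sqrt (8 * K 0 * ((\<Sum>i<n. norm (u i) ^ 4) / real n))"
proof -
  let ?q = "\<Sum>i<n. norm (u i) ^ 4"
  have q: "0 \<le> ?q" by (intro sum_nonneg) simp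
  have "2 / (real n * (real n - 1) * h) *
     (\<Sum>i<n. \<Sum>j\<in>{..<n} - {i}. (inner (u i) (u j))\<^sup>2 * (K ((ecdf_at n y i - ecdf_at n y j) / h))\<^sup>2)
     \<le> 2 / (real n * (real n - 1) * h) * (2 * K 0 * (real n * h) * ?q)"
    using inner_sq_weight_sq_le[OF h, where n = n and u = u and y = y] n h unfolding weight_def by (intro mult_left_mono) auto
  also have "\<dots> = 4 * K 0 * ?q / (real n - 1)"
    using h n by (simp add: field_simps)
  also have "\<dots> \<le> 4 * K 0 * ?q / (real n / 2)"
    using n q K0_pos by (intro divide_left_mono) auto
  also have "\<dots> = 8 * K 0 * (?q / real n)" by simp
  finally show ?thesis unfolding v_stat_def by (rule real_sqrt_le_mono)
qed

text \<open>Replacing the divisor \<open>n * (n * h)\<close> by the smaller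
  \<open>n * (n - 1) * h\<close> only increases a positive form, while the denominator is bounded by
  \<open>v_stat_le\<close>.\<close>

lemma studentized_ge:
  assumes h: "h > 0" and n: "n \<ge> 2" and s: "s > 0" and B: "(\<Sum>i<n. norm (u i) ^ 4) / real n \<le> B"
    and W: "s \<le> wform n (weight K h n y) u u / (real n * (real n * h))"
  shows "real n * sqrt h * (s / sqrt (8 * K 0 * B)) \<le> studentized K h n u y"
proof -
  define W where "W = wform n (weight K h n y) u u"
  have b: "real n * (real n * h) > 0" using n h by simp
  have W_pos: "W > 0" using s assms(5) b unfolding W_def[symmetric] by (metis less_le_trans zero_less_divide_iff not_less_iff_gr_or_eq)
  have Q: "Q_stat K h n u y = W / (real n * (real n - 1) * h)"
    by (simp add: Q_stat_def W_def wform_def weight_def sum_divide_distrib[symmetric] sum_distrib_left[symmetric] sum_distrib_right[symmetric])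
  have "s \<le> W / (real n * (real n * h))" using W by (simp add: W_def)
  also have "\<dots> \<le> W / (real n * (real n - 1) * h)"
    using W_pos n h by (intro divide_left_mono) auto
  finally have sQ: "s \<le> Q_stat K h n u y" unfolding Q .
  \<comment> \<open>Division by 0 gives 0, so the denominator must be shown to be positive. Were it
    not, every inner product times its weight would vanish, and with them the numerator.\<close>
  have v_pos: "v_stat K h n u y > 0"
  proof (rule ccontr)
    assume "\<not> v_stat K h n u y > 0"
    then have "2 / (real n * (real n - 1) * h) *
        (\<Sum>i<n. \<Sum>j\<in>{..<n} - {i}. (inner (u i) (u j))\<^sup>2 * (weight K h n y i j)\<^sup>2) \<le> 0"
      unfolding v_stat_def weight_def[symmetric] by simp
    moreover have "2 / (real n * (real n - 1) * h) > 0" using n h by simp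
    ultimately have "(\<Sum>i<n. \<Sum>j\<in>{..<n} - {i}. (inner (u i) (u j))\<^sup>2 * (weight K h n y i j)\<^sup>2) \<le> 0"
      by (meson mult_pos_pos not_less)
    moreover have "0 \<le> (\<Sum>i<n. \<Sum>j\<in>{..<n} - {i}. (inner (u i) (u j))\<^sup>2 * (weight K h n y i j)\<^sup>2)"
      by (intro sum_nonneg) simp
    ultimately have "(\<Sum>i<n. \<Sum>j\<in>{..<n} - {i}. (inner (u i) (u j))\<^sup>2 * (weight K h n y i j)\<^sup>2) = 0"
      by linarith
    then have "inner (u i) (u j) * weight K h n y i j = 0" if "i < n" "j \<in> {..<n} - {i}" for i j
      using that by (subst (asm) sum_nonneg_eq_0_iff) (auto simp: sum_nonneg_eq_0_iff intro!: sum_nonneg)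
    then have "W = 0" unfolding W_def wform_def by (intro sum.neutral ballI) auto
    with W_pos show False by simp
  qed
  have v_le: "v_stat K h n u y \<le> sqrt (8 * K 0 * B)"
    using v_stat_le[OF h n, of u y] mult_left_mono[OF B, of "8 * K 0"] K0_pos
    by (meson order.trans real_sqrt_le_mono mult_nonneg_nonneg less_imp_le zero_le_numeral)
  have "s / sqrt (8 * K 0 * B) \<le> Q_stat K h n u y / v_stat K h n u y"
    using sQ s v_pos v_le by (intro frac_le) auto
  then have "real n * sqrt h * (s / sqrt (8 * K 0 * B)) \<le> real n * sqrt h * (Q_stat K h n u y / v_stat K h n u y)"
    using h by (intro mult_left_mono) auto
  then show ?thesis by (simp add: studentized_def)
qed

lemma measurable_studentized:
  fixes u :: "nat \<Rightarrow> 'w \<Rightarrow> l2"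
  assumes u: "\<And>i. u i \<in> borel_measurable M" and y: "\<And>i. y i \<in> borel_measurable M"
  shows "(\<lambda>\<omega>. studentized K h n (\<lambda>i. u i \<omega>) (\<lambda>i. y i \<omega>)) \<in> borel_measurable M"
proof -
  have w: "(\<lambda>\<omega>. K ((ecdf_at n (\<lambda>i. y i \<omega>) i - ecdf_at n (\<lambda>i. y i \<omega>) j) / h)) \<in> borel_measurable M" if "i < n" "j < n" for i j
    using measurable_weight[of n "\<lambda>\<omega> i. y i \<omega>" M i j h] y that unfolding weight_def by simp
  have "(\<lambda>\<omega>. Q_stat K h n (\<lambda>i. u i \<omega>) (\<lambda>i. y i \<omega>)) \<in> borel_measurable M"
    unfolding Q_stat_def using u
    by (intro borel_measurable_times borel_measurable_const borel_measurable_sum borel_measurable_inner w) auto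
  moreover have "(\<lambda>\<omega>. v_stat K h n (\<lambda>i. u i \<omega>) (\<lambda>i. y i \<omega>)) \<in> borel_measurable M"
  proof -
    have [measurable]: "(\<lambda>\<omega>. \<Sum>i<n. \<Sum>j\<in>{..<n} - {i}. (inner (u i \<omega>) (u j \<omega>))\<^sup>2 *
        (K ((ecdf_at n (\<lambda>i. y i \<omega>) i - ecdf_at n (\<lambda>i. y i \<omega>) j) / h))\<^sup>2) \<in> borel_measurable M"
      using u by (intro borel_measurable_sum borel_measurable_times borel_measurable_power borel_measurable_inner w) auto
    show ?thesis unfolding v_stat_def by measurable
  qed
  ultimately show ?thesis unfolding studentized_def by simp
qed

end

context weighted_sample
begin

text \<open>Divided by \<open>(r n)\<^sup>2\<close>, the form of the observed variables is at least
  \<open>c0 - R'\<close>, where the noise enters \<open>R'\<close> with mean of order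
  \<open>1 / L n\<close> and the cross term with mean of order
  \<open>1 / sqrt ((r n)\<^sup>2 * n)\<close>. As \<open>thr\<close> is eventually at least 1,
  \<open>rthr\<close> sends \<open>L n\<close> and hence \<open>(r n)\<^sup>2 * n\<close> to
  infinity. So the noise is negligible even when \<open>r n\<close> tends to 0, and the statistic is
  at least a multiple of \<open>L n\<close> with high probability.\<close>

lemma studentized_exceeds:
  fixes e :: "'z \<Rightarrow> l2" and g :: "'t \<Rightarrow> l2" and h r thr :: "nat \<Rightarrow> real"
  assumes e: "cond_centered P T w e" and e4: "integrable P (\<lambda>z. norm (e z) ^ 4)"
    and g[measurable]: "g \<in> borel_measurable T" and g4: "integrable P (\<lambda>z. norm (g (w z)) ^ 4)"
    and A: "A \<in> sets borel" and ne: "(\<integral>z. indicator A (f (w z)) *\<^sub>R g (w z) \<partial>P) \<noteq> 0"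
    and h0: "\<And>n. n \<ge> 1 \<Longrightarrow> h n > 0" and h: "h \<longlonglongrightarrow> 0"
    and nh: "filterlim (\<lambda>n. real n * h n) at_top sequentially"
    and r: "\<And>n. n \<ge> 1 \<Longrightarrow> \<bar>r n\<bar> \<le> C"
    and thr: "\<forall>\<^sub>F n in sequentially. thr n \<ge> 1"
    and rthr: "filterlim (\<lambda>n. (r n)\<^sup>2 * real n * sqrt (h n) / thr n) at_top sequentially"
    and xi: "\<xi> > 0"
  shows "\<forall>\<^sub>F n in sequentially. 1 - \<xi> \<le>
    prob {\<omega> \<in> space M. thr n \<le> studentized K (h n) n (\<lambda>i. e (Z i \<omega>) + r n *\<^sub>R g (w (Z i \<omega>))) (\<lambda>i. f (w (Z i \<omega>)))}"
proof -
  have eP: "e \<in> borel_measurable P" using e by (simp add: cond_centered_def)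
  then have eS[measurable]: "e \<in> borel_measurable S"
    unfolding measurable_cong_sets[OF sets_P refl] .
  define u where "u z = g (w z)" for z
  have uS[measurable]: "u \<in> borel_measurable S" unfolding u_def by measurable
  have uP: "u \<in> borel_measurable P" by measurable
  have u4: "integrable P (\<lambda>z. norm (u z) ^ 4)" using g4 by (simp add: u_def)
  have u_sq: "sq_integrable P u" unfolding sq_integrable_def using uP norm_power4_integrable_imp(1)[OF uP u4] by simp
  have h0': "\<forall>\<^sub>F n in sequentially. h n > 0" using eventually_mono[OF eventually_ge_at_top[of 1] h0] .
  obtain c0 where c0: "c0 > 0" and signal: "\<And>q. q > 0 \<Longrightarrow> \<forall>\<^sub>F n in sequentially. \<exists>R. integrable M R \<and> (\<forall>\<omega>. 0 \<le> R \<omega>) \<and> expectation R \<le> q \<and>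
      (\<forall>\<omega>. c0 - R \<omega> \<le> wform n (\<kappa> (h n) n (\<lambda>k. Z k \<omega>)) (\<lambda>i. u (Z i \<omega>)) (\<lambda>i. u (Z i \<omega>)) / (real n * (real n * h n)))"
    using signal_form_lower_bound[OF h0' h nh u_sq A] ne unfolding u_def by blast
  define me where "me = (\<integral>z. norm (e z) ^ 4 \<partial>P)"
  define mu where "mu = (\<integral>z. norm (u z) ^ 4 \<partial>P)"
  have me: "0 \<le> me" and mu: "0 \<le> mu" by (auto simp: me_def mu_def)
  \<comment> \<open>Bound for the mean of the fourth power of the norm of an observed variable:
    \<open>(2 * a\<^sup>2 + 2 * b\<^sup>2)\<^sup>2 \<le> 8 * a^4 + 8 * b^4\<close>, with
    \<open>C\<close> bounding \<open>\<bar>r n\<bar>\<close> uniformly in \<open>n\<close>.\<close>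
  define m where "m = 8 * me + 8 * C ^ 4 * mu"
  have m: "0 \<le> m" using me mu by (simp add: m_def)
  \<comment> \<open>By Markov, a nonnegative variable of mean \<open>m\<close> reaches
    \<open>B\<close> with probability at most \<open>\<xi> / 2\<close>; the 1 keeps \<open>B\<close>
    positive when \<open>m = 0\<close>.\<close>
  define B where "B = 2 * (m + 1) / \<xi>"
  have B: "B > 0" using m xi by (simp add: B_def)
  \<comment> \<open>The total remainder \<open>R'\<close> will have mean at most
    \<open>2 * q\<close>, so it reaches \<open>c0 / 2\<close> with probability at most
    \<open>4 * q / c0 = \<xi> / 2\<close>.\<close>
  define q where "q = c0 * \<xi> / 8"
  have q: "q > 0" using c0 xi by (simp add: q_def)
  define L where "L n = (r n)\<^sup>2 * real n * sqrt (h n)" for n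
  have L_inf: "filterlim L at_top sequentially"
  proof (rule filterlim_at_top_mono[OF rthr])
    show "\<forall>\<^sub>F n in sequentially. (r n)\<^sup>2 * real n * sqrt (h n) / thr n \<le> L n"
      using thr h0'
    proof eventually_elim
      case (elim n)
      then have "L n * 1 \<le> L n * thr n" by (intro mult_left_mono) (auto simp: L_def)
      then show ?case using elim by (simp add: L_def divide_le_eq)
    qed
  qed
  have "(\<lambda>n. sqrt (8 * K 0 * me) / L n) \<longlonglongrightarrow> 0"
    by (rule tendsto_divide_0[OF tendsto_const filterlim_at_top_imp_at_infinity[OF L_inf]])
  then have ev1: "\<forall>\<^sub>F n in sequentially. sqrt (8 * K 0 * me) / L n < q / 2"
    by (rule order_tendstoD(2)) (use q in simp)
  have r2n_inf: "filterlim (\<lambda>n. (r n)\<^sup>2 * real n) at_top sequentially"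
  proof (rule filterlim_at_top_mono[OF L_inf])
    have "\<forall>\<^sub>F n in sequentially. h n < 1" by (rule order_tendstoD(2)[OF h]) simp
    then show "\<forall>\<^sub>F n in sequentially. L n \<le> (r n)\<^sup>2 * real n"
      using h0'
    proof eventually_elim
      case (elim n)
      then have "sqrt (h n) \<le> 1" by simp
      then have "(r n)\<^sup>2 * real n * sqrt (h n) \<le> (r n)\<^sup>2 * real n * 1" by (rule mult_left_mono) simp
      then show ?case by (simp add: L_def)
    qed
  qed
  have "(\<lambda>n. 2 * sqrt (2 * (me + mu) / ((r n)\<^sup>2 * real n))) \<longlonglongrightarrow> 2 * sqrt 0"
    by (intro tendsto_intros tendsto_divide_0[OF tendsto_const filterlim_at_top_imp_at_infinity[OF r2n_inf]])
  then have ev2: "\<forall>\<^sub>F n in sequentially. 2 * sqrt (2 * (me + mu) / ((r n)\<^sup>2 * real n)) < q / 2"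
    by (rule order_tendstoD(2)) (use q in simp)
  \<comment> \<open>This is the margin needed for the lower bound
    \<open>L n * c0 / (2 * sqrt (8 * K 0 * B))\<close> of the statistic to reach
    \<open>thr n\<close>.\<close>
  have ev3: "\<forall>\<^sub>F n in sequentially. (r n)\<^sup>2 * real n * sqrt (h n) / thr n \<ge> 2 * sqrt (8 * K 0 * B) / c0"
    using rthr by (simp add: filterlim_at_top)
  have ev4: "\<forall>\<^sub>F n in sequentially. L n \<ge> 1" using L_inf by (simp add: filterlim_at_top)
  show ?thesis
    using ev1 ev2 ev3 ev4 thr signal[OF q] eventually_ge_at_top[of 2]
  proof eventually_elim
    case (elim n)
    have hn: "h n > 0" and n0: "n > 0" using elim(7) h0 by auto
    have rn: "r n \<noteq> 0" using elim(4) by (auto simp: L_def)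
    define b where "b = real n * (real n * h n)"
    have b: "b > 0" using n0 hn by (simp add: b_def)
    obtain R where R: "integrable M R" "\<And>\<omega>. 0 \<le> R \<omega>" "expectation R \<le> q"
      "\<And>\<omega>. c0 - R \<omega> \<le> wform n (\<kappa> (h n) n (\<lambda>k. Z k \<omega>)) (\<lambda>i. u (Z i \<omega>)) (\<lambda>i. u (Z i \<omega>)) / b"
      using elim(6) unfolding b_def by blast
    define W :: "'w \<Rightarrow> (nat \<Rightarrow> l2) \<Rightarrow> (nat \<Rightarrow> l2) \<Rightarrow> real"
      where "W \<omega> = wform n (\<kappa> (h n) n (\<lambda>k. Z k \<omega>))" for \<omega>
    define E where "E \<omega> i = e (Z i \<omega>)" for \<omega> i
    define V where "V \<omega> i = u (Z i \<omega>)" for \<omega> i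
    define U where "U \<omega> i = E \<omega> i + r n *\<^sub>R V \<omega> i" for \<omega> i
    define a1 where "a1 \<omega> = W \<omega> (E \<omega>) (E \<omega>) / b" for \<omega>
    define a2 where "a2 \<omega> = W \<omega> (E \<omega>) (V \<omega>) / b" for \<omega>
    have a1: "integrable M (\<lambda>\<omega>. \<bar>a1 \<omega>\<bar>)" "expectation (\<lambda>\<omega>. \<bar>a1 \<omega>\<bar>) \<le> sqrt (8 * K 0 * me / b)"
      using degenerate_expectation_abs_le[OF e e4 hn n0] unfolding a1_def W_def E_def me_def b_def by auto
    have a2: "integrable M (\<lambda>\<omega>. \<bar>a2 \<omega>\<bar>)" "expectation (\<lambda>\<omega>. \<bar>a2 \<omega>\<bar>) \<le> sqrt (2 * (me + mu) / real n)"
      using regression_expectation_abs_le[OF e e4 g g4 hn n0] unfolding a2_def W_def E_def V_def me_def mu_def u_def b_def by auto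
    define R' where "R' \<omega> = R \<omega> + \<bar>a1 \<omega>\<bar> / (r n)\<^sup>2 + 2 * (\<bar>a2 \<omega>\<bar> / \<bar>r n\<bar>)" for \<omega>
    have R'_int: "integrable M R'" unfolding R'_def using R a1 a2 by simp
    have R'_nn: "0 \<le> R' \<omega>" for \<omega> unfolding R'_def using R(2) by simp
    have "expectation R' = expectation R + expectation (\<lambda>\<omega>. \<bar>a1 \<omega>\<bar>) / (r n)\<^sup>2 + 2 * (expectation (\<lambda>\<omega>. \<bar>a2 \<omega>\<bar>) / \<bar>r n\<bar>)"
      unfolding R'_def using R a1 a2 by simp
    also have "\<dots> \<le> q + sqrt (8 * K 0 * me / b) / (r n)\<^sup>2 + 2 * (sqrt (2 * (me + mu) / real n) / \<bar>r n\<bar>)"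
      using R(3) a1(2) a2(2) by (intro add_mono mult_left_mono divide_right_mono) auto
    also have "sqrt (8 * K 0 * me / b) / (r n)\<^sup>2 = sqrt (8 * K 0 * me) / L n"
    proof -
      have "sqrt b = real n * sqrt (h n)" unfolding b_def by (simp add: real_sqrt_mult mult.assoc[symmetric])
      then show ?thesis by (simp add: real_sqrt_divide L_def mult.assoc)
    qed
    also have "sqrt (2 * (me + mu) / real n) / \<bar>r n\<bar> = sqrt (2 * (me + mu) / ((r n)\<^sup>2 * real n))"
      by (simp add: real_sqrt_divide real_sqrt_mult)
    finally have R'_le: "expectation R' \<le> 2 * q" using elim(1,2) by linarith
    define S4 where "S4 \<omega> = (\<Sum>i<n. norm (U \<omega> i) ^ 4) / real n" for \<omega>
    define bd where "bd \<omega> = (\<Sum>i<n. 8 * norm (E \<omega> i) ^ 4 + 8 * C ^ 4 * norm (V \<omega> i) ^ 4) / real n" for \<omega>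
    have S4_le: "S4 \<omega> \<le> bd \<omega>" for \<omega>
      unfolding S4_def bd_def
    proof (intro divide_right_mono sum_mono)
      fix i
      have "(norm (U \<omega> i))\<^sup>2 \<le> 2 * (norm (E \<omega> i))\<^sup>2 + 2 * (norm (r n *\<^sub>R V \<omega> i))\<^sup>2"
        unfolding U_def by (rule norm_add_sq_le)
      then have "((norm (U \<omega> i))\<^sup>2)\<^sup>2 \<le> (2 * (norm (E \<omega> i))\<^sup>2 + 2 * (norm (r n *\<^sub>R V \<omega> i))\<^sup>2)\<^sup>2"
        by (rule power_mono) simp
      also have "\<dots> \<le> 2 * (2 * (norm (E \<omega> i))\<^sup>2)\<^sup>2 + 2 * (2 * (norm (r n *\<^sub>R V \<omega> i))\<^sup>2)\<^sup>2"
        using norm_add_sq_le[of "2 * (norm (E \<omega> i))\<^sup>2" "2 * (norm (r n *\<^sub>R V \<omega> i))\<^sup>2"] by simp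
      also have "\<dots> = 8 * norm (E \<omega> i) ^ 4 + 8 * (\<bar>r n\<bar> ^ 4 * norm (V \<omega> i) ^ 4)"
        by (simp add: power_mult_distrib power_mult[symmetric])
      also have "\<dots> \<le> 8 * norm (E \<omega> i) ^ 4 + 8 * (C ^ 4 * norm (V \<omega> i) ^ 4)"
        using r[of n] n0 by (intro add_left_mono mult_left_mono mult_right_mono power_mono) auto
      finally show "norm (U \<omega> i) ^ 4 \<le> 8 * norm (E \<omega> i) ^ 4 + 8 * C ^ 4 * norm (V \<omega> i) ^ 4"
        by (simp add: power_mult[symmetric])
    qed simp
    have eZ: "integrable M (\<lambda>\<omega>. norm (E \<omega> i) ^ 4)" "expectation (\<lambda>\<omega>. norm (E \<omega> i) ^ 4) = me" for i
      using integrable_Z[of "\<lambda>z. norm (e z) ^ 4"] integral_Z[of "\<lambda>z. norm (e z) ^ 4"] e4 by (auto simp: E_def me_def)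
    have uZ: "integrable M (\<lambda>\<omega>. norm (V \<omega> i) ^ 4)" "expectation (\<lambda>\<omega>. norm (V \<omega> i) ^ 4) = mu" for i
      using integrable_Z[of "\<lambda>z. norm (u z) ^ 4"] integral_Z[of "\<lambda>z. norm (u z) ^ 4"] u4 by (auto simp: V_def mu_def)
    have bd_int: "integrable M bd" unfolding bd_def using eZ uZ by auto
    have bd_exp: "expectation bd = m"
      unfolding bd_def using eZ uZ n0 by (simp add: m_def)
    have bd_nn: "0 \<le> bd \<omega>" for \<omega> unfolding bd_def by (intro divide_nonneg_nonneg sum_nonneg) auto
    define bad1 where "bad1 = {\<omega> \<in> space M. R' \<omega> \<ge> c0 / 2}"
    define bad2 where "bad2 = {\<omega> \<in> space M. bd \<omega> \<ge> B}"
    define good where "good = {\<omega> \<in> space M. thr n \<le> studentized K (h n) n (\<lambda>i. U \<omega> i) (\<lambda>i. f (w (Z i \<omega>)))}"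
    have bad1: "bad1 \<in> events" "prob bad1 \<le> \<xi> / 2"
    proof -
      show "bad1 \<in> events" unfolding bad1_def using R'_int by measurable
      have "prob bad1 \<le> expectation R' / (c0 / 2)"
        unfolding bad1_def by (rule integral_Markov_inequality_measure[OF R'_int sets.top]) (use R'_nn c0 in auto)
      also have "\<dots> \<le> 2 * q / (c0 / 2)" using R'_le c0 by (intro divide_right_mono) auto
      finally show "prob bad1 \<le> \<xi> / 2" using c0 by (simp add: q_def)
    qed
    have bad2: "bad2 \<in> events" "prob bad2 \<le> \<xi> / 2"
    proof -
      show "bad2 \<in> events" unfolding bad2_def using bd_int by measurable
      have "prob bad2 \<le> expectation bd / B"
        unfolding bad2_def by (rule integral_Markov_inequality_measure[OF bd_int sets.top]) (use bd_nn B in auto)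
      also have "\<dots> = m / (m + 1) * (\<xi> / 2)" unfolding bd_exp B_def using m xi by (simp add: field_simps)
      also have "\<dots> \<le> 1 * (\<xi> / 2)" using m xi by (intro mult_right_mono) auto
      finally show "prob bad2 \<le> \<xi> / 2" by simp
    qed
    have good: "good \<in> events"
    proof -
      have "(\<lambda>\<omega>. studentized K (h n) n (\<lambda>i. U \<omega> i) (\<lambda>i. f (w (Z i \<omega>)))) \<in> borel_measurable M"
        unfolding U_def E_def V_def by (rule measurable_studentized) measurable
      then show ?thesis unfolding good_def by measurable
    qed
    have "space M - (bad1 \<union> bad2) \<subseteq> good"
    proof
      fix \<omega> assume \<omega>: "\<omega> \<in> space M - (bad1 \<union> bad2)"
      then have lt: "R' \<omega> < c0 / 2" "bd \<omega> < B" by (auto simp: bad1_def bad2_def not_le)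
      have Weq: "W \<omega> (U \<omega>) (U \<omega>) = W \<omega> (E \<omega>) (E \<omega>) + 2 * r n * W \<omega> (E \<omega>) (V \<omega>) + (r n)\<^sup>2 * W \<omega> (V \<omega>) (V \<omega>)"
        unfolding W_def U_def by (rule wform_add_scale) (rule weight_commute)
      have "(r n)\<^sup>2 * (c0 / 2) \<le> (r n)\<^sup>2 * (c0 - R' \<omega>)" using lt by (intro mult_left_mono) auto
      also have "\<dots> = (r n)\<^sup>2 * (c0 - R \<omega>) - \<bar>a1 \<omega>\<bar> - 2 * (\<bar>r n\<bar> * \<bar>a2 \<omega>\<bar>)"
        unfolding R'_def using rn by (simp add: field_simps power2_eq_square abs_if)
      also have "\<dots> \<le> (r n)\<^sup>2 * (W \<omega> (V \<omega>) (V \<omega>) / b) + a1 \<omega> + 2 * (r n * a2 \<omega>)"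
      proof -
        have "(r n)\<^sup>2 * (c0 - R \<omega>) \<le> (r n)\<^sup>2 * (W \<omega> (V \<omega>) (V \<omega>) / b)"
          using R(4)[of \<omega>] unfolding W_def V_def by (intro mult_left_mono) auto
        moreover have "- (\<bar>r n\<bar> * \<bar>a2 \<omega>\<bar>) \<le> r n * a2 \<omega>" using abs_ge_minus_self[of "r n * a2 \<omega>"] by (simp add: abs_mult)
        ultimately show ?thesis by linarith
      qed
      also have "\<dots> = W \<omega> (U \<omega>) (U \<omega>) / b" unfolding Weq a1_def a2_def by (simp add: add_divide_distrib algebra_simps)
      finally have W_ge: "(r n)\<^sup>2 * (c0 / 2) \<le> W \<omega> (U \<omega>) (U \<omega>) / b" .
      have "real n * sqrt (h n) * ((r n)\<^sup>2 * (c0 / 2) / sqrt (8 * K 0 * B)) \<le> studentized K (h n) n (U \<omega>) (\<lambda>i. f (w (Z i \<omega>)))"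
      proof (rule studentized_ge[OF hn elim(7)])
        show "0 < (r n)\<^sup>2 * (c0 / 2)" using rn c0 by simp
        show "(\<Sum>i<n. norm (U \<omega> i) ^ 4) / real n \<le> B" using S4_le[of \<omega>] lt(2) by (simp add: S4_def)
        show "(r n)\<^sup>2 * (c0 / 2) \<le> wform n (weight K (h n) n (\<lambda>i. f (w (Z i \<omega>)))) (U \<omega>) (U \<omega>) / (real n * (real n * h n))"
          using W_ge by (simp add: W_def b_def)
      qed
      moreover have "thr n \<le> real n * sqrt (h n) * ((r n)\<^sup>2 * (c0 / 2) / sqrt (8 * K 0 * B))"
      proof -
        have sq: "sqrt (8 * K 0 * B) > 0" using K0_pos B by simp
        have "2 * sqrt (8 * K 0 * B) / c0 * thr n \<le> (r n)\<^sup>2 * real n * sqrt (h n)"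
          using elim(3,5) by (simp add: le_divide_eq)
        then show ?thesis using sq c0 by (simp add: field_simps)
      qed
      ultimately show "\<omega> \<in> good" using \<omega> by (simp add: good_def)
    qed
    then have "prob (space M - (bad1 \<union> bad2)) \<le> prob good" using good by (intro finite_measure_mono)
    moreover have "prob (space M - (bad1 \<union> bad2)) = 1 - prob (bad1 \<union> bad2)"
      using bad1 bad2 by (intro prob_compl) auto
    moreover have "prob (bad1 \<union> bad2) \<le> prob bad1 + prob bad2" using bad1 bad2 by (intro measure_Un_le) auto
    ultimately have "1 - \<xi> \<le> prob good" using bad1 bad2 by linarith
    then show ?case by (simp add: good_def U_def E_def V_def u_def)
  qed
qed

end

section \<open>Passage from the hypotheses to the law of one observation\<close>

lemma (in finite_measure) cond_mean_nonzero_imp_set_integral_nonzero: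
  fixes D Y :: "'a \<Rightarrow> 'b::{banach, second_countable_topology}" and V :: "'a \<Rightarrow> real"
  assumes V[measurable]: "V \<in> borel_measurable M"
    and Y: "has_cond_exp M (sigma_of M V) D Y" and ne: "\<not> (AE \<omega> in M. Y \<omega> = 0)"
  obtains A where "A \<in> sets borel" "(\<integral>\<omega>. indicator A (V \<omega>) *\<^sub>R D \<omega> \<partial>M) \<noteq> 0"
proof (rule ccontr)
  assume "\<not> thesis"
  then have zero: "(\<integral>\<omega>. indicator A (V \<omega>) *\<^sub>R D \<omega> \<partial>M) = 0" if "A \<in> sets borel" for A using that \<open>\<And>A. A \<in> sets borel \<Longrightarrow> _ \<Longrightarrow> thesis\<close> by blast
  let ?F = "sigma_of M V"
  have sub: "subalgebra M ?F" unfolding subalgebra_def by (auto simp: sets_vimage_algebra2)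
  have YF: "Y \<in> borel_measurable ?F" and Y_int: "integrable M Y"
    and eq: "\<And>A. A \<in> sets ?F \<Longrightarrow> set_lebesgue_integral M A Y = set_lebesgue_integral M A D"
    using Y by (auto simp: has_cond_exp_def)
  \<comment> \<open>If all set integrals of \<open>D\<close> vanish, so do those of \<open>Y\<close>
    over the sigma-algebra for which \<open>Y\<close> is measurable; then \<open>Y\<close> is zero
    almost everywhere, against \<open>ne\<close>.\<close>
  have "AE \<omega> in restr_to_subalg M ?F. Y \<omega> = 0"
  proof (rule sigma_finite_measure.density_zero)
    show "sigma_finite_measure (restr_to_subalg M ?F)"
      using finite_measure_restr_to_subalg[OF sub finite_measure_axioms] by (simp add: finite_measure_def)
    show "integrable (restr_to_subalg M ?F) Y" using sub YF Y_int by (rule integrable_in_subalg)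
    fix E assume "E \<in> sets (restr_to_subalg M ?F)"
    then have E: "E \<in> sets ?F" by (simp add: sets_restr_to_subalg[OF sub])
    then obtain A where A: "A \<in> sets borel" "E = V -` A \<inter> space M" by (auto simp: sets_vimage_algebra2)
    have "set_lebesgue_integral (restr_to_subalg M ?F) E Y = set_lebesgue_integral M E Y"
      unfolding set_lebesgue_integral_def
      by (rule integral_subalgebra2[OF sub]) (intro borel_measurable_scaleR borel_measurable_indicator E YF)
    also have "\<dots> = set_lebesgue_integral M E D" by (rule eq[OF E])
    also have "\<dots> = (\<integral>\<omega>. indicator A (V \<omega>) *\<^sub>R D \<omega> \<partial>M)"
      unfolding set_lebesgue_integral_def
      by (intro Bochner_Integration.integral_cong refl) (auto simp: A indicator_def)
    finally show "set_lebesgue_integral (restr_to_subalg M ?F) E Y = 0" using zero[OF A(1)] by simp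
  qed
  then have "AE \<omega> in M. Y \<omega> = 0" by (rule AE_restr_to_subalg[OF sub])
  with ne show False by simp
qed

text \<open>Transfers centering to the law of the pair, on which the sample is modelled, with
  \<open>snd\<close> as the conditioning variable. Set integrals over preimages under
  \<open>X\<close> are those in \<open>has_cond_exp\<close>.\<close>

lemma has_cond_exp_zero_imp_cond_centered:
  fixes U X :: "'w \<Rightarrow> 'b::{real_inner, banach, second_countable_topology}"
  assumes U[measurable]: "U \<in> borel_measurable M" and X[measurable]: "X \<in> borel_measurable M"
    and zero: "has_cond_exp M (sigma_of M X) U (\<lambda>_. 0)"
  shows "cond_centered (distr M borel (\<lambda>\<omega>. (U \<omega>, X \<omega>))) borel snd fst"
proof (rule cond_centeredI)
  have fst[measurable]: "(fst :: 'b \<times> 'b \<Rightarrow> 'b) \<in> borel_measurable borel"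
    and snd[measurable]: "(snd :: 'b \<times> 'b \<Rightarrow> 'b) \<in> borel_measurable borel"
    by (auto intro!: borel_measurable_continuous_onI continuous_intros)
  have UX[measurable]: "(\<lambda>\<omega>. (U \<omega>, X \<omega>)) \<in> borel_measurable M" by measurable
  have Ui: "integrable M U" using zero by (simp add: has_cond_exp_def)
  show "integrable (distr M borel (\<lambda>\<omega>. (U \<omega>, X \<omega>))) fst"
    using Ui by (subst integrable_distr_eq) auto
  show "snd \<in> distr M borel (\<lambda>\<omega>. (U \<omega>, X \<omega>)) \<rightarrow>\<^sub>M (borel :: 'b measure)" by simp
  fix A :: "'b set" assume A[measurable]: "A \<in> sets borel"
  let ?E = "X -` A \<inter> space M"
  have "(\<integral>y. indicator A (snd y) *\<^sub>R fst y \<partial>distr M borel (\<lambda>\<omega>. (U \<omega>, X \<omega>))) = (\<integral>\<omega>. indicator A (X \<omega>) *\<^sub>R U \<omega> \<partial>M)"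
    by (subst integral_distr) auto
  also have "\<dots> = set_lebesgue_integral M ?E U"
    unfolding set_lebesgue_integral_def
    by (intro Bochner_Integration.integral_cong refl) (auto simp: indicator_def)
  also have "\<dots> = 0"
  proof -
    have "?E \<in> sets (sigma_of M X)" using A by (auto simp: sets_vimage_algebra2)
    then show ?thesis using zero by (simp add: has_cond_exp_def)
  qed
  finally show "(\<integral>y. indicator A (snd y) *\<^sub>R fst y \<partial>distr M borel (\<lambda>\<omega>. (U \<omega>, X \<omega>))) = 0" .
qed

lemma (in finite_measure) integrable_power4_if_power8:
  fixes u :: "'a \<Rightarrow> 'b::{real_normed_vector, second_countable_topology}"
  assumes "u \<in> borel_measurable M" and u8: "integrable M (\<lambda>x. norm (u x) ^ 8)"
  shows "integrable M (\<lambda>x. norm (u x) ^ 4)"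
proof (rule Bochner_Integration.integrable_bound)
  show "integrable M (\<lambda>x. 1 + norm (u x) ^ 8)" using u8 by simp
  show "AE x in M. norm (norm (u x) ^ 4) \<le> norm (1 + norm (u x) ^ 8)"
  proof (rule AE_I2)
    fix x
    have "2 * norm (u x) ^ 4 \<le> norm (u x) ^ 8 + 1"
      using weighted_AM_GM[of 1 "norm (u x) ^ 4" 1] by (simp add: power_mult[symmetric])
    moreover have "0 \<le> norm (u x) ^ 4" by simp
    ultimately have "norm (u x) ^ 4 \<le> 1 + norm (u x) ^ 8" by linarith
    then show "norm (norm (u x) ^ 4) \<le> norm (1 + norm (u x) ^ 8)" by simp
  qed
qed (use assms in measurable)

text \<open>The direction \<open>g\<close> may be random, as is needed for
  \<open>\<gamma>hat\<close>. Coordinates are continuous in the product topology, so each component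
  of the direction is measurable.\<close>

lemma measurable_proj:
  assumes [measurable]: "x \<in> borel_measurable M" and g: "g \<in> borel_measurable M"
  shows "(\<lambda>\<omega>. proj \<psi> q (g \<omega>) (x \<omega>)) \<in> borel_measurable M"
proof -
  have "(\<lambda>\<omega>. g \<omega> j) \<in> borel_measurable M" for j
    by (rule measurable_compose[OF g borel_measurable_continuous_onI]) (rule continuous_on_product_coordinates)
  then show ?thesis unfolding proj_def by measurable
qed

lemma proj_mono_dim:
  assumes "q \<le> q'" "\<And>j. j \<ge> q \<Longrightarrow> \<gamma> j = 0"
  shows "proj \<psi> q' \<gamma> x = proj \<psi> q \<gamma> x"
  unfolding proj_def using assms by (intro sum.mono_neutral_right) auto

theorem theorem6:
  fixes M :: "'w measure"
    and U0 X :: "'w \<Rightarrow> l2"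
    and U0s Xs :: "nat \<Rightarrow> 'w \<Rightarrow> l2"
    and \<delta> :: "l2 \<Rightarrow> l2"
    and \<psi> :: "nat \<Rightarrow> l2"
    and b0 :: "nat \<Rightarrow> real"
    and B :: "nat \<Rightarrow> (nat \<Rightarrow> real) set"
    and K :: "real \<Rightarrow> real"
    and r h \<alpha> :: "nat \<Rightarrow> real"
    and p :: "nat \<Rightarrow> nat"
    and \<gamma>hat :: "nat \<Rightarrow> 'w \<Rightarrow> nat \<Rightarrow> real"
    and Us :: "nat \<Rightarrow> nat \<Rightarrow> 'w \<Rightarrow> l2"
    and stat :: "nat \<Rightarrow> (nat \<Rightarrow> real) \<Rightarrow> 'w \<Rightarrow> real"
  assumes M: "prob_space M"
    and basis: "orthonormal_basis \<psi>"
    and U0_measurable: "U0 \<in> borel_measurable M"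
    and X_measurable: "X \<in> borel_measurable M"
    and X_centered: "integral\<^sup>L M X = 0"
    and U0_cond: "has_cond_exp M (sigma_of M X) U0 (\<lambda>_. 0)"
    and \<delta>_measurable: "\<delta> \<in> borel_measurable borel"
    and r: "(antimono_on {1..} r \<and> r \<longlonglongrightarrow> 0) \<or> (\<forall>n\<ge>1. r n = 1)"
    and a1_indep: "prob_space.indep_vars M (\<lambda>_. borel) (\<lambda>i \<omega>. (U0s i \<omega>, Xs i \<omega>)) UNIV"
    and a1_distr: "\<And>i. distr M borel (\<lambda>\<omega>. (U0s i \<omega>, Xs i \<omega>)) = distr M borel (\<lambda>\<omega>. (U0 \<omega>, X \<omega>))"
    and a1_U0_moment: "integrable M (\<lambda>\<omega>. norm (U0 \<omega>) ^ 8)"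
    and a1_X_moment: "\<exists>\<rho>>0. integrable M (\<lambda>\<omega>. exp (\<rho> * norm (X \<omega>)))"
    and a2: "\<And>q \<gamma>. q \<ge> 1 \<Longrightarrow> \<gamma> \<in> unit_sphere q \<Longrightarrow>
        continuous_on UNIV (cdf (distr M borel (\<lambda>\<omega>. proj \<psi> q \<gamma> (X \<omega>))))"
    and a3: "\<exists>sigma2>0. \<exists>C1>0. \<exists>C2>0. \<exists>\<nu>>2.
        (AE \<omega> in M. sigma2 \<le>
          real_cond_exp M (sigma_of M (\<lambda>\<omega>. (Xs 0 \<omega>, Xs 1 \<omega>)))
            (\<lambda>\<omega>. (inner (U0s 0 \<omega>) (U0s 1 \<omega>))\<^sup>2 * of_bool (\<bar>inner (U0s 0 \<omega>) (U0s 1 \<omega>)\<bar> \<le> C1)) \<omega>) \<and>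
        (AE \<omega> in M.
          nn_cond_exp M (sigma_of M X) (\<lambda>\<omega>. ennreal (norm (U0 \<omega>) powr \<nu>)) \<omega> \<le> ennreal C2)"
    and b0_summable: "summable (\<lambda>j. (b0 j)\<^sup>2)"
    and b0_pos: "\<And>n. n \<ge> 1 \<Longrightarrow> (\<Sum>j<p n. (b0 j)\<^sup>2) > 0"
    and a4_dir: "\<And>q. q \<ge> 1 \<Longrightarrow> (\<Sum>j<q. (b0 j)\<^sup>2) > 0 \<Longrightarrow> normalized_dir b0 q \<in> B q"
    and a4_open: "\<And>q. q \<ge> 1 \<Longrightarrow> openin (top_of_set (unit_sphere q)) (B q)"
    and a4_nested: "\<And>q q'. 1 \<le> q \<Longrightarrow> q < q' \<Longrightarrow> B q \<subseteq> B q'"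
    and K_cont: "continuous_on UNIV K"
    and K_nonneg: "\<And>x. K x \<ge> 0"
    and K_integrable: "integrable lborel K"
    and K_integral: "integral\<^sup>L lborel K = 1"
    and K_even: "\<And>x. K x = K (- x)"
    and K_antimono: "antimono_on {0..} K"
    and K_fourier: "integrable lborel (fourier K)"
    and K_lipschitz: "\<exists>C. \<forall>u v. \<bar>K u - K v\<bar> \<le> C * \<bar>u - v\<bar>"
    and h_pos: "\<And>n. n \<ge> 1 \<Longrightarrow> h n > 0"
    and h_lim: "h \<longlonglongrightarrow> 0"
    and h2: "filterlim (\<lambda>n. real n * h n ^ 2) at_top sequentially"
    and h4: "filterlim (\<lambda>n. real n * h n ^ 4) at_top sequentially"
    and p_ge: "\<And>n. n \<ge> 1 \<Longrightarrow> p n \<ge> 1"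
    and p_mono: "mono_on {1..} p"
    and p_lim: "filterlim p at_top sequentially"
    and p_growth: "\<exists>lam>0. Bseq (\<lambda>n. real (p n) * ln (real n) powr (- lam))"
    and \<alpha>_pos: "\<And>n. n \<ge> 1 \<Longrightarrow> \<alpha> n > 0"
    and c1: "filterlim (\<lambda>n. \<alpha> n / (real (p n) * ln (real n))) at_top sequentially"
    and c2: "filterlim (\<lambda>n. (r n)\<^sup>2 * real n * sqrt (h n) / \<alpha> n) at_top sequentially"
    and d_mean: "integral\<^sup>L M (\<lambda>\<omega>. \<delta> (X \<omega>)) = 0"
    and d_moment: "integrable M (\<lambda>\<omega>. norm (\<delta> (X \<omega>)) ^ 8)"
    and d_pos: "0 < integral\<^sup>L M (\<lambda>\<omega>. norm (\<delta> (X \<omega>)) ^ 8)"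
    and e: "\<exists>pt\<ge>1. \<exists>\<gamma>t\<in>B pt.
        (\<exists>Y. has_cond_exp M (sigma_of M (\<lambda>\<omega>. proj \<psi> pt \<gamma>t (X \<omega>))) (\<lambda>\<omega>. \<delta> (X \<omega>)) Y \<and>
             \<not> (AE \<omega> in M. Y \<omega> = 0)) \<and>
        (let F = cdf (distr M borel (\<lambda>\<omega>. proj \<psi> pt \<gamma>t (X \<omega>)));
             V = (\<lambda>\<omega>. F (proj \<psi> pt \<gamma>t (X \<omega>)))
         in \<exists>d. measurable_version \<delta> d \<and>
              (\<forall>t\<in>{0..1}. \<exists>\<delta>bar \<in> borel_measurable borel.
                 (\<forall>v. v \<notin> {0..1} \<longrightarrow> \<delta>bar v = 0) \<and>
                 has_cond_exp M (sigma_of M V) (\<lambda>\<omega>. d (X \<omega>) t) (\<lambda>\<omega>. \<delta>bar (V \<omega>)) \<and>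
                 integrable lborel (fourier \<delta>bar)))"
    and Us_def: "\<And>n i \<omega>. Us n i \<omega> = U0s i \<omega> + r n *\<^sub>R \<delta> (Xs i \<omega>)"
    and stat_def: "\<And>n \<gamma> \<omega>. stat n \<gamma> \<omega> =
        studentized K (h n) n (\<lambda>i. Us n i \<omega>) (\<lambda>i. proj \<psi> (p n) \<gamma> (Xs i \<omega>))"
    and \<gamma>hat_measurable: "\<And>n. n \<ge> 1 \<Longrightarrow> \<gamma>hat n \<in> borel_measurable M"
    and \<gamma>hat_argmax: "\<And>n \<omega>. n \<ge> 1 \<Longrightarrow> \<omega> \<in> space M \<Longrightarrow>
        is_arg_max (\<lambda>\<gamma>. stat n \<gamma> \<omega> - \<alpha> n * of_bool (\<gamma> \<noteq> normalized_dir b0 (p n)))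
          (\<lambda>\<gamma>. \<gamma> \<in> B (p n)) (\<gamma>hat n \<omega>)"
  shows "\<forall>a\<in>{0<..<1}.
      (\<lambda>n. measure M {\<omega> \<in> space M. stat n (\<gamma>hat n \<omega>) \<omega> \<ge> std_normal_quantile (1 - a)}) \<longlonglongrightarrow> 1"
proof
  fix a :: real assume "a \<in> {0<..<1}"
  interpret prob_space M by (rule M)
  interpret kernel K
    using K_cont K_nonneg K_integrable K_integral K_even K_antimono by unfold_locales
  obtain pt \<gamma>t Y where pt: "pt \<ge> 1" and \<gamma>t: "\<gamma>t \<in> B pt"
    and Y: "has_cond_exp M (sigma_of M (\<lambda>\<omega>. proj \<psi> pt \<gamma>t (X \<omega>))) (\<lambda>\<omega>. \<delta> (X \<omega>)) Y"
      "\<not> (AE \<omega> in M. Y \<omega> = 0)"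
    using e by blast
  have \<gamma>t_sphere: "\<gamma>t \<in> unit_sphere pt"
    using openin_imp_subset[OF a4_open[OF pt]] \<gamma>t by auto
  define P where "P = distr M borel (\<lambda>\<omega>. (U0 \<omega>, X \<omega>))"
  define Z where "Z = (\<lambda>i \<omega>. (U0s i \<omega>, Xs i \<omega>))"
  interpret iid_sample M "borel :: (l2 \<times> l2) measure" P Z
    by standard (use a1_indep a1_distr in \<open>auto simp: Z_def P_def\<close>)
  interpret P: prob_space P by (rule prob_space_P)
  define f where "f x = proj \<psi> pt \<gamma>t x" for x
  have f[measurable]: "f \<in> borel_measurable borel" unfolding f_def proj_def by measurable
  have fst_m[measurable]: "(fst :: l2 \<times> l2 \<Rightarrow> l2) \<in> borel_measurable borel"
    and snd_m[measurable]: "(snd :: l2 \<times> l2 \<Rightarrow> l2) \<in> borel_measurable borel"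
    by (auto intro!: borel_measurable_continuous_onI continuous_intros)
  note [measurable] = U0_measurable X_measurable \<delta>_measurable
  \<comment> \<open>Observations are pairs of noise and covariate; they enter the weights through
    the covariate, and the ranked score is the projection onto the fixed direction
    \<open>\<gamma>t\<close>.\<close>
  interpret weighted_sample M "borel :: (l2 \<times> l2) measure" P Z K "borel :: l2 measure" snd f
    by standard measurable
  have [measurable]: "Xs i \<in> borel_measurable M" "U0s i \<in> borel_measurable M" for i
    using measurable_compose[OF measurable_Z[of i] snd_m] measurable_compose[OF measurable_Z[of i] fst_m]
    by (simp_all add: Z_def)
  have centered: "cond_centered P borel snd fst"
    unfolding P_def using U0_measurable X_measurable U0_cond by (rule has_cond_exp_zero_imp_cond_centered)
  have UX[measurable]: "(\<lambda>\<omega>. (U0 \<omega>, X \<omega>)) \<in> borel_measurable M" by measurable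
  have e4: "integrable P (\<lambda>z. norm (fst z) ^ 4)"
    unfolding P_def using integrable_power4_if_power8[OF U0_measurable a1_U0_moment]
    by (subst integrable_distr_eq) auto
  have g4: "integrable P (\<lambda>z. norm (\<delta> (snd z)) ^ 4)"
    unfolding P_def using integrable_power4_if_power8[OF _ d_moment]
    by (subst integrable_distr_eq) auto
  have "(\<lambda>\<omega>. proj \<psi> pt \<gamma>t (X \<omega>)) \<in> borel_measurable M"
    using measurable_compose[OF X_measurable f] by (simp add: f_def)
  from cond_mean_nonzero_imp_set_integral_nonzero[OF this Y]
  obtain A where A: "A \<in> sets borel" and A_ne: "(\<integral>\<omega>. indicator A (f (X \<omega>)) *\<^sub>R \<delta> (X \<omega>) \<partial>M) \<noteq> 0"
    unfolding f_def .
  have ne: "(\<integral>z. indicator A (f (snd z)) *\<^sub>R \<delta> (snd z) \<partial>P) \<noteq> 0"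
  proof -
    have [measurable]: "A \<in> sets borel" by (rule A)
    have "(\<integral>z. indicator A (f (snd z)) *\<^sub>R \<delta> (snd z) \<partial>P) = (\<integral>\<omega>. indicator A (f (X \<omega>)) *\<^sub>R \<delta> (X \<omega>) \<partial>M)"
      unfolding P_def by (subst integral_distr) auto
    then show ?thesis using A_ne by simp
  qed
  have h_lt_1: "\<forall>\<^sub>F n in sequentially. h n < 1" by (rule order_tendstoD(2)[OF h_lim]) simp
  have nh: "filterlim (\<lambda>n. real n * h n) at_top sequentially"
  proof (rule filterlim_at_top_mono[OF h2])
    show "\<forall>\<^sub>F n in sequentially. real n * h n ^ 2 \<le> real n * h n"
      using h_lt_1 eventually_ge_at_top[of 1]
    proof eventually_elim
      case (elim n)
      then have "h n * h n \<le> h n * 1" using h_pos[of n] by (intro mult_left_mono) auto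
      then show ?case by (intro mult_left_mono) (auto simp: power2_eq_square)
    qed
  qed
  obtain C where C: "\<And>n. n \<ge> 1 \<Longrightarrow> \<bar>r n\<bar> \<le> C"
  proof -
    have "\<exists>C. \<forall>n\<ge>1. \<bar>r n\<bar> \<le> C"
      using r
    proof
      assume "antimono_on {1..} r \<and> r \<longlonglongrightarrow> 0"
      then have "Bseq r" by (auto intro: convergent_imp_Bseq convergentI)
      then show ?thesis by (auto simp: Bseq_def)
    qed (auto intro: exI[of _ 1])
    then show ?thesis using that by blast
  qed
  \<comment> \<open>For \<open>n \<ge> 3\<close> the divisor is at least 1, as
    \<open>exp 1 \<le> 3\<close> and \<open>p n \<ge> 1\<close>.\<close>
  have \<alpha>_inf: "filterlim \<alpha> at_top sequentially"
  proof (rule filterlim_at_top_mono[OF c1])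
    show "\<forall>\<^sub>F n in sequentially. \<alpha> n / (real (p n) * ln (real n)) \<le> \<alpha> n"
      using eventually_ge_at_top[of 3]
    proof eventually_elim
      case (elim n)
      have "exp 1 \<le> real n" using exp_le elim by (meson of_nat_le_iff of_nat_numeral order.trans numeral_le_real_of_nat_iff)
      then have "1 \<le> ln (real n)" using elim by (simp add: ln_ge_iff)
      moreover have "1 \<le> real (p n)" using p_ge[of n] elim by simp
      ultimately have "1 * 1 \<le> real (p n) * ln (real n)" by (intro mult_mono) auto
      then have "\<alpha> n * 1 \<le> \<alpha> n * (real (p n) * ln (real n))" "0 < real (p n) * ln (real n)"
        using \<alpha>_pos[of n] elim by (auto intro!: mult_left_mono)
      then show ?case by (simp add: divide_le_eq)
    qed
  qed
  \<comment> \<open>One \<alpha> pays for the penalty of \<open>\<gamma>t\<close>; the other remains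
    as a lower bound for the statistic at the maximizer and outgrows every quantile.\<close>
  define thr where "thr n = 2 * \<alpha> n" for n
  have thr: "\<forall>\<^sub>F n in sequentially. thr n \<ge> 1"
    using filterlim_at_top[THEN iffD1, OF \<alpha>_inf, rule_format, of 1] by (auto simp: thr_def elim: eventually_mono)
  have rthr: "filterlim (\<lambda>n. (r n)\<^sup>2 * real n * sqrt (h n) / thr n) at_top sequentially"
  proof -
    have "filterlim (\<lambda>n. 1 / 2 * ((r n)\<^sup>2 * real n * sqrt (h n) / \<alpha> n)) at_top sequentially"
      by (rule filterlim_tendsto_pos_mult_at_top[OF tendsto_const _ c2]) simp
    then show ?thesis by (simp add: thr_def)
  qed
  let ?z = "std_normal_quantile (1 - a)"
  let ?T = "\<lambda>n. {\<omega> \<in> space M. stat n (\<gamma>hat n \<omega>) \<omega> \<ge> ?z}"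
  have lower: "\<forall>\<^sub>F n in sequentially. 1 - \<xi> \<le> prob (?T n)" if xi: "\<xi> > 0" for \<xi>
  proof -
    have \<alpha>_z: "\<forall>\<^sub>F n in sequentially. \<alpha> n \<ge> ?z" using \<alpha>_inf by (simp add: filterlim_at_top)
    have p_pt: "\<forall>\<^sub>F n in sequentially. p n \<ge> pt" using p_lim by (simp add: filterlim_at_top)
    have "\<forall>\<^sub>F n in sequentially. 1 - \<xi> \<le> prob {\<omega> \<in> space M. thr n \<le>
        studentized K (h n) n (\<lambda>i. fst (Z i \<omega>) + r n *\<^sub>R \<delta> (snd (Z i \<omega>))) (\<lambda>i. f (snd (Z i \<omega>)))}"
      by (rule studentized_exceeds[OF centered e4 \<delta>_measurable g4 A ne _ h_lim nh _ thr rthr xi])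
        (use h_pos C in auto)
    then show ?thesis
      using \<alpha>_z p_pt eventually_ge_at_top[of 1]
    proof eventually_elim
      case (elim n)
      let ?good = "{\<omega> \<in> space M. thr n \<le> studentized K (h n) n (\<lambda>i. fst (Z i \<omega>) + r n *\<^sub>R \<delta> (snd (Z i \<omega>))) (\<lambda>i. f (snd (Z i \<omega>)))}"
      \<comment> \<open>Padding by zeros is the identity in this encoding, so the fixed direction
        gives the same projection in every dimension from \<open>pt\<close> on.\<close>
      have f_eq: "proj \<psi> (p n) \<gamma>t x = f x" for x
        unfolding f_def using elim(3) \<gamma>t_sphere by (intro proj_mono_dim) (auto simp: unit_sphere_def)
      have \<gamma>t_B: "\<gamma>t \<in> B (p n)"
        using a4_nested[OF pt, of "p n"] elim(3) \<gamma>t by (cases "pt = p n") auto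
      have "?good \<subseteq> ?T n"
      proof
        fix \<omega> assume \<omega>: "\<omega> \<in> ?good"
        then have sp: "\<omega> \<in> space M" and ge: "thr n \<le> stat n \<gamma>t \<omega>"
          by (auto simp: stat_def Us_def Z_def f_eq)
        let ?pen = "\<lambda>\<gamma>. \<alpha> n * of_bool (\<gamma> \<noteq> normalized_dir b0 (p n))"
        have "stat n \<gamma>t \<omega> - ?pen \<gamma>t \<le> stat n (\<gamma>hat n \<omega>) \<omega> - ?pen (\<gamma>hat n \<omega>)"
          using \<gamma>hat_argmax[OF elim(4) sp] \<gamma>t_B unfolding is_arg_max_def by (meson not_less)
        moreover have "0 \<le> ?pen (\<gamma>hat n \<omega>)" "?pen \<gamma>t \<le> \<alpha> n" using \<alpha>_pos[OF elim(4)] by (auto simp: of_bool_def)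
        ultimately have "?z \<le> stat n (\<gamma>hat n \<omega>) \<omega>" using ge elim(2) unfolding thr_def by linarith
        then show "\<omega> \<in> ?T n" using sp by simp
      qed
      \<comment> \<open>Monotonicity of the measure requires the larger set to be measurable, which
        rests on the measurability of \<open>\<gamma>hat n\<close>.\<close>
      moreover have "?T n \<in> events"
      proof -
        have "(\<lambda>\<omega>. studentized K (h n) n (\<lambda>i. Us n i \<omega>) (\<lambda>i. proj \<psi> (p n) (\<gamma>hat n \<omega>) (Xs i \<omega>))) \<in> borel_measurable M"
          by (intro measurable_studentized measurable_proj \<gamma>hat_measurable elim(4)) (simp_all add: Us_def)
        then show ?thesis unfolding stat_def by measurable
      qed
      ultimately have "prob ?good \<le> prob (?T n)" by (rule finite_measure_mono)
      then show ?case using elim(1) by linarith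
    qed
  qed
  show "(\<lambda>n. measure M (?T n)) \<longlonglongrightarrow> 1"
  proof (rule LIMSEQ_I)
    fix \<xi> :: real assume "\<xi> > 0"
    then have "\<forall>\<^sub>F n in sequentially. 1 - \<xi> / 2 \<le> prob (?T n)" by (intro lower) simp
    then have "\<forall>\<^sub>F n in sequentially. norm (prob (?T n) - 1) < \<xi>"
    proof eventually_elim
      case (elim n)
      moreover have "prob (?T n) \<le> 1" by (rule prob_le_1)
      ultimately show ?case using \<open>\<xi> > 0\<close> unfolding real_norm_def by linarith
    qed
    then show "\<exists>no. \<forall>n\<ge>no. norm (prob (?T n) - 1) < \<xi>" by (simp add: eventually_sequentially)
  qed
qed

end
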